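(* There is an absolute constant $c>0$ such that, for all sufficiently large integers $r$, $$m_{\le 4}(r)\ \ge\ c\, r^{-3}\sqrt{\log r}.$$
   Context: An $r$-graph is an $r$-uniform hypergraph (a finite vertex set with a set of $r$-element subsets called edges). $M_{\le 4}(n,r)$ denotes the maximum number of edges in an $n$-vertex $r$-graph in which the number of edges contained in every $(r+1)$-set of vertices lies in $\{0,2,4\}$. Define $$m_{\le 4}(r)=\lim_{n\to\infty}\frac{M_{\le 4}(n,r)}{\binom nr}.$$ This limit exists because, by averaging over $m$-vertex subsets, the sequence $M_{\le 4}(n,r)/\binom nr$ is nonincreasing in $n$. *)

theory Defs
  imports Complex_Main
begin

definition r_graph :: "nat \<Rightarrow> 'a set \<Rightarrow> 'a set set \<Rightarrow> bool" where
  "r_graph r V E \<longleftrightarrow> finite V \<and> (\<forall>e\<in>E. e \<subseteq> V \<and> card e = r)"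

definition even_le4_graph :: "nat \<Rightarrow> 'a set \<Rightarrow> 'a set set \<Rightarrow> bool" where
  "even_le4_graph r V E \<longleftrightarrow> r_graph r V E \<and>
     (\<forall>S. S \<subseteq> V \<and> card S = r + 1 \<longrightarrow> card {e \<in> E. e \<subseteq> S} \<in> {0, 2, 4})"

text \<open>Every finite \<open>r\<close>-graph is isomorphic to one whose vertices are natural numbers,
  so restricting the vertex type below loses nothing.\<close>

definition M_le4 :: "nat \<Rightarrow> nat \<Rightarrow> nat" where
  "M_le4 n r = Max {card E | (V :: nat set) E. card V = n \<and> even_le4_graph r V E}"

definition m_le4 :: "nat \<Rightarrow> real" where
  "m_le4 r = lim (\<lambda>n. real (M_le4 n r) / real (n choose r))"

text \<open>The maximum and the limit in these definitions exist.\<close>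

lemma r_graph_card_le:
  assumes "r_graph r V E"
  shows "finite E" "card E \<le> card V choose r"
proof -
  have V: "finite V" and sub: "E \<subseteq> {e. e \<subseteq> V \<and> card e = r}"
    using assms by (auto simp: r_graph_def)
  have fin: "finite {e. e \<subseteq> V \<and> card e = r}"
    using V by simp
  show "finite E" using finite_subset[OF sub fin] .
  show "card E \<le> card V choose r"
    using card_mono[OF fin sub] n_subsets[OF V] by simp
qed

lemma M_le4_finite:
  "finite {card E | (V :: nat set) E. card V = n \<and> even_le4_graph r V E}"
  by (rule finite_subset[of _ "{..n choose r}"])
    (auto simp: even_le4_graph_def dest: r_graph_card_le)

lemma M_le4_nonempty:
  "{card E | (V :: nat set) E. card V = n \<and> even_le4_graph r V E} \<noteq> {}"
proof -
  have "card {..<n} = n \<and> even_le4_graph r {..<n} {}"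
    by (simp add: even_le4_graph_def r_graph_def)
  then show ?thesis by blast
qed

lemma M_le4_upper:
  fixes V :: "nat set"
  assumes "even_le4_graph r V E"
  shows "card E \<le> M_le4 (card V) r"
  unfolding M_le4_def using assms by (intro Max_ge M_le4_finite) blast

lemma M_le4_attained:
  obtains V :: "nat set" and E where
    "card V = n" "even_le4_graph r V E" "card E = M_le4 n r"
  using Max_in[OF M_le4_finite M_le4_nonempty, of n r] unfolding M_le4_def by auto

lemma M_le4_averaging:
  assumes "r \<le> n"
  shows "(Suc n - r) * M_le4 (Suc n) r \<le> Suc n * M_le4 n r"
proof -
  obtain V :: "nat set" and E where V: "card V = Suc n" and E: "even_le4_graph r V E"
    and cE: "card E = M_le4 (Suc n) r"
    by (rule M_le4_attained)
  have rg: "r_graph r V E" using E by (simp add: even_le4_graph_def)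
  have fV: "finite V" using rg by (simp add: r_graph_def)
  have fE: "finite E" using r_graph_card_le[OF rg] by simp
  have del: "card {e \<in> E. v \<notin> e} \<le> M_le4 n r" if "v \<in> V" for v
  proof -
    have "{e. (e \<in> E \<and> v \<notin> e) \<and> e \<subseteq> S} = {e \<in> E. e \<subseteq> S}" if "S \<subseteq> V - {v}" for S
      using that by blast
    then have "even_le4_graph r (V - {v}) {e \<in> E. v \<notin> e}"
      using E by (auto simp: even_le4_graph_def r_graph_def)
    from M_le4_upper[OF this] show ?thesis using that V fV by simp
  qed
  have "(Suc n - r) * card E = (\<Sum>e\<in>E. card (V - e))"
  proof -
    have "card (V - e) = Suc n - r" if "e \<in> E" for e
      using that rg V fV by (auto simp: r_graph_def card_Diff_subset finite_subset)
    then show ?thesis by simp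
  qed
  also have "\<dots> = (\<Sum>e\<in>E. \<Sum>v\<in>V. if v \<notin> e then 1 else 0)"
    by (intro sum.cong refl) (simp add: sum.If_cases fV Diff_eq Compl_eq)
  also have "\<dots> = (\<Sum>v\<in>V. \<Sum>e\<in>E. if v \<notin> e then 1 else 0)"
    by (rule sum.swap)
  also have "\<dots> = (\<Sum>v\<in>V. card {e \<in> E. v \<notin> e})"
    by (intro sum.cong refl) (simp add: sum.If_cases fE Int_def)
  also have "\<dots> \<le> (\<Sum>v\<in>V. M_le4 n r)"
    by (rule sum_mono) (rule del)
  finally show ?thesis using V cE by simp
qed

lemma M_le4_ratio_antimono:
  assumes "r \<le> n"
  shows "real (M_le4 (Suc n) r) / real (Suc n choose r) \<le> real (M_le4 n r) / real (n choose r)"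
proof -
  have pos: "0 < n choose r" "0 < Suc n choose r" using assms by simp_all
  have b: "(Suc n - r) * (Suc n choose r) = Suc n * (n choose r)"
    using binomial_absorb_comp[of "Suc n" r] by simp
  have "(Suc n - r) * (M_le4 (Suc n) r * (n choose r)) \<le> Suc n * M_le4 n r * (n choose r)"
    using mult_right_mono[OF M_le4_averaging[OF assms], of "n choose r"]
    by (simp only: mult.assoc)
  also have "\<dots> = M_le4 n r * (Suc n * (n choose r))"
    by (simp only: ac_simps)
  also have "\<dots> = (Suc n - r) * (M_le4 n r * (Suc n choose r))"
    unfolding b[symmetric] by (simp only: ac_simps)
  finally have "M_le4 (Suc n) r * (n choose r) \<le> M_le4 n r * (Suc n choose r)"
    using assms by (simp only: mult_le_cancel1)
  then have "real (M_le4 (Suc n) r) * real (n choose r) \<le> real (M_le4 n r) * real (Suc n choose r)"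
    by (simp only: of_nat_mult[symmetric] of_nat_le_iff)
  then show ?thesis using pos by (simp add: divide_simps)
qed

lemma m_le4_LIMSEQ:
  "(\<lambda>n. real (M_le4 n r) / real (n choose r)) \<longlonglongrightarrow> m_le4 r"
proof -
  let ?f = "\<lambda>n. real (M_le4 n r) / real (n choose r)"
  have "decseq (\<lambda>n. ?f (n + r))"
    using M_le4_ratio_antimono[of r] by (intro decseq_SucI) simp
  then obtain L where "(\<lambda>n. ?f (n + r)) \<longlonglongrightarrow> L"
    using decseq_convergent[of "\<lambda>n. ?f (n + r)" 0] by auto
  then have "?f \<longlonglongrightarrow> L" by (rule LIMSEQ_offset)
  then show ?thesis unfolding m_le4_def using convergentI convergent_LIMSEQ_iff by blast
qed

end

theory Submission
  imports Defs "HOL-Real_Asymp.Real_Asymp" "HOL-Number_Theory.Cong" "HOL-Library.FuncSet"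
begin

text \<open>
  Write $k = r^2$ and let $V$ be the family of $(r-1)$-subsets of $[0, k)$ with a prescribed
  element sum modulo $k$. Two members of $V$ inside a common $(r+1)$-set $S$ are complements in $S$ of
  disjoint pairs, so if $H \subseteq V$ has at most two members in every $(r+1)$-set, then every
  $(r+1)$-set contains 0, 2 or 4 of the $r$-sets that contain a member of $H$. Blowing up these $r$-sets
  gives the lower bound on the limit density.

  The triples of members of $V$ that lie in a common $(r+1)$-set form a triple system with $O(r^4)$
  edges per vertex and codegrees at most $r + 1$, and $H$ has to be an independent set in it.
  By the theorem of Ajtai, Komlos, Pintz, Spencer and Szemeredi, in the form of Duke, Lefmann and
  Roedl, such a system has an independent set of relative size $\Omega(\sqrt{\log r}/r^2)$, which is
  where the factor $\sqrt{\log r}$ comes from. A random induced subsystem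
  has no short cycles after few deletions, and a semi-random greedy procedure is run on it: the vertices
  chosen in one round turn the triples through them into pairs. Absence of cycles of length at most four
  makes the survival events around a vertex independent, so that degrees are controlled by Chebyshev's
  inequality.
\<close>

section \<open>Random subsets of a finite set\<close>

text \<open>The choice of \<open>k\<close> balances two losses. Prescribing the residue costs a
  factor of order \<open>1 / k\<close>, so \<open>k\<close> should be small; comparing density
  inside \<open>[0, k)\<close> with density in the blow-ups costs
  \<open>(k choose r) * fact r / k ^ r\<close>, which stays bounded away from 0 only if
  \<open>k\<close> is at least of order \<open>r ^ 2\<close>. No \<open>r\<close>-set contains two
  members of \<open>V\<close>, and \<open>(k - s) * (k choose s) = r * (k choose r)\<close> for
  \<open>s = r - 1\<close>, so a family \<open>H\<close> of relative size \<open>h\<close> in a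
  typical residue class yields density of order \<open>h * r / k\<close>, which is
  \<open>h / r\<close>. The obstacle is that the triple system is far from locally sparse: with
  \<open>D\<close> of order \<open>r ^ 4\<close> bounding its average degree, codegrees may be of
  order \<open>D powr (1 / 4)\<close>. Sampling therefore has to thin it almost to constant degree,
  with probability close to \<open>D powr (- 1 / 2)\<close>. Stopping at degrees of order
  \<open>D powr (1 / 16)\<close> makes short cycles rare enough to delete and still costs only a
  constant factor in the logarithm.\<close>

definition bernoulli_sum :: "real \<Rightarrow> 'b set \<Rightarrow> ('b set \<Rightarrow> real) \<Rightarrow> real" where
  "bernoulli_sum p U f = (\<Sum>C\<in>Pow U. p ^ card C * (1 - p) ^ card (U - C) * f C)"

text \<open>The weight is that of independent choices with probability \<open>p\<close>, so weight
  times indicator is a product over the elements of \<open>U\<close>, and the sum over all subsets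
  is the expansion of \<open>\<Prod>x\<in>U. f x + g x\<close>. Setting \<open>f\<close> to 0 on
  \<open>Y\<close> kills the subsets that meet \<open>Y\<close>; setting \<open>g\<close> to 0 on
  \<open>A\<close> kills those that miss part of \<open>A\<close>.\<close>

lemma bernoulli_sum_cylinder:
  assumes U: "finite U" and sub: "A \<subseteq> U" "Y \<subseteq> U" and disj: "A \<inter> Y = {}"
  shows "bernoulli_sum p U (\<lambda>C. of_bool (A \<subseteq> C \<and> Y \<inter> C = {})) = p ^ card A * (1 - p) ^ card Y"
proof -
  define f where "f = (\<lambda>x. if x \<in> Y then 0 else p)"
  define g where "g = (\<lambda>x. if x \<in> A then 0 else 1 - p)"
  have fX: "prod f X = p ^ card X * of_bool (Y \<inter> X = {})" if "X \<subseteq> U" for X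
  proof (cases "Y \<inter> X = {}")
    case True
    then have "prod f X = prod (\<lambda>_. p) X" by (intro prod.cong) (auto simp: f_def)
    then show ?thesis using True by simp
  next
    case False
    then have "prod f X = 0" using finite_subset[OF that U] by (intro prod_zero) (auto simp: f_def)
    then show ?thesis using False by simp
  qed
  have gX: "prod g (U - X) = (1 - p) ^ card (U - X) * of_bool (A \<subseteq> X)" if "X \<subseteq> U" for X
  proof (cases "A \<subseteq> X")
    case True
    then have "prod g (U - X) = prod (\<lambda>_. 1 - p) (U - X)" by (intro prod.cong) (auto simp: g_def)
    then show ?thesis using True by simp
  next
    case False
    then have "prod g (U - X) = 0" using U sub by (intro prod_zero) (auto simp: g_def)
    then show ?thesis using False by simp
  qed
  have "bernoulli_sum p U (\<lambda>C. of_bool (A \<subseteq> C \<and> Y \<inter> C = {})) = (\<Sum>X\<in>Pow U. prod f X * prod g (U - X))"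
    unfolding bernoulli_sum_def by (intro sum.cong) (auto simp: fX gX)
  also have "\<dots> = (\<Prod>x\<in>U. f x + g x)" by (rule prod_add[OF U, symmetric])
  also have "\<dots> = (\<Prod>x\<in>U. (if x \<in> A then p else 1) * (if x \<in> Y then 1 - p else 1))"
    using disj by (intro prod.cong) (auto simp: f_def g_def)
  also have "\<dots> = p ^ card A * (1 - p) ^ card Y"
    using U sub by (simp add: prod.distrib prod.If_cases Int_absorb1)
  finally show ?thesis .
qed

lemma bernoulli_sum_const:
  assumes "finite U"
  shows "bernoulli_sum p U (\<lambda>_. c) = c"
  using bernoulli_sum_cylinder[OF assms, of "{}" "{}" p]
  by (simp add: bernoulli_sum_def flip: sum_distrib_right)

lemma bernoulli_sum_add: "bernoulli_sum p U (\<lambda>C. f C + g C) = bernoulli_sum p U f + bernoulli_sum p U g"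
  by (simp add: bernoulli_sum_def sum.distrib ring_distribs)

lemma bernoulli_sum_diff: "bernoulli_sum p U (\<lambda>C. f C - g C) = bernoulli_sum p U f - bernoulli_sum p U g"
  by (simp add: bernoulli_sum_def sum_subtractf ring_distribs)

lemma bernoulli_sum_cmult: "bernoulli_sum p U (\<lambda>C. c * f C) = c * bernoulli_sum p U f"
  by (simp add: bernoulli_sum_def sum_distrib_left mult_ac)

lemma bernoulli_sum_sum: "bernoulli_sum p U (\<lambda>C. \<Sum>i\<in>I. f i C) = (\<Sum>i\<in>I. bernoulli_sum p U (f i))"
  unfolding bernoulli_sum_def by (subst sum.swap) (simp add: sum_distrib_left)

lemma bernoulli_sum_mono:
  assumes "0 \<le> p" "p \<le> 1" "\<And>C. C \<subseteq> U \<Longrightarrow> f C \<le> g C"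
  shows "bernoulli_sum p U f \<le> bernoulli_sum p U g"
  unfolding bernoulli_sum_def using assms by (intro sum_mono mult_left_mono) auto

lemma bernoulli_sum_exists:
  assumes p: "0 \<le> p" "p \<le> 1" and U: "finite U" and c: "c \<le> bernoulli_sum p U f"
  obtains C where "C \<subseteq> U" "c \<le> f C"
proof -
  define m where "m = Max (f ` Pow U)"
  have "m \<in> f ` Pow U" unfolding m_def using U by (intro Max_in) auto
  moreover have "bernoulli_sum p U f \<le> m"
    using bernoulli_sum_mono[OF p, of U f "\<lambda>_. m"] U
    by (simp add: bernoulli_sum_const m_def)
  ultimately show ?thesis using c that by force
qed

text \<open>Two distinct events either depend on disjoint sets of elements, hence are independent,
  or contradict each other. So no covariance off the diagonal is positive, and the variance is at
  most the mean. \<open>\<mu>\<close> may be any upper bound for the mean, since only the upper tail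
  is wanted.\<close>

lemma bernoulli_sum_chebyshev:
  fixes A Y :: "'i \<Rightarrow> 'b set" and p \<mu> t :: real
  defines "X \<equiv> \<lambda>i C. of_bool (A i \<subseteq> C \<and> Y i \<inter> C = {}) :: real"
  defines "q \<equiv> \<lambda>i. p ^ card (A i) * (1 - p) ^ card (Y i)"
  assumes p: "0 \<le> p" "p \<le> 1" and U: "finite U" and I: "finite I"
    and sub: "\<And>i. i \<in> I \<Longrightarrow> A i \<subseteq> U \<and> Y i \<subseteq> U \<and> A i \<inter> Y i = {}"
    and dep: "\<And>i j. \<lbrakk>i \<in> I; j \<in> I; i \<noteq> j\<rbrakk> \<Longrightarrow>
        (A i \<union> Y i) \<inter> (A j \<union> Y j) = {} \<or> A i \<inter> Y j \<noteq> {} \<or> A j \<inter> Y i \<noteq> {}"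
    and mu: "(\<Sum>i\<in>I. q i) \<le> \<mu>" and t: "0 < t"
  shows "bernoulli_sum p U (\<lambda>C. of_bool (\<mu> + t < (\<Sum>i\<in>I. X i C))) \<le> \<mu> / t\<^sup>2"
proof -
  define Q where "Q = (\<Sum>i\<in>I. q i)"
  have q0: "0 \<le> q i" for i using p by (simp add: q_def)
  have EX: "bernoulli_sum p U (X i) = q i" if "i \<in> I" for i
    unfolding X_def q_def using sub[OF that] U by (intro bernoulli_sum_cylinder) auto
  have EXX: "bernoulli_sum p U (\<lambda>C. X i C * X j C) \<le> q i * q j + (if i = j then q i else 0)"
    if "i \<in> I" "j \<in> I" for i j
  proof (cases "i = j")
    case True
    have "(\<lambda>C. X i C * X i C) = X i" by (auto simp: X_def)
    then show ?thesis using True EX[OF that(1)] q0 by simp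
  next
    case False
    from dep[OF that False] show ?thesis
    proof (elim disjE)
      assume d: "(A i \<union> Y i) \<inter> (A j \<union> Y j) = {}"
      have fin: "finite (A i)" "finite (Y i)" "finite (A j)" "finite (Y j)"
        using sub[OF that(1)] sub[OF that(2)] U finite_subset by blast+
      have "(\<lambda>C. X i C * X j C) = (\<lambda>C. of_bool (A i \<union> A j \<subseteq> C \<and> (Y i \<union> Y j) \<inter> C = {}))"
        unfolding X_def by (intro ext) auto
      then have "bernoulli_sum p U (\<lambda>C. X i C * X j C) = p ^ card (A i \<union> A j) * (1 - p) ^ card (Y i \<union> Y j)"
        using sub[OF that(1)] sub[OF that(2)] U d by (simp only:) (rule bernoulli_sum_cylinder, auto)
      also have "\<dots> = q i * q j"
        using d fin by (subst (1 2) card_Un_disjoint) (auto simp: q_def power_add)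
      finally show ?thesis using False by simp
    next
      assume "A i \<inter> Y j \<noteq> {}"
      then have "(\<lambda>C. X i C * X j C) = (\<lambda>_. 0)" unfolding X_def by (intro ext) auto
      then show ?thesis using False q0 U by (simp add: bernoulli_sum_const)
    next
      assume "A j \<inter> Y i \<noteq> {}"
      then have "(\<lambda>C. X i C * X j C) = (\<lambda>_. 0)" unfolding X_def by (intro ext) auto
      then show ?thesis using False q0 U by (simp add: bernoulli_sum_const)
    qed
  qed
  have "(of_bool (\<mu> + t < (\<Sum>i\<in>I. X i C)) :: real) \<le> (1 / t\<^sup>2) * ((\<Sum>i\<in>I. X i C) - Q)\<^sup>2" for C
  proof (cases "\<mu> + t < (\<Sum>i\<in>I. X i C)")
    case True
    then have "t\<^sup>2 \<le> ((\<Sum>i\<in>I. X i C) - Q)\<^sup>2" using mu t unfolding Q_def by (intro power_mono) auto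
    then show ?thesis using True t by simp
  qed simp
  then have "bernoulli_sum p U (\<lambda>C. of_bool (\<mu> + t < (\<Sum>i\<in>I. X i C)))
      \<le> bernoulli_sum p U (\<lambda>C. (1 / t\<^sup>2) * ((\<Sum>i\<in>I. X i C) - Q)\<^sup>2)"
    by (intro bernoulli_sum_mono p)
  also have "\<dots> = (1 / t\<^sup>2) * bernoulli_sum p U (\<lambda>C. ((\<Sum>i\<in>I. X i C) - Q)\<^sup>2)"
    by (rule bernoulli_sum_cmult)
  also have "(\<lambda>C. ((\<Sum>i\<in>I. X i C) - Q)\<^sup>2) =
      (\<lambda>C. (\<Sum>i\<in>I. \<Sum>j\<in>I. X i C * X j C) - (2 * Q) * (\<Sum>i\<in>I. X i C) + Q\<^sup>2)"
    by (intro ext) (simp add: power2_eq_square algebra_simps sum_product)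
  also have "bernoulli_sum p U \<dots> = (\<Sum>i\<in>I. \<Sum>j\<in>I. bernoulli_sum p U (\<lambda>C. X i C * X j C)) - (2 * Q) * Q + Q\<^sup>2"
    by (simp add: bernoulli_sum_add bernoulli_sum_diff bernoulli_sum_cmult bernoulli_sum_sum
        bernoulli_sum_const U EX Q_def)
  also have "(\<Sum>i\<in>I. \<Sum>j\<in>I. bernoulli_sum p U (\<lambda>C. X i C * X j C)) \<le>
      (\<Sum>i\<in>I. \<Sum>j\<in>I. q i * q j + (if i = j then q i else 0))"
    by (intro sum_mono EXX)
  also have "\<dots> = Q\<^sup>2 + Q"
    using I by (simp add: sum.distrib Q_def power2_eq_square sum_product)
  also have "(1 / t\<^sup>2) * (Q\<^sup>2 + Q - 2 * Q * Q + Q\<^sup>2) = Q / t\<^sup>2"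
    by (simp add: power2_eq_square)
  also have "\<dots> \<le> \<mu> / t\<^sup>2" using mu by (simp add: Q_def divide_right_mono)
  finally show ?thesis using t by (simp add: divide_right_mono)
qed

section \<open>Locally sparse hypergraphs with edges of size two and three\<close>

text \<open>An edge set is a forest iff every finite nonempty \<open>F\<close> satisfies the inequality below, so this says
  that there are no cycles of length at most four. In this form the property passes to
  contractions without any case analysis.\<close>

definition locally_sparse :: "'a set set \<Rightarrow> bool" where
  "locally_sparse E \<longleftrightarrow>
     (\<forall>F\<subseteq>E. finite F \<and> F \<noteq> {} \<and> card F \<le> 4 \<longrightarrow> (\<Sum>f\<in>F. card f - 1) < card (\<Union>F))"

definition degree :: "nat \<Rightarrow> 'a set set \<Rightarrow> 'a \<Rightarrow> nat" where
  "degree j E v = card {e \<in> E. v \<in> e \<and> card e = j}"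

definition independent_set :: "'a set set \<Rightarrow> 'a set \<Rightarrow> bool" where
  "independent_set E I \<longleftrightarrow> (\<forall>e\<in>E. \<not> e \<subseteq> I)"

text \<open>The state between rounds: the original system has only triples, and pairs arise from
  triples of which one vertex has been chosen. The two kinds of degree evolve differently and carry
  separate bounds.\<close>

definition mixed_graph :: "'a set \<Rightarrow> 'a set set \<Rightarrow> real \<Rightarrow> real \<Rightarrow> bool" where
  "mixed_graph V E a d \<longleftrightarrow> finite V \<and> (\<forall>e\<in>E. e \<subseteq> V \<and> card e \<in> {2, 3}) \<and> locally_sparse E \<and>
     (\<forall>v\<in>V. real (degree 2 E v) \<le> a \<and> real (degree 3 E v) \<le> d)"

text \<open>The vertices whose choice in a round excludes \<open>u\<close> from the next one:
  \<open>u\<close> itself is then used up, or the other end of a pair through \<open>u\<close> is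
  taken.\<close>

definition nbhd :: "'a set set \<Rightarrow> 'a \<Rightarrow> 'a set" where
  "nbhd E u = insert u {x. {u, x} \<in> E}"

section \<open>Consequences of having no short cycles\<close>

lemma locally_sparse_list:
  assumes "locally_sparse E" "distinct fs" "set fs \<subseteq> E" "fs \<noteq> []" "length fs \<le> 4"
  shows "(\<Sum>f\<leftarrow>fs. card f - 1) < card (\<Union>(set fs))"
proof -
  have "card (set fs) \<le> 4" using assms by (simp add: distinct_card)
  then have "(\<Sum>f\<in>set fs. card f - 1) < card (\<Union>(set fs))"
    using assms unfolding locally_sparse_def by simp
  then show ?thesis using assms by (simp add: sum_list_distinct_conv_sum_set)
qed

lemma card_Un_shared:
  assumes "finite A" "finite B" "x \<in> A" "x \<in> B"
  shows "card (A \<union> B) + 1 \<le> card A + card B"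
proof -
  have "card (A \<union> B) + card (A \<inter> B) = card A + card B" using card_Un_Int[OF assms(1,2)] by simp
  moreover have "0 < card (A \<inter> B)" using assms by (auto simp: card_gt_0_iff)
  ultimately show ?thesis by simp
qed

text \<open>Two edges with two common vertices are a cycle of length two: their union has at most
  \<open>card e + card f - 2\<close> vertices, one fewer than sparsity demands.\<close>

lemma locally_sparse_linear:
  assumes sp: "locally_sparse E" and c: "\<And>e. e \<in> E \<Longrightarrow> finite e \<and> 2 \<le> card e"
    and e: "e \<in> E" "f \<in> E" "x \<in> e" "x \<in> f" "y \<in> e" "y \<in> f" "x \<noteq> y"
  shows "e = f"
proof (rule ccontr)
  assume ne: "e \<noteq> f"
  have fin: "finite e" "finite f" using c e by auto
  have "card {x, y} \<le> card (e \<inter> f)" using e fin by (intro card_mono) auto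
  then have "card (e \<union> f) + 2 \<le> card e + card f" using card_Un_Int[OF fin] e by simp
  moreover have "card e - 1 + (card f - 1) < card (e \<union> f)"
    using locally_sparse_list[OF sp, of "[e, f]"] ne e by simp
  moreover have "2 \<le> card e" "2 \<le> card f" using c e by auto
  ultimately show False by linarith
qed

lemma nbhd_not_mem:
  assumes sp: "locally_sparse E" and c: "\<And>e. e \<in> E \<Longrightarrow> card e \<in> {2, 3}"
    and f: "f \<in> E" "card f = 3" "v \<in> f" "u \<in> f" "u \<noteq> v"
  shows "v \<notin> nbhd E u"
proof
  assume "v \<in> nbhd E u"
  then have "{u, v} \<in> E" using f by (auto simp: nbhd_def)
  moreover have c2: "finite e \<and> 2 \<le> card e" if "e \<in> E" for e
    using c[OF that] by (auto intro: card_ge_0_finite)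
  ultimately have "f = {u, v}" using locally_sparse_linear[OF sp c2, of f "{u, v}" u v] f by blast
  then show False using f by (simp add: card_insert_if)
qed

text \<open>A common element \<open>x\<close> other than \<open>v\<close> closes the cycle
  \<open>f\<close>, \<open>{u, x}\<close>, \<open>{u', x}\<close>, \<open>f'\<close> through
  \<open>v\<close>; this is where cycles of length four have to be excluded. The cycle is shorter if
  \<open>f = f'\<close> or if \<open>{u, u'}\<close> is itself an edge, and those cases are treated
  alongside.\<close>

lemma nbhd_disjoint:
  assumes sp: "locally_sparse E" and c: "\<And>e. e \<in> E \<Longrightarrow> card e \<in> {2, 3}"
    and f: "f \<in> E" "v \<in> f" "u \<in> f" "u \<noteq> v"
    and f': "f' \<in> E" "v \<in> f'" "u' \<in> f'" "u' \<noteq> v" and ne: "u \<noteq> u'"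
  shows "nbhd E u \<inter> nbhd E u' \<subseteq> {v}"
proof
  fix x assume x: "x \<in> nbhd E u \<inter> nbhd E u'"
  have c2: "2 \<le> card e" "finite e" if "e \<in> E" for e
    using c[OF that] by (auto intro: card_ge_0_finite)
  have bound: "card (f \<union> f') + 1 \<le> card f + card f'"
    using f f' c2 by (intro card_Un_shared) auto
  have cards: "2 \<le> card f" "2 \<le> card f'" using c2 f f' by auto
  show "x \<in> {v}"
  proof (rule ccontr)
    assume xv: "x \<notin> {v}"
    show False
    proof (cases "{u, u'} \<in> E")
      case True
      have g: "{u, u'} \<noteq> f" "{u, u'} \<noteq> f'" using f f' by auto
      have "card f - 1 + 1 < card (f \<union> {u, u'})"
        using locally_sparse_list[OF sp, of "[f, {u, u'}]"] g f True ne by simp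
      moreover have "card f - 1 + (card f' - 1 + 1) < card (f \<union> (f' \<union> {u, u'}))" if "f \<noteq> f'"
        using locally_sparse_list[OF sp, of "[f, f', {u, u'}]"] g f f' True that ne by simp
      moreover have "f \<union> (f' \<union> {u, u'}) = f \<union> f'" using f f' by auto
      moreover have "f \<union> {u, u'} = f" if "f = f'" using f f' that by auto
      ultimately show False using bound cards by (cases "f = f'") auto
    next
      case False
      then have xu: "x \<noteq> u" "x \<noteq> u'" using x ne by (auto simp: nbhd_def insert_commute)
      then have E: "{u, x} \<in> E" "{u', x} \<in> E" using x by (auto simp: nbhd_def)
      have g: "{u, x} \<noteq> f" "{u, x} \<noteq> f'" "{u', x} \<noteq> f" "{u', x} \<noteq> f'" "{u, x} \<noteq> {u', x}"
        using f f' xv ne by (auto simp: doubleton_eq_iff)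
      have "card f - 1 + (1 + 1) < card (f \<union> ({u, x} \<union> {u', x}))"
        using locally_sparse_list[OF sp, of "[f, {u, x}, {u', x}]"] g f E xu
        by (simp add: card_insert_if)
      moreover have "card f - 1 + (card f' - 1 + (1 + 1)) < card (f \<union> (f' \<union> ({u, x} \<union> {u', x})))" if "f \<noteq> f'"
        using locally_sparse_list[OF sp, of "[f, f', {u, x}, {u', x}]"] g f f' E xu that
        by (simp add: card_insert_if)
      moreover have "f \<union> (f' \<union> ({u, x} \<union> {u', x})) = insert x (f \<union> f')" using f f' by auto
      moreover have "f \<union> ({u, x} \<union> {u', x}) = insert x f" if "f = f'" using f f' that by auto
      moreover have "card (insert x (f \<union> f')) \<le> card (f \<union> f') + 1" "card (insert x f) \<le> card f + 1"
        using c2(2)[OF f(1)] c2(2)[OF f'(1)] by (simp_all add: card_insert_if)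
      ultimately show False using bound cards by (cases "f = f'") auto
    qed
  qed
qed

section \<open>Contraction of the edges by the chosen vertices\<close>

definition contract :: "'a set set \<Rightarrow> 'a set \<Rightarrow> 'a set \<Rightarrow> 'a set set" where
  "contract E C W = {e - C | e. e \<in> E \<and> e - C \<subseteq> W \<and> 2 \<le> card (e - C)}"

text \<open>Each contracted edge has a preimage, and restoring the removed vertices raises the left
  side of the inequality by exactly \<open>\<Sum>g\<in>F. card (\<phi> g \<inter> C)\<close> and the
  right side by at most that. So a violation in the contraction would lift to one in
  \<open>E\<close> with the same number of edges.\<close>

lemma locally_sparse_contract:
  assumes sp: "locally_sparse E" and fin: "\<And>e. e \<in> E \<Longrightarrow> finite e"
  shows "locally_sparse (contract E C W)"
  unfolding locally_sparse_def
proof (intro allI impI, elim conjE)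
  fix F assume F: "F \<subseteq> contract E C W" "finite F" "F \<noteq> {}" "card F \<le> 4"
  have "\<forall>g\<in>F. \<exists>e. e \<in> E \<and> e - C = g \<and> 2 \<le> card g"
    using F unfolding contract_def by blast
  then obtain \<phi> where \<phi>: "\<And>g. g \<in> F \<Longrightarrow> \<phi> g \<in> E \<and> \<phi> g - C = g \<and> 2 \<le> card g"
    by metis
  have inj: "inj_on \<phi> F" by (rule inj_on_inverseI[where g = "\<lambda>e. e - C"]) (use \<phi> in auto)
  have cg: "card (\<phi> g) - 1 = card g - 1 + card (\<phi> g \<inter> C)" if "g \<in> F" for g
  proof -
    have "card (\<phi> g) = card (\<phi> g - C) + card (\<phi> g \<inter> C)"
      using card_Int_Diff[of "\<phi> g" C] \<phi>[OF that] fin by simp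
    then show ?thesis using \<phi>[OF that] by simp
  qed
  have "(\<Sum>f\<in>\<phi> ` F. card f - 1) < card (\<Union>(\<phi> ` F))"
    using sp F \<phi> unfolding locally_sparse_def
    by (auto simp: image_subset_iff card_image[OF inj])
  moreover have "(\<Sum>f\<in>\<phi> ` F. card f - 1) = (\<Sum>g\<in>F. card g - 1) + (\<Sum>g\<in>F. card (\<phi> g \<inter> C))"
    by (simp add: sum.reindex[OF inj] cg sum.distrib del: One_nat_def)
  moreover have "card (\<Union>(\<phi> ` F)) \<le> card (\<Union>F) + (\<Sum>g\<in>F. card (\<phi> g \<inter> C))"
  proof -
    have fU: "finite (\<Union>F)" using F \<phi> fin by (metis finite_Diff finite_Union)
    have "\<Union>(\<phi> ` F) \<subseteq> \<Union>F \<union> (\<Union>g\<in>F. \<phi> g \<inter> C)" using \<phi> by blast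
    then have "card (\<Union>(\<phi> ` F)) \<le> card (\<Union>F \<union> (\<Union>g\<in>F. \<phi> g \<inter> C))"
      using fU F \<phi> fin by (intro card_mono) auto
    also have "\<dots> \<le> card (\<Union>F) + card (\<Union>g\<in>F. \<phi> g \<inter> C)" by (rule card_Un_le)
    also have "\<dots> \<le> card (\<Union>F) + (\<Sum>g\<in>F. card (\<phi> g \<inter> C))" by (intro add_left_mono card_UN_le[OF F(2)])
    finally show ?thesis .
  qed
  ultimately show "(\<Sum>f\<in>F. card f - 1) < card (\<Union>F)" by simp
qed

text \<open>\<open>contract\<close> forgets edges that shrink to at most one vertex, and the
  hypotheses on \<open>W\<close> and \<open>G\<close> make up for this. Edges that shrink to one
  vertex of \<open>W\<close> are ruled out by the choice of \<open>W\<close>; edges wholly inside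
  \<open>C\<close> contain no vertex of \<open>G\<close>; all others inside
  \<open>I \<union> G\<close> leave an edge of the contraction inside \<open>I\<close>.\<close>

lemma independent_contract:
  assumes I: "I \<subseteq> W" "independent_set (contract E C W) I" and WC: "W \<inter> C = {}"
    and W: "\<And>u e. u \<in> W \<Longrightarrow> e \<in> E \<Longrightarrow> u \<in> e \<Longrightarrow> \<not> e - {u} \<subseteq> C"
    and G: "G \<subseteq> C" "\<And>x e. x \<in> G \<Longrightarrow> e \<in> E \<Longrightarrow> x \<in> e \<Longrightarrow> \<not> e \<subseteq> C"
    and ne: "\<And>e. e \<in> E \<Longrightarrow> finite e \<and> e \<noteq> {}"
  shows "independent_set E (I \<union> G)"
  unfolding independent_set_def
proof (intro ballI notI)
  fix e assume e: "e \<in> E" "e \<subseteq> I \<union> G"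
  have sub: "e - C \<subseteq> I" using e G by auto
  consider "card (e - C) = 0" | "card (e - C) = 1" | "2 \<le> card (e - C)" by linarith
  then show False
  proof cases
    case 1
    then have "e \<subseteq> C" using ne[OF e(1)] by auto
    moreover obtain x where "x \<in> e" using ne[OF e(1)] by auto
    ultimately show False using e G(2)[of x e] I(1) WC by auto
  next
    case 2
    then obtain u where u: "e - C = {u}" by (auto simp: card_1_singleton_iff)
    then show False using W[of u e] sub I e by auto
  next
    case 3
    then have "e - C \<in> contract E C W" using e sub I unfolding contract_def by blast
    then show False using I(2) sub unfolding independent_set_def by blast
  qed
qed

section \<open>One round of the semi-random procedure\<close>

text \<open>The event that \<open>u\<close> survives a round is that no element of its cluster is chosen. The dummy elements
  \<open>(u, i)\<close> with \<open>i \<ge> 1\<close> pad all clusters to the same size \<open>m\<close>, so that every vertex survives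
  with the same probability \<open>(1 - p) ^ m\<close> and degrees drop at the expected rate everywhere.\<close>

definition cluster :: "nat \<Rightarrow> 'a set set \<Rightarrow> 'a \<Rightarrow> ('a \<times> nat) set" where
  "cluster m E u = nbhd E u \<times> {0} \<union> {u} \<times> {1..m - card (nbhd E u)}"

lemma mixed_graphD:
  assumes "mixed_graph V E a d"
  shows "finite V" "finite E" "locally_sparse E" "\<And>e. e \<in> E \<Longrightarrow> card e \<in> {2, 3}"
    "\<And>e. e \<in> E \<Longrightarrow> e \<subseteq> V" "\<And>e. e \<in> E \<Longrightarrow> finite e" "\<And>e. e \<in> E \<Longrightarrow> 2 \<le> card e"
    "\<And>v. v \<in> V \<Longrightarrow> real (degree 2 E v) \<le> a" "\<And>v. v \<in> V \<Longrightarrow> real (degree 3 E v) \<le> d"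
    "\<And>e f x y. \<lbrakk>e \<in> E; f \<in> E; x \<in> e; x \<in> f; y \<in> e; y \<in> f; x \<noteq> y\<rbrakk> \<Longrightarrow> e = f"
proof -
  show 1: "finite V" "locally_sparse E" and card: "\<And>e. e \<in> E \<Longrightarrow> card e \<in> {2, 3}"
    and sub: "\<And>e. e \<in> E \<Longrightarrow> e \<subseteq> V" 
    using assms by (auto simp: mixed_graph_def)
  have "E \<subseteq> Pow V" using sub by blast
  then show "finite E" using 1 finite_subset by blast
  show fin: "\<And>e. e \<in> E \<Longrightarrow> finite e" using sub 1 finite_subset by blast
  show two: "\<And>e. e \<in> E \<Longrightarrow> 2 \<le> card e" using card by fastforce
  show "\<And>v. v \<in> V \<Longrightarrow> real (degree 2 E v) \<le> a" "\<And>v. v \<in> V \<Longrightarrow> real (degree 3 E v) \<le> d"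
    using assms by (auto simp: mixed_graph_def)
  show "e = f" if "e \<in> E" "f \<in> E" "x \<in> e" "x \<in> f" "y \<in> e" "y \<in> f" "x \<noteq> y" for e f x y
    using locally_sparse_linear[OF 1(2) _ that] fin two by blast
qed

lemma nbhd_card:
  assumes "mixed_graph V E a d"
  shows "card (nbhd E u) = degree 2 E u + 1" "u \<in> V \<Longrightarrow> nbhd E u \<subseteq> V"
proof -
  note E = mixed_graphD[OF assms]
  have sub: "{x. {u, x} \<in> E} \<subseteq> V" using E(5) by blast
  then show "u \<in> V \<Longrightarrow> nbhd E u \<subseteq> V" by (auto simp: nbhd_def)
  have u: "u \<notin> {x. {u, x} \<in> E}" using E(4)[of "{u}"] by auto
  have "{e \<in> E. u \<in> e \<and> card e = 2} = (\<lambda>x. {u, x}) ` {x. {u, x} \<in> E}"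
  proof
    show "{e \<in> E. u \<in> e \<and> card e = 2} \<subseteq> (\<lambda>x. {u, x}) ` {x. {u, x} \<in> E}"
      by (auto simp: card_2_iff insert_commute)
    show "(\<lambda>x. {u, x}) ` {x. {u, x} \<in> E} \<subseteq> {e \<in> E. u \<in> e \<and> card e = 2}"
      using u by (auto simp: card_insert_if)
  qed
  moreover have "inj_on (\<lambda>x. {u, x}) {x. {u, x} \<in> E}"
    by (auto simp: inj_on_def doubleton_eq_iff)
  ultimately have "degree 2 E u = card {x. {u, x} \<in> E}"
    by (simp add: degree_def card_image)
  then show "card (nbhd E u) = degree 2 E u + 1"
    using u finite_subset[OF sub E(1)] by (simp add: nbhd_def)
qed

text \<open>The bound on \<open>m\<close> makes the natural subtraction in the padding exact; the 1
  in it accounts for \<open>u\<close> itself.\<close>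

lemma cluster_card:
  assumes G: "mixed_graph V E a d" and u: "u \<in> V" and m: "a + 1 \<le> real m"
  shows "card (cluster m E u) = m" "cluster m E u \<subseteq> V \<times> {..m}" "(u, 0) \<in> cluster m E u"
proof -
  have fin: "finite (nbhd E u)" using nbhd_card[OF G] u mixed_graphD(1)[OF G] finite_subset by metis
  have "real (card (nbhd E u)) \<le> m" using nbhd_card(1)[OF G, of u] mixed_graphD(8)[OF G u] m by simp
  then have le: "card (nbhd E u) \<le> m" by simp
  have "card (cluster m E u) = card (nbhd E u \<times> {0::nat}) + card ({u} \<times> {1..m - card (nbhd E u)})"
    unfolding cluster_def using fin by (intro card_Un_disjoint) auto
  then show "card (cluster m E u) = m" using le by (simp add: card_cartesian_product)
  show "cluster m E u \<subseteq> V \<times> {..m}" unfolding cluster_def using nbhd_card(2)[OF G u] u by auto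
  show "(u, 0) \<in> cluster m E u" by (simp add: cluster_def nbhd_def)
qed

text \<open>Dummy elements carry their vertex in the first coordinate and a positive second
  coordinate, so clusters of distinct vertices can meet only in the neighbourhoods.\<close>

lemma cluster_disjoint:
  assumes G: "mixed_graph V E a d"
    and f: "f \<in> E" "v \<in> f" "u \<in> f" "u \<noteq> v" "f' \<in> E" "v \<in> f'" "u' \<in> f'" "u' \<noteq> v" and ne: "u \<noteq> u'"
  shows "cluster m E u \<inter> cluster m E u' \<subseteq> {(v, 0)}"
  using nbhd_disjoint[OF mixed_graphD(3)[OF G] _ f ne] mixed_graphD(4)[OF G] ne
  unfolding cluster_def by auto

lemma cluster_not_mem:
  assumes G: "mixed_graph V E a d"
    and f: "f \<in> E" "card f = 3" "v \<in> f" "u \<in> f" "u \<noteq> v"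
  shows "(v, i) \<notin> cluster m E u"
  using nbhd_not_mem[OF mixed_graphD(3)[OF G] _ f] mixed_graphD(4)[OF G] f
  unfolding cluster_def by auto

text \<open>The cluster of \<open>v\<close> itself is left out. The count still bounds the new
  degree of a surviving \<open>v\<close>, and it can be estimated without conditioning on that
  survival.\<close>

definition triples_surviving :: "nat \<Rightarrow> 'a set set \<Rightarrow> 'a \<Rightarrow> ('a \<times> nat) set \<Rightarrow> 'a set set" where
  "triples_surviving m E v C = {f \<in> E. v \<in> f \<and> card f = 3 \<and> (\<Union>u\<in>f - {v}. cluster m E u) \<inter> C = {}}"

text \<open>Records an edge \<open>f\<close> that turns into the pair \<open>{v, w}\<close>: for a
  pair nothing further has to be chosen, for a triple its third vertex has to be. The element
  \<open>(v, 0)\<close> is removed from the cluster because it is the only element that clusters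
  belonging to different edges at \<open>v\<close> can share; when \<open>v\<close> survives, it is
  not chosen anyway.\<close>

definition pairs_surviving :: "nat \<Rightarrow> 'a set set \<Rightarrow> 'a \<Rightarrow> ('a \<times> nat) set \<Rightarrow> ('a set \<times> 'a) set" where
  "pairs_surviving m E v C = {(f, w). f \<in> E \<and> v \<in> f \<and> w \<in> f \<and> w \<noteq> v \<and>
     (f - {v, w}) \<times> {0} \<subseteq> C \<and> (cluster m E w - {(v, 0)}) \<inter> C = {}}"

section \<open>Degrees after a round\<close>

lemma card_eq_sum_of_bool: "finite I \<Longrightarrow> real (card {i \<in> I. P i}) = (\<Sum>i\<in>I. of_bool (P i))"
  by (simp add: of_bool_def sum.If_cases Int_def)

text \<open>The two clusters of a triple at \<open>v\<close> are disjoint, which gives the exponent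
  \<open>2 * m\<close>. Clusters from different triples at \<open>v\<close> are disjoint as well, so
  the events are independent and Chebyshev applies.\<close>

lemma triples_surviving_tail:
  assumes G: "mixed_graph V E a d" and v: "v \<in> V" and m: "a + 1 \<le> real m"
    and p: "0 \<le> p" "p \<le> 1" and mu: "d * (1 - p) ^ (2 * m) \<le> \<mu>" and t: "0 < t"
  shows "bernoulli_sum p (V \<times> {..m}) (\<lambda>C. of_bool (\<mu> + t < real (card (triples_surviving m E v C)))) \<le> \<mu> / t\<^sup>2"
proof -
  note E = mixed_graphD[OF G]
  define I where "I = {f \<in> E. v \<in> f \<and> card f = 3}"
  define Y where "Y = (\<lambda>f. \<Union>u\<in>f - {v}. cluster m E u)"
  have I: "f \<in> E" "v \<in> f" "card f = 3" "f \<subseteq> V" if "f \<in> I" for f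
    using that E(5) by (auto simp: I_def)
  have cY: "card (Y f) = 2 * m" if "f \<in> I" for f
  proof -
    have "card (f - {v}) = 2" using I[OF that] by (simp add: card_Diff_singleton_if)
    then obtain x y where xy: "f - {v} = {x, y}" "x \<noteq> y" by (auto simp: card_2_iff)
    then have xy': "x \<in> f" "y \<in> f" "x \<noteq> v" "y \<noteq> v" "x \<in> V" "y \<in> V" using I[OF that] by auto
    have "cluster m E x \<inter> cluster m E y \<subseteq> {(v, 0)}"
      using cluster_disjoint[OF G I(1,2)[OF that] xy'(1,3) I(1,2)[OF that] xy'(2,4)] xy by simp
    moreover have "(v, 0) \<notin> cluster m E x" using cluster_not_mem[OF G I(1,3,2)[OF that] xy'(1,3)] .
    ultimately have "cluster m E x \<inter> cluster m E y = {}" by auto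
    moreover have "finite (cluster m E x)" "finite (cluster m E y)"
      using cluster_card[OF G _ m] xy' E(1) by (meson finite_SigmaI finite_atMost finite_subset)+
    ultimately have "card (cluster m E x \<union> cluster m E y) = 2 * m"
      using cluster_card[OF G _ m] xy' by (simp add: card_Un_disjoint)
    then show ?thesis by (simp add: Y_def xy)
  qed
  have "bernoulli_sum p (V \<times> {..m}) (\<lambda>C. of_bool (\<mu> + t < (\<Sum>f\<in>I. of_bool ({} \<subseteq> C \<and> Y f \<inter> C = {})))) \<le> \<mu> / t\<^sup>2"
  proof (rule bernoulli_sum_chebyshev[OF p])
    show "finite (V \<times> {..m})" "finite I" using E by (auto simp: I_def)
    show "{} \<subseteq> V \<times> {..m} \<and> Y f \<subseteq> V \<times> {..m} \<and> {} \<inter> Y f = {}" if "f \<in> I" for f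
      unfolding Y_def using cluster_card(2)[OF G _ m] I(4)[OF that] by blast
    have "(\<Sum>f\<in>I. p ^ card {} * (1 - p) ^ card (Y f)) = real (degree 3 E v) * (1 - p) ^ (2 * m)"
      by (simp add: cY degree_def I_def)
    also have "\<dots> \<le> d * (1 - p) ^ (2 * m)" using E(9)[OF v] p by (intro mult_right_mono) auto
    finally show "(\<Sum>f\<in>I. p ^ card {} * (1 - p) ^ card (Y f)) \<le> \<mu>" using mu by simp
    show "({} \<union> Y f) \<inter> ({} \<union> Y g) = {} \<or> {} \<inter> Y g \<noteq> {} \<or> {} \<inter> Y f \<noteq> {}"
      if fg: "f \<in> I" "g \<in> I" "f \<noteq> g" for f g
    proof -
      have "cluster m E x \<inter> cluster m E y = {}" if xy: "x \<in> f - {v}" "y \<in> g - {v}" for x y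
      proof -
        have ne: "x \<noteq> y" using E(10)[of f g v x] I fg xy by auto
        have "cluster m E x \<inter> cluster m E y \<subseteq> {(v, 0)}"
          using cluster_disjoint[OF G _ _ _ _ _ _ _ _ ne, of f v g] I fg xy by auto
        moreover have "(v, 0) \<notin> cluster m E x" using cluster_not_mem[OF G, of f v x] I fg xy by auto
        ultimately show ?thesis by auto
      qed
      then show ?thesis by (auto simp: Y_def)
    qed
  qed (rule t)
  moreover have "triples_surviving m E v C = {f \<in> I. {} \<subseteq> C \<and> Y f \<inter> C = {}}" for C
    by (auto simp: triples_surviving_def I_def Y_def)
  moreover have "finite I" using E by (auto simp: I_def)
  ultimately show ?thesis by (simp only: card_eq_sum_of_bool)
qed

text \<open>An old pair needs only \<open>m - 1\<close> elements to be avoided, because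
  \<open>(v, 0)\<close> has been removed from the cluster. A triple has two choices of the remaining
  vertex \<open>w\<close>, each with probability \<open>p * (1 - p) ^ m\<close>, whence the term
  with factor 2.\<close>

lemma pairs_surviving_tail:
  fixes E :: "'a set set"
  assumes G: "mixed_graph V E a d" and v: "v \<in> V" and m: "a + 1 \<le> real m"
    and p: "0 \<le> p" "p \<le> 1" and mu: "a * (1 - p) ^ (m - 1) + 2 * d * p * (1 - p) ^ m \<le> \<mu>" and t: "0 < t"
  shows "bernoulli_sum p (V \<times> {..m}) (\<lambda>C. of_bool (\<mu> + t < real (card (pairs_surviving m E v C)))) \<le> \<mu> / t\<^sup>2"
proof -
  note E = mixed_graphD[OF G]
  define J where "J = (\<lambda>j. {f \<in> E. v \<in> f \<and> card f = j})"
  define I where "I = Sigma (J 2 \<union> J 3) (\<lambda>f. f - {v})"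
  define A where "A = (\<lambda>(f, w). (f - {v, w}) \<times> {0::nat})"
  define Y where "Y = (\<lambda>(f :: 'a set, w). cluster m E w - {(v, 0)})"
  have finJ: "finite (J j)" for j using E by (auto simp: J_def)
  have I: "f \<in> E" "v \<in> f" "w \<in> f" "w \<noteq> v" "f \<subseteq> V" "w \<in> V" if "(f, w) \<in> I" for f w
    using that E(5) by (auto simp: I_def J_def)
  have finc: "finite (cluster m E w)" if "w \<in> V" for w
    using cluster_card(2)[OF G that m] E(1) by (meson finite_SigmaI finite_atMost finite_subset)
  have A0: "A (f, w) = {}" if "f \<in> J 2" "w \<in> f - {v}" for f w
  proof -
    have "f = {v, w}" using that by (auto simp: J_def card_2_iff)
    then show ?thesis by (auto simp: A_def)
  qed
  have A1: "card (A (f, w)) = 1" if "f \<in> J 3" "w \<in> f - {v}" for f w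
    using that by (auto simp: A_def J_def card_cartesian_product card_Diff_subset)
  have Y0: "card (Y (f, w)) = m - 1" if "f \<in> J 2" "w \<in> f - {v}" for f w
  proof -
    have f: "f = {v, w}" "f \<in> E" "v \<noteq> w" using that by (auto simp: J_def card_2_iff)
    then have "w \<in> V" "(v, 0) \<in> cluster m E w" using E(5) by (auto simp: cluster_def nbhd_def insert_commute)
    then show ?thesis using cluster_card(1)[OF G _ m] by (simp add: Y_def card_Diff_singleton_if)
  qed
  have Y1: "card (Y (f, w)) = m" if "f \<in> J 3" "w \<in> f - {v}" for f w
  proof -
    have f: "f \<in> E" "card f = 3" "v \<in> f" "w \<in> f" "w \<noteq> v" using that by (auto simp: J_def)
    then have "w \<in> V" "(v, 0) \<notin> cluster m E w" using E(5) cluster_not_mem[OF G f] by auto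
    then show ?thesis using cluster_card(1)[OF G _ m] by (simp add: Y_def)
  qed
  have "bernoulli_sum p (V \<times> {..m}) (\<lambda>C. of_bool (\<mu> + t < (\<Sum>i\<in>I. of_bool (A i \<subseteq> C \<and> Y i \<inter> C = {})))) \<le> \<mu> / t\<^sup>2"
  proof (rule bernoulli_sum_chebyshev[OF p])
    show "finite (V \<times> {..m})" using E by auto
    show "finite I" unfolding I_def using E finJ by (auto simp: J_def)
    show "A i \<subseteq> V \<times> {..m} \<and> Y i \<subseteq> V \<times> {..m} \<and> A i \<inter> Y i = {}" if i: "i \<in> I" for i
    proof -
      obtain f w where i': "i = (f, w)" by (cases i)
      note I' = I[OF i[unfolded i']]
      have "(x, 0) \<notin> cluster m E w" if x: "x \<in> f - {v, w}" for x
      proof -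
        have "card f \<noteq> 2" using x I' by (auto simp: card_2_iff)
        then have "card f = 3" using E(4)[OF I'(1)] by simp
        then show ?thesis using cluster_not_mem[OF G I'(1), of x w] x I' by auto
      qed
      then show ?thesis using cluster_card(2)[OF G I'(6) m] I' by (auto simp: A_def Y_def i')
    qed
    have "(\<Sum>i\<in>I. p ^ card (A i) * (1 - p) ^ card (Y i))
        = (\<Sum>f\<in>J 2 \<union> J 3. \<Sum>w\<in>f - {v}. p ^ card (A (f, w)) * (1 - p) ^ card (Y (f, w)))"
      unfolding I_def using E finJ by (subst sum.Sigma) (auto simp: J_def)
    also have "\<dots> = (\<Sum>f\<in>J 2. \<Sum>w\<in>f - {v}. p ^ card (A (f, w)) * (1 - p) ^ card (Y (f, w)))
        + (\<Sum>f\<in>J 3. \<Sum>w\<in>f - {v}. p ^ card (A (f, w)) * (1 - p) ^ card (Y (f, w)))"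
      using finJ by (intro sum.union_disjoint) (auto simp: J_def)
    also have "\<dots> = (\<Sum>f\<in>J 2. \<Sum>w\<in>f - {v}. (1 - p) ^ (m - 1)) + (\<Sum>f\<in>J 3. \<Sum>w\<in>f - {v}. p * (1 - p) ^ m)"
      using A0 A1 Y0 Y1 by (intro arg_cong2[where f = "(+)"] sum.cong) auto
    also have "\<dots> = (\<Sum>f\<in>J 2. (1 - p) ^ (m - 1)) + (\<Sum>f\<in>J 3. 2 * (p * (1 - p) ^ m))"
      by (intro arg_cong2[where f = "(+)"] sum.cong) (auto simp: J_def card_Diff_singleton_if)
    also have "\<dots> = real (degree 2 E v) * (1 - p) ^ (m - 1) + real (degree 3 E v) * (2 * (p * (1 - p) ^ m))"
      by (simp add: degree_def J_def)
    also have "\<dots> \<le> a * (1 - p) ^ (m - 1) + d * (2 * (p * (1 - p) ^ m))"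
      using E(8,9)[OF v] p by (intro add_mono mult_right_mono) auto
    finally show "(\<Sum>i\<in>I. p ^ card (A i) * (1 - p) ^ card (Y i)) \<le> \<mu>" using mu by (simp add: mult_ac)
    show "(A i \<union> Y i) \<inter> (A j \<union> Y j) = {} \<or> A i \<inter> Y j \<noteq> {} \<or> A j \<inter> Y i \<noteq> {}"
      if ij: "i \<in> I" "j \<in> I" "i \<noteq> j" for i j
    proof -
      obtain f w g z where ij': "i = (f, w)" "j = (g, z)" by (cases i, cases j)
      note If = I[OF ij(1)[unfolded ij'(1)]] and Ig = I[OF ij(2)[unfolded ij'(2)]]
      have wz: "w \<noteq> z" using E(10)[of f g v w] If Ig ij ij' by auto
      show ?thesis
      proof (cases "f = g")
        case True
        \<comment> \<open>The two events of one triple are not independent but contradictory: the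
          vertex \<open>z\<close> must be chosen for one of them and must survive for the
          other.\<close>
        then have "(z, 0) \<in> A i \<inter> Y j" using If Ig wz cluster_card(3)[OF G Ig(6) m] by (auto simp: A_def Y_def ij')
        then show ?thesis by auto
      next
        case False
        have disj: "cluster m E x \<inter> cluster m E y \<subseteq> {(v, 0)}"
          if xy: "x \<in> f" "x \<noteq> v" "y \<in> g" "y \<noteq> v" for x y
        proof -
          have "x \<noteq> y" using E(10)[of f g v x] If Ig xy False by auto
          then show ?thesis using cluster_disjoint[OF G If(1,2) xy(1,2) Ig(1,2) xy(3,4)] by simp
        qed
        have self: "(x, 0) \<in> cluster m E x" for x by (simp add: cluster_def nbhd_def)
        have AA: "A i \<union> Y i \<subseteq> (\<Union>x\<in>f - {v}. cluster m E x) - {(v, 0)}" "A j \<union> Y j \<subseteq> (\<Union>y\<in>g - {v}. cluster m E y) - {(v, 0)}"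
          using If Ig self by (auto simp: A_def Y_def ij')
        moreover have "(\<Union>x\<in>f - {v}. cluster m E x) \<inter> (\<Union>y\<in>g - {v}. cluster m E y) \<subseteq> {(v, 0)}"
          using disj by blast
        ultimately show ?thesis by blast
      qed
    qed
  qed (rule t)
  moreover have "pairs_surviving m E v C = {i \<in> I. A i \<subseteq> C \<and> Y i \<inter> C = {}}" for C
    using E(4) by (auto simp: pairs_surviving_def I_def A_def Y_def J_def)
  moreover have "finite I" unfolding I_def using E finJ by (auto simp: J_def)
  ultimately show ?thesis by (simp only: card_eq_sum_of_bool)
qed

lemma contract_degree_3:
  assumes G: "mixed_graph V E a d" and v: "v \<notin> C"
    and W: "\<And>u. u \<in> W \<Longrightarrow> cluster m E u \<inter> D = {}"
  shows "degree 3 (contract E C W) v \<le> card (triples_surviving m E v D)"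
proof -
  note E = mixed_graphD[OF G]
  have "e \<in> E \<and> (\<Union>u\<in>e - {v}. cluster m E u) \<inter> D = {}" if e: "e \<in> contract E C W" "card e = 3" for e
  proof -
    obtain f where f: "f \<in> E" "e = f - C" "e \<subseteq> W" using e(1) unfolding contract_def by blast
    have "card f \<le> card e" using E(4)[OF f(1)] e(2) by auto
    then have "e = f" using f E(6)[OF f(1)] by (intro card_seteq) auto
    then show ?thesis using f W by blast
  qed
  then show ?thesis unfolding degree_def triples_surviving_def
    using E(2) by (intro card_mono) auto
qed

text \<open>Different recorded pairs \<open>(f, w)\<close> may give the same contracted edge, so the
  map is shown to be onto and only an upper bound results.\<close>

lemma contract_degree_2:
  assumes G: "mixed_graph V E a d" and v: "v \<notin> C"
    and W: "\<And>u. u \<in> W \<Longrightarrow> cluster m E u \<inter> D = {}" and C: "C = {x \<in> V. (x, 0) \<in> D}"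
  shows "degree 2 (contract E C W) v \<le> card (pairs_surviving m E v D)"
proof -
  note E = mixed_graphD[OF G]
  have "{e \<in> contract E C W. v \<in> e \<and> card e = 2} \<subseteq> (\<lambda>(f, w). f - C) ` pairs_surviving m E v D"
  proof
    fix e assume e: "e \<in> {e \<in> contract E C W. v \<in> e \<and> card e = 2}"
    then obtain f where f: "f \<in> E" "e = f - C" "e \<subseteq> W" by (auto simp: contract_def)
    obtain w where w: "e = {v, w}" "w \<noteq> v" using e by (auto simp: card_2_iff)
    have "w \<in> W" "v \<in> f" "w \<in> f" "f - {v, w} \<subseteq> C" using f w by auto
    moreover have "cluster m E w \<inter> D = {}" using W \<open>w \<in> W\<close> .
    ultimately have "(f, w) \<in> pairs_surviving m E v D"
      using f(1) w C by (auto simp: pairs_surviving_def)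
    then show "e \<in> (\<lambda>(f, w). f - C) ` pairs_surviving m E v D" using f by force
  qed
  moreover have "finite (pairs_surviving m E v D)"
    by (rule finite_subset[of _ "E \<times> V"]) (use E in \<open>auto simp: pairs_surviving_def\<close>)
  ultimately show ?thesis unfolding degree_def by (rule surj_card_le[rotated])
qed

section \<open>Selecting a favourable outcome of a round\<close>

lemma bernoulli_sum_superset:
  assumes "finite U" "A \<subseteq> U"
  shows "bernoulli_sum p U (\<lambda>C. of_bool (A \<subseteq> C)) = p ^ card A"
  using bernoulli_sum_cylinder[OF assms(1,2), of "{}" p] by simp

lemma sum_bool_ge_1:
  fixes P :: "'a \<Rightarrow> bool"
  assumes "finite I" "i \<in> I" "P i"
  shows "1 \<le> (\<Sum>i\<in>I. of_bool (P i) :: real)"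
proof -
  have "(of_bool (P i) :: real) \<le> (\<Sum>i\<in>I. of_bool (P i))"
    using assms by (intro member_le_sum) auto
  then show ?thesis using assms by simp
qed

text \<open>The outcome is judged by the single quantity
  \<open>card (good C) + c * card (surv C)\<close>, where \<open>c\<close> is the density guaranteed
  by the later rounds. One expectation then suffices, and the sizes of the two sets need not be
  concentrated separately. Vertices whose degrees deviate too far are simply not counted as
  survivors, which costs the two Chebyshev terms.\<close>

lemma nibble_step:
  fixes V :: "'a set" and a d p c t2 t3 \<mu>2 \<mu>3 :: real
  assumes G: "mixed_graph V E a d" and m: "a + 1 \<le> real m"
    and p: "0 \<le> p" "p \<le> 1" and t: "0 < t2" "0 < t3" and c: "0 \<le> c"
    and mu2: "a * (1 - p) ^ (m - 1) + 2 * d * p * (1 - p) ^ m \<le> \<mu>2"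
    and mu3: "d * (1 - p) ^ (2 * m) \<le> \<mu>3"
    and next_round: "\<And>(W :: 'a set) E'. mixed_graph W E' (\<mu>2 + t2) (\<mu>3 + t3) \<Longrightarrow>
        \<exists>I\<subseteq>W. independent_set E' I \<and> c * card W \<le> card I"
  shows "\<exists>I\<subseteq>V. independent_set E I \<and>
    (p * (1 - a * p - d * p\<^sup>2) + c * ((1 - p) ^ m - d * p\<^sup>2 - \<mu>2 / t2\<^sup>2 - \<mu>3 / t3\<^sup>2)) * card V \<le> card I"
proof -
  note E = mixed_graphD[OF G]
  define U where "U = V \<times> {..m}"
  \<comment> \<open>Only second coordinate 0 stands for a vertex; chosen dummy elements do nothing
    except destroy survivors.\<close>
  define chosen where "chosen = (\<lambda>C. {x \<in> V. (x, 0::nat) \<in> C})"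
  define good where "good = (\<lambda>C. {x \<in> chosen C. \<forall>e\<in>E. x \<in> e \<longrightarrow> \<not> e \<subseteq> chosen C})"
  define surv where "surv = (\<lambda>C. {u \<in> V. cluster m E u \<inter> C = {} \<and> (\<forall>e\<in>E. u \<in> e \<longrightarrow> \<not> e - {u} \<subseteq> chosen C) \<and>
    real (card (pairs_surviving m E u C)) \<le> \<mu>2 + t2 \<and> real (card (triples_surviving m E u C)) \<le> \<mu>3 + t3})"
  define J where "J = (\<lambda>j u. {e \<in> E. u \<in> e \<and> card e = j})"
  have U: "finite U" and finJ: "finite (J j u)" for j u using E by (auto simp: U_def J_def)
  have JE: "e \<subseteq> V" "e \<in> E" "u \<in> e" "card e = j" if "e \<in> J j u" for e j u
    using that E(5) by (auto simp: J_def)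
  \<comment> \<open>\<open>fg\<close> and \<open>fs\<close> are union-bound minorants of the
    indicators of being good and of surviving. Unlike the indicators themselves, they have
    expectations that can be bounded term by term.\<close>
  define fg where "fg = (\<lambda>x C. of_bool ({(x, 0::nat)} \<subseteq> C)
    - (\<Sum>e\<in>J 2 x. of_bool (e \<times> {0} \<subseteq> C)) - (\<Sum>e\<in>J 3 x. of_bool (e \<times> {0} \<subseteq> C)) :: real)"
  define fs where "fs = (\<lambda>u C. of_bool (cluster m E u \<inter> C = {})
    - (\<Sum>e\<in>J 3 u. of_bool ((e - {u}) \<times> {0} \<subseteq> C))
    - of_bool (\<mu>2 + t2 < real (card (pairs_surviving m E u C))) - of_bool (\<mu>3 + t3 < real (card (triples_surviving m E u C))) :: real)"
  have good_ge: "(\<Sum>x\<in>V. fg x C) \<le> card (good C)" if "C \<subseteq> U" for C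
  proof -
    have "fg x C \<le> of_bool (x \<in> good C)" if x: "x \<in> V" for x
    proof -
      define S :: "nat \<Rightarrow> real" where "S = (\<lambda>j. \<Sum>e\<in>J j x. of_bool (e \<times> {0} \<subseteq> C))"
      have S0: "0 \<le> S j" for j unfolding S_def by (intro sum_nonneg) auto
      have fgS: "fg x C = of_bool ((x, 0) \<in> C) - S 2 - S 3" by (simp add: fg_def S_def)
      show ?thesis
      proof (cases "x \<in> chosen C \<and> x \<notin> good C")
        case True
        then obtain e where e: "e \<in> E" "x \<in> e" "e \<subseteq> chosen C" by (auto simp: good_def)
        then have "e \<times> {0} \<subseteq> C" by (auto simp: chosen_def)
        moreover have "e \<in> J 2 x \<or> e \<in> J 3 x" using e E(4) by (auto simp: J_def)
        ultimately have "1 \<le> S 2 \<or> 1 \<le> S 3" unfolding S_def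
          using sum_bool_ge_1[OF finJ, of e _ x "\<lambda>e. e \<times> {0} \<subseteq> C"] by blast
        then show ?thesis using S0[of 2] S0[of 3] by (auto simp: fgS of_bool_def)
      next
        case False
        then show ?thesis using x S0[of 2] S0[of 3] by (auto simp: fgS of_bool_def chosen_def)
      qed
    qed
    then have "(\<Sum>x\<in>V. fg x C) \<le> (\<Sum>x\<in>V. of_bool (x \<in> good C))" by (rule sum_mono)
    also have "\<dots> = real (card {x \<in> V. x \<in> good C})" using E(1) by (simp add: card_eq_sum_of_bool)
    also have "{x \<in> V. x \<in> good C} = good C" by (auto simp: good_def chosen_def)
    finally show ?thesis .
  qed
  have surv_ge: "(\<Sum>u\<in>V. fs u C) \<le> card (surv C)" if "C \<subseteq> U" for C
  proof -
    have "fs u C \<le> of_bool (u \<in> surv C)" if u: "u \<in> V" for u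
    proof -
      define S :: real where "S = (\<Sum>e\<in>J 3 u. of_bool ((e - {u}) \<times> {0} \<subseteq> C))"
      have S0: "0 \<le> S" unfolding S_def by (intro sum_nonneg) auto
      have fsS: "fs u C = of_bool (cluster m E u \<inter> C = {}) - S - of_bool (\<mu>2 + t2 < real (card (pairs_surviving m E u C)))
          - of_bool (\<mu>3 + t3 < real (card (triples_surviving m E u C)))"
        by (simp add: fs_def S_def)
      consider "u \<in> surv C" | "cluster m E u \<inter> C \<noteq> {}" | "\<mu>2 + t2 < real (card (pairs_surviving m E u C))"
        | "\<mu>3 + t3 < real (card (triples_surviving m E u C))"
        | e where "e \<in> E" "u \<in> e" "e - {u} \<subseteq> chosen C" "cluster m E u \<inter> C = {}"
        using u unfolding surv_def mem_Collect_eq not_le[symmetric] by blast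
      then show ?thesis
      proof cases
        case (5 e)
        \<comment> \<open>Pairs are already covered by the cluster, which contains the other end.
          Only triples with both other vertices chosen need a separate error term, of size at most
          \<open>d * p\<^sup>2\<close>.\<close>
        have "card e \<noteq> 2"
        proof
          assume "card e = 2"
          then obtain x where "e = {u, x}" "x \<noteq> u" using 5 by (auto simp: card_2_iff)
          then have "(x, 0) \<in> cluster m E u \<inter> C"
            using 5 by (auto simp: cluster_def nbhd_def chosen_def)
          then show False using 5 by auto
        qed
        then have "e \<in> J 3 u" using 5 E(4) by (auto simp: J_def)
        moreover have "(e - {u}) \<times> {0} \<subseteq> C" using 5 by (auto simp: chosen_def)
        ultimately have "1 \<le> S" unfolding S_def by (rule sum_bool_ge_1[OF finJ])
        then show ?thesis by (auto simp: fsS of_bool_def)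
      qed (use S0 in \<open>auto simp: fsS of_bool_def\<close>)
    qed
    then have "(\<Sum>x\<in>V. fs x C) \<le> (\<Sum>x\<in>V. of_bool (x \<in> surv C))" by (rule sum_mono)
    also have "\<dots> = real (card {x \<in> V. x \<in> surv C})" using E(1) by (simp add: card_eq_sum_of_bool)
    also have "{x \<in> V. x \<in> surv C} = surv C" by (auto simp: surv_def)
    finally show ?thesis .
  qed
  have Eg: "p * (1 - a * p - d * p\<^sup>2) \<le> bernoulli_sum p U (fg x)" if x: "x \<in> V" for x
  proof -
    have sub: "e \<times> {0} \<subseteq> U" "card (e \<times> {0::nat}) = j" if "e \<in> J j x" for e j
      using JE[OF that] by (auto simp: U_def card_cartesian_product)
    have "bernoulli_sum p U (\<lambda>C. of_bool ({(x, 0)} \<subseteq> C)) = p"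
      using bernoulli_sum_superset[OF U, of "{(x, 0)}" p] x by (simp add: U_def)
    moreover have "bernoulli_sum p U (\<lambda>C. \<Sum>e\<in>J j x. of_bool (e \<times> {0} \<subseteq> C)) = degree j E x * p ^ j" for j
      unfolding bernoulli_sum_sum using sub U
      by (simp add: bernoulli_sum_superset) (simp add: degree_def J_def)
    ultimately have "bernoulli_sum p U (fg x) = p - real (degree 2 E x) * p\<^sup>2 - real (degree 3 E x) * p ^ 3"
      unfolding fg_def bernoulli_sum_diff by simp
    also have "\<dots> \<ge> p - a * p\<^sup>2 - d * p ^ 3"
      using E(8,9)[OF x] p by (intro diff_mono mult_right_mono) auto
    finally show ?thesis by (simp add: algebra_simps power2_eq_square power3_eq_cube)
  qed
  have Es: "(1 - p) ^ m - d * p\<^sup>2 - \<mu>2 / t2\<^sup>2 - \<mu>3 / t3\<^sup>2 \<le> bernoulli_sum p U (fs u)" if u: "u \<in> V" for u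
  proof -
    have sub: "(e - {u}) \<times> {0} \<subseteq> U" "card ((e - {u}) \<times> {0::nat}) = 2" if "e \<in> J 3 u" for e
      using JE[OF that] by (auto simp: U_def card_cartesian_product card_Diff_singleton_if)
    have "bernoulli_sum p U (\<lambda>C. of_bool (cluster m E u \<inter> C = {})) = (1 - p) ^ m"
      using bernoulli_sum_cylinder[OF U, of "{}" "cluster m E u" p] cluster_card[OF G u m] by (simp add: U_def)
    moreover have "bernoulli_sum p U (\<lambda>C. \<Sum>e\<in>J 3 u. of_bool ((e - {u}) \<times> {0} \<subseteq> C)) = real (degree 3 E u) * p\<^sup>2"
      unfolding bernoulli_sum_sum using sub U
      by (simp add: bernoulli_sum_superset) (simp add: degree_def J_def)
    moreover have "real (degree 3 E u) * p\<^sup>2 \<le> d * p\<^sup>2" using E(9)[OF u] by (intro mult_right_mono) auto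
    ultimately show ?thesis unfolding fs_def bernoulli_sum_diff
      using pairs_surviving_tail[OF G u m p mu2 t(1)] triples_surviving_tail[OF G u m p mu3 t(2)]
      unfolding U_def by simp
  qed
  have distrib: "(X + c * Y) * card V = (\<Sum>x\<in>V. X) + c * (\<Sum>x\<in>V. Y)" for X Y :: real
    by (simp add: ring_distribs)
  have "(p * (1 - a * p - d * p\<^sup>2) + c * ((1 - p) ^ m - d * p\<^sup>2 - \<mu>2 / t2\<^sup>2 - \<mu>3 / t3\<^sup>2)) * card V
      = (\<Sum>x\<in>V. p * (1 - a * p - d * p\<^sup>2)) + c * (\<Sum>x\<in>V. (1 - p) ^ m - d * p\<^sup>2 - \<mu>2 / t2\<^sup>2 - \<mu>3 / t3\<^sup>2)"
    by (rule distrib)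
  also have "\<dots> \<le> (\<Sum>x\<in>V. bernoulli_sum p U (fg x)) + c * (\<Sum>x\<in>V. bernoulli_sum p U (fs x))"
    by (intro add_mono mult_left_mono sum_mono Eg Es c)
  also have "\<dots> = bernoulli_sum p U (\<lambda>C. (\<Sum>x\<in>V. fg x C) + c * (\<Sum>x\<in>V. fs x C))"
    by (simp only: bernoulli_sum_add bernoulli_sum_cmult bernoulli_sum_sum)
  also have "\<dots> \<le> bernoulli_sum p U (\<lambda>C. card (good C) + c * card (surv C))"
    by (intro bernoulli_sum_mono p add_mono mult_left_mono good_ge surv_ge c)
  finally obtain C where C: "C \<subseteq> U" and le: "(p * (1 - a * p - d * p\<^sup>2)
      + c * ((1 - p) ^ m - d * p\<^sup>2 - \<mu>2 / t2\<^sup>2 - \<mu>3 / t3\<^sup>2)) * card V \<le> card (good C) + c * card (surv C)"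
    by (rule bernoulli_sum_exists[OF p U])
  define W E' where "W = surv C" and "E' = contract E (chosen C) (surv C)"
  have WC: "W \<inter> chosen C = {}"
    by (auto simp: W_def surv_def chosen_def cluster_def nbhd_def)
  have "mixed_graph W E' (\<mu>2 + t2) (\<mu>3 + t3)"
    unfolding mixed_graph_def
  proof (intro conjI ballI)
    show "finite W" using E(1) by (simp add: W_def surv_def)
    show "locally_sparse E'" unfolding E'_def using locally_sparse_contract[OF E(3)] E(6) by blast
    show "e \<subseteq> W" if "e \<in> E'" for e using that by (auto simp: E'_def W_def contract_def)
    show "card e \<in> {2, 3}" if e: "e \<in> E'" for e
    proof -
      obtain f where f: "f \<in> E" "e = f - chosen C" "2 \<le> card e"
        using e unfolding E'_def contract_def by blast
      have "card e \<le> card f" using f E(6) by (auto intro: card_mono)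
      then show ?thesis using f E(4)[OF f(1)] by auto
    qed
    fix v assume v: "v \<in> W"
    have cl: "\<And>u. u \<in> surv C \<Longrightarrow> cluster m E u \<inter> C = {}" by (auto simp: surv_def)
    have vC: "v \<notin> chosen C" using v WC by auto
    have "real (card (pairs_surviving m E v C)) \<le> \<mu>2 + t2" "real (card (triples_surviving m E v C)) \<le> \<mu>3 + t3"
      using v by (simp_all add: W_def surv_def)
    moreover have "degree 2 E' v \<le> card (pairs_surviving m E v C)" unfolding E'_def
      by (rule contract_degree_2[OF G vC cl]) (auto simp: chosen_def)
    moreover have "degree 3 E' v \<le> card (triples_surviving m E v C)" unfolding E'_def
      by (rule contract_degree_3[OF G vC cl])
    ultimately show "real (degree 2 E' v) \<le> \<mu>2 + t2" "real (degree 3 E' v) \<le> \<mu>3 + t3"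
      by linarith+
  qed
  from next_round[OF this] obtain I where I: "I \<subseteq> W" "independent_set E' I" "c * card W \<le> card I" by auto
  have "independent_set E (I \<union> good C)"
  proof (rule independent_contract[OF I(1) I(2)[unfolded E'_def W_def[symmetric]] WC])
    show "finite e \<and> e \<noteq> {}" if "e \<in> E" for e using E(6,7)[OF that] by auto
  qed (auto simp: W_def surv_def good_def)
  moreover have "card (I \<union> good C) = card I + card (good C)"
  proof (rule card_Un_disjoint)
    show "finite I" using I(1) E(1) by (auto simp: W_def surv_def intro: finite_subset)
    show "finite (good C)" using E(1) by (auto simp: good_def chosen_def)
    show "I \<inter> good C = {}" using I(1) WC by (auto simp: good_def)
  qed
  moreover have "I \<union> good C \<subseteq> V" using I(1) by (auto simp: W_def surv_def good_def chosen_def)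
  ultimately show ?thesis using le I(3) unfolding W_def by (intro exI[of _ "I \<union> good C"]) auto
qed

section \<open>Iterating the rounds\<close>

text \<open>After \<open>J - j\<close> rounds \<open>\<sigma>\<close> is the fraction of vertices still present; triple degrees have shrunk by
  \<open>\<sigma>\<^sup>2\<close> and pair degrees are at most \<open>3 (J - j) (A / L) \<sigma>\<close>. With \<open>A\<^sup>2 = D L\<close> and \<open>L = ln D\<close>, a
  round with \<open>p \<approx> 1 / (4 A \<sigma>)\<close> adds about \<open>1 / (16 A)\<close> to the relative size of the
  independent set, and there is room for \<open>L / 4\<close> rounds.\<close>

lemma nibble_rounds:
  fixes A L \<sigma> :: real and J j :: nat and V :: "'a set"
  assumes L: "1 \<le> L" and J: "real J \<le> L / 4" and big: "16 * L ^ 3 \<le> A * (3 / 4) ^ J"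
    and "j \<le> J" "\<sigma> \<le> 1" "(3 / 4) ^ (J - j) \<le> \<sigma>"
    and "mixed_graph V E (3 * real (J - j) * (A / L) * \<sigma>) (A\<^sup>2 / L * (1 + real (J - j) / J) * \<sigma>\<^sup>2)"
  shows "\<exists>I\<subseteq>V. independent_set E I \<and> real j * (1 - 1 / (4 * L)) ^ j / (16 * A * \<sigma>) * card V \<le> card I"
  using assms(4-)
proof (induction j arbitrary: \<sigma> V E)
  case 0
  have "independent_set E {}" using mixed_graphD(7)[OF 0(4)] by (fastforce simp: independent_set_def)
  then show ?case by (intro exI[of _ "{}"]) simp
next
  case (Suc j)
  define i where "i = J - Suc j"
  define w where "w = 1 - 1 / (4 * L)"
  \<comment> \<open>Common cluster size. Pair degrees stay below
    \<open>3 / 4 * (A * \<sigma>)\<close>, and \<open>A * \<sigma>\<close> is at least 16, so there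
    is room for \<open>a + 1 \<le> real m\<close>.\<close>
  define m where "m = nat \<lceil>A * \<sigma>\<rceil>"
  \<comment> \<open>Normalised to \<open>p * m = 1 / 4\<close>. Bernoulli's inequality then gives
    survival probability \<open>s \<ge> 3 / 4\<close>, the base of the powers that bound
    \<open>\<sigma>\<close> from below.\<close>
  define p where "p = 1 / (4 * real m)"
  define s where "s = (1 - p) ^ m"
  define a where "a = 3 * real i * (A / L) * \<sigma>"
  define d where "d = A\<^sup>2 / L * (1 + real i / J) * \<sigma>\<^sup>2"
  define \<tau> where "\<tau> = \<sigma> * s"
  \<comment> \<open>In units of \<open>(A / L) * \<tau>\<close>, the pair degree bound grows by 3
    per round: \<open>3 / 2\<close> covers the newly created pairs and the small correction to the
    old ones, and \<open>3 / 2\<close> is the deviation \<open>t2\<close>.\<close>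
  define \<mu>2 where "\<mu>2 = (A / L) * \<tau> * (3 * real i + 3 / 2)"
  define t2 where "t2 = (A / L) * \<tau> * (3 / 2)"
  define \<mu>3 where "\<mu>3 = A\<^sup>2 / L * (1 + real i / J) * \<tau>\<^sup>2"
  \<comment> \<open>Triple degrees may exceed their expected decay by a share \<open>1 / J\<close>
    per round, so the excess factor never passes 2.\<close>
  define t3 where "t3 = A\<^sup>2 / L * \<tau>\<^sup>2 / J"
  have ij: "J - j = Suc i" "i < J" "i + j + 1 = J" using Suc.prems(1) by (auto simp: i_def)
  have k: "(3 / 4) ^ J \<le> (3 / 4 :: real) ^ n" if "n \<le> J" for n using that by (intro power_decreasing) auto
  have L3: "L \<le> L ^ 3" "1 \<le> L ^ 3" using L self_le_power[of L 3] by auto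
  have "0 < A * (3 / 4) ^ J" using big L3 by linarith
  then have A: "0 < A" by (simp add: zero_less_mult_iff)
  have Ax: "16 * L ^ 3 \<le> A * x" if "(3 / 4) ^ n \<le> x" "n \<le> J" for n x
  proof -
    have "A * (3 / 4) ^ J \<le> A * x" using A order_trans[OF k[OF that(2)] that(1)] by (intro mult_left_mono) auto
    then show ?thesis using big by simp
  qed
  have \<sigma>ge: "(3 / 4) ^ i \<le> \<sigma>" using Suc.prems(3) by (simp add: i_def)
  then have \<sigma>: "0 < \<sigma>" by (rule less_le_trans[rotated]) simp
  have A\<sigma>: "16 * L ^ 3 \<le> A * \<sigma>" using Ax[OF \<sigma>ge] ij by simp
  have m: "A * \<sigma> \<le> m" "real m \<le> 2 * (A * \<sigma>)" "16 \<le> real m"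
    using A\<sigma> L3 unfolding m_def by linarith+
  have p: "0 < p" "p \<le> 1 / 64" "p * m = 1 / 4" "p \<le> 1 / (4 * (A * \<sigma>))" "1 / (8 * (A * \<sigma>)) \<le> p"
    using m A \<sigma> by (auto simp: p_def field_simps)
  have s: "3 / 4 \<le> s" "s \<le> 1"
    using Bernoulli_inequality[of "- p" m] p by (auto simp: s_def power_le_one mult.commute)
  have \<tau>ge: "(3 / 4) ^ Suc i \<le> \<tau>"
    using mult_mono[OF \<sigma>ge s(1)] \<sigma> by (simp add: \<tau>_def mult.commute)
  have \<tau>: "0 < \<tau>" "\<tau> \<le> 1" using \<sigma> s Suc.prems(2) by (auto simp: \<tau>_def intro: mult_le_one)
  have A\<tau>: "16 * L ^ 3 \<le> A * \<tau>" using Ax[OF \<tau>ge] ij by simp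
  have iL: "real i + 1 \<le> L / 4" "0 < real J" "real i \<le> J" using J ij by auto
  have a: "0 \<le> a" "a \<le> 3 / 4 * (A * \<sigma>)"
  proof -
    have "a = 3 * (A * \<sigma>) * (real i / L)" by (simp add: a_def)
    also have "\<dots> \<le> 3 * (A * \<sigma>) * (1 / 4)"
      using iL L A \<sigma> by (intro mult_left_mono) (auto simp: field_simps)
    finally show "a \<le> 3 / 4 * (A * \<sigma>)" by simp
  qed (use A L \<sigma> in \<open>simp add: a_def\<close>)
  have ij2: "1 + real i / J \<le> 2" using iL by simp
  have d: "0 \<le> d" "d \<le> 2 * (A * \<sigma>)\<^sup>2 / L"
  proof -
    have "d = (A * \<sigma>)\<^sup>2 / L * (1 + real i / J)" by (simp add: d_def power_mult_distrib)
    also have "\<dots> \<le> (A * \<sigma>)\<^sup>2 / L * 2" using ij2 L by (intro mult_left_mono) auto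
    finally show "d \<le> 2 * (A * \<sigma>)\<^sup>2 / L" by (simp add: mult.commute)
  qed (use L in \<open>simp add: d_def\<close>)
  have AL: "1 \<le> A / L * \<sigma>" using A\<sigma> L3 L by (simp add: field_simps)
  have ap: "a * p \<le> 3 / 16"
  proof -
    have "a * p \<le> 3 / 4 * (A * \<sigma>) * (1 / (4 * (A * \<sigma>)))" using a p A \<sigma> by (intro mult_mono) auto
    then show ?thesis using A \<sigma> by simp
  qed
  have dp: "d * p \<le> A / L * \<sigma> / 2"
  proof -
    have "d * p \<le> 2 * (A * \<sigma>)\<^sup>2 / L * (1 / (4 * (A * \<sigma>)))" using d p L by (intro mult_mono) auto
    then show ?thesis using A \<sigma> L by (simp add: power2_eq_square field_simps)
  qed
  have dp2: "d * p\<^sup>2 \<le> 1 / (8 * L)"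
  proof -
    have "d * p * p \<le> A / L * \<sigma> / 2 * (1 / (4 * (A * \<sigma>)))"
      using dp p d A \<sigma> L by (intro mult_mono) auto
    then show ?thesis using A \<sigma> L by (simp add: power2_eq_square mult.assoc field_simps)
  qed
  have mu2: "a * (1 - p) ^ (m - 1) + 2 * d * p * (1 - p) ^ m \<le> \<mu>2"
  proof -
    \<comment> \<open>The exponent \<open>m - 1\<close> costs a factor
      \<open>1 / (1 - p) \<le> 1 + 2 * p\<close>. Its effect on \<open>a\<close> is only an additive
      constant, because \<open>a * p\<close> is bounded.\<close>
    have "(1 - p) ^ m = (1 - p) * (1 - p) ^ (m - 1)" using m by (cases m) auto
    then have "(1 - p) ^ (m - 1) = s / (1 - p)" using p by (simp add: s_def)
    also have "\<dots> \<le> s * (1 + 2 * p)"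
    proof -
      have "0 \<le> p * (1 - 2 * p)" using p by (intro mult_nonneg_nonneg) auto
      then have "1 \<le> (1 + 2 * p) * (1 - p)" by (simp add: algebra_simps)
      then have "1 / (1 - p) \<le> 1 + 2 * p" using p by (simp add: divide_le_eq)
      then have "s * (1 / (1 - p)) \<le> s * (1 + 2 * p)" using s by (intro mult_left_mono) auto
      then show ?thesis by simp
    qed
    finally have "a * (1 - p) ^ (m - 1) + 2 * d * p * (1 - p) ^ m \<le> a * (s * (1 + 2 * p)) + 2 * d * p * s"
      using a by (auto simp: s_def intro: mult_left_mono)
    also have "\<dots> = s * (a + 2 * (a * p) + 2 * (d * p))" by (simp add: algebra_simps)
    also have "\<dots> \<le> s * (a + 3 / 2 * (A / L * \<sigma>))"
      using s ap dp AL by (intro mult_left_mono) auto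
    also have "\<dots> = \<mu>2" by (simp add: \<mu>2_def a_def \<tau>_def algebra_simps)
    finally show ?thesis .
  qed
  have mu3: "d * (1 - p) ^ (2 * m) \<le> \<mu>3"
    by (simp add: d_def \<mu>3_def \<tau>_def s_def power_mult_distrib mult.commute[of 2 m] power_mult)
  have e2: "\<mu>2 / t2\<^sup>2 \<le> 1 / (32 * L)"
  proof -
    have "\<mu>2 / t2\<^sup>2 = 4 / 3 * (real i + 1 / 2) * L / (A * \<tau>)"
      using A L \<tau> by (simp add: \<mu>2_def t2_def power2_eq_square divide_simps)
    also have "\<dots> \<le> 4 / 3 * (L / 4) * L / (16 * L ^ 3)"
    proof (rule frac_le)
      show "4 / 3 * (real i + 1 / 2) * L \<le> 4 / 3 * (L / 4) * L"
        using iL L by (intro mult_right_mono mult_left_mono) auto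
    qed (use L A\<tau> in auto)
    also have "\<dots> \<le> 1 / (32 * L)" using L by (simp add: power3_eq_cube field_simps)
    finally show ?thesis .
  qed
  have e3: "\<mu>3 / t3\<^sup>2 \<le> 1 / (32 * L)"
  proof -
    have "\<mu>3 / t3\<^sup>2 = (1 + real i / J) * (real J)\<^sup>2 * L / (A * \<tau>)\<^sup>2"
      using A L \<tau> iL by (simp add: \<mu>3_def t3_def power2_eq_square divide_simps)
    also have "\<dots> \<le> 2 * (L / 4)\<^sup>2 * L / (16 * L ^ 3)\<^sup>2"
    proof (rule frac_le)
      show "(1 + real i / J) * (real J)\<^sup>2 * L \<le> 2 * (L / 4)\<^sup>2 * L"
        using L J ij2 by (intro mult_right_mono mult_mono power_mono) auto
      show "(16 * L ^ 3)\<^sup>2 \<le> (A * \<tau>)\<^sup>2" using L by (intro power_mono[OF A\<tau>]) simp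
    qed (use L in auto)
    also have "\<dots> = 1 / (32 * L) * (1 / (64 * L\<^sup>2))"
      using L by (simp add: power2_eq_square power3_eq_cube field_simps)
    also have "\<dots> \<le> 1 / (32 * L) * 1"
      using L by (intro mult_left_mono) (auto simp: divide_simps intro: order_trans[OF _ mult_left_mono[of 1]])
    finally show ?thesis by simp
  qed
  have w: "0 \<le> w" "w \<le> 1" using L by (auto simp: w_def field_simps)
  define c where "c = real j * w ^ j / (16 * A * \<tau>)"
  have c: "0 \<le> c" using w A \<tau> by (simp add: c_def)
  have next_round: "\<exists>I\<subseteq>W. independent_set E' I \<and> c * card W \<le> card I"
    if "mixed_graph W E' (\<mu>2 + t2) (\<mu>3 + t3)" for W :: "'a set" and E'
  proof -
    have "\<mu>2 + t2 = 3 * real (J - j) * (A / L) * \<tau>"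
      unfolding ij(1) by (simp add: \<mu>2_def t2_def algebra_simps)
    moreover have "\<mu>3 + t3 = A\<^sup>2 / L * (1 + real (J - j) / J) * \<tau>\<^sup>2"
      unfolding ij(1) by (simp add: \<mu>3_def t3_def algebra_simps add_divide_distrib)
    ultimately show ?thesis
      using Suc.IH[of \<tau> W E'] that \<tau> \<tau>ge ij Suc.prems(1) unfolding c_def w_def by simp
  qed
  have "a + 1 \<le> real m" using a(2) m A\<sigma> L3 by linarith
  moreover have "mixed_graph V E a d" using Suc.prems(4) by (simp add: a_def d_def i_def)
  moreover have "0 < t2" "0 < t3" using A L \<tau> iL by (auto simp: t2_def t3_def)
  ultimately obtain I where I: "I \<subseteq> V" "independent_set E I"
    "(p * (1 - a * p - d * p\<^sup>2) + c * ((1 - p) ^ m - d * p\<^sup>2 - \<mu>2 / t2\<^sup>2 - \<mu>3 / t3\<^sup>2)) * card V \<le> card I"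
    using nibble_step[of V E a d m p t2 t3 c \<mu>2 \<mu>3] p c mu2 mu3 next_round by auto
  have "real (Suc j) * w ^ Suc j / (16 * A * \<sigma>) \<le> p * (1 - a * p - d * p\<^sup>2) + c * (s - d * p\<^sup>2 - \<mu>2 / t2\<^sup>2 - \<mu>3 / t3\<^sup>2)"
  proof -
    \<comment> \<open>The gain of this round: \<open>p\<close> is at least
      \<open>1 / (8 * (A * \<sigma>))\<close>, and at most \<open>3 / 16 + 1 / 8\<close> of the
      chosen vertices is lost, leaving more than half.\<close>
    have "1 / (8 * L) \<le> 1 / 8" using L by (simp add: divide_simps)
    then have "1 / (8 * (A * \<sigma>)) * (1 / 2) \<le> p * (1 - a * p - d * p\<^sup>2)"
      using p ap dp2 A \<sigma> by (intro mult_mono) auto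
    moreover have "c * (s * w) \<le> c * (s - d * p\<^sup>2 - \<mu>2 / t2\<^sup>2 - \<mu>3 / t3\<^sup>2)"
    proof (intro mult_left_mono c)
      \<comment> \<open>The three error terms sum to at most \<open>3 / (16 * L)\<close>, which is
        at most \<open>s / (4 * L)\<close> since \<open>s \<ge> 3 / 4\<close>. This is the origin of
        the loss factor \<open>w\<close> per round; the factor \<open>s\<close> cancels against
        \<open>\<tau> = \<sigma> * s\<close>.\<close>
      have "3 / 4 * (1 / (4 * L)) \<le> s * (1 / (4 * L))" using s L by (intro mult_right_mono) auto
      moreover have "1 / (8 * L) + 1 / (32 * L) + 1 / (32 * L) = 3 / 4 * (1 / (4 * L))" by simp
      moreover have "s * w = s - s * (1 / (4 * L))" by (simp add: w_def algebra_simps)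
      ultimately show "s * w \<le> s - d * p\<^sup>2 - \<mu>2 / t2\<^sup>2 - \<mu>3 / t3\<^sup>2" using dp2 e2 e3 by linarith
    qed
    moreover have "c * (s * w) = real j * w ^ Suc j / (16 * A * \<sigma>)"
      using A \<sigma> s by (simp add: c_def \<tau>_def mult_ac)
    moreover have "real (Suc j) * w ^ Suc j / (16 * A * \<sigma>) = w ^ Suc j / (16 * A * \<sigma>) + real j * w ^ Suc j / (16 * A * \<sigma>)"
      by (simp add: algebra_simps add_divide_distrib)
    moreover have "w ^ Suc j / (16 * A * \<sigma>) \<le> 1 / (16 * A * \<sigma>)"
      using w A \<sigma> by (intro divide_right_mono power_le_one) auto
    ultimately show ?thesis by (simp add: mult.assoc)
  qed
  then have "real (Suc j) * w ^ Suc j / (16 * A * \<sigma>) * card V \<le> card I"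
    using I(3) unfolding s_def[symmetric] by (meson mult_right_mono of_nat_0_le_iff order_trans)
  then show ?case using I unfolding w_def by blast
qed

lemma sparse_triple_system_independent:
  "\<exists>D0. \<forall>D\<ge>D0. \<forall>(V :: 'a set) E. finite V \<and> (\<forall>e\<in>E. e \<subseteq> V \<and> card e = 3) \<and> locally_sparse E \<and>
     (\<forall>v\<in>V. real (degree 3 E v) \<le> D) \<longrightarrow>
     (\<exists>I\<subseteq>V. independent_set E I \<and> sqrt (ln D / D) / 256 * card V \<le> card I)"
proof -
  \<comment> \<open>After at most \<open>L / 4\<close> rounds the surviving fraction is still at
    least \<open>D powr (- 1 / 8)\<close>, because \<open>3 / 4 \<ge> exp (- (1 / 2))\<close>. The
    bound \<open>8 \<le> ln D\<close> keeps the rounded-down number of rounds above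
    \<open>L / 8\<close>.\<close>
  have "eventually (\<lambda>D::real. 1 \<le> D \<and> 8 \<le> ln D \<and> 16 * ln D ^ 3 \<le> sqrt (D * ln D) * D powr (- 1 / 8)) at_top"
    by (intro eventually_conj) real_asymp+
  then obtain D0 where D0: "\<And>D. D \<ge> D0 \<Longrightarrow> 1 \<le> D \<and> 8 \<le> ln D \<and> 16 * ln D ^ 3 \<le> sqrt (D * ln D) * D powr (- 1 / 8)"
    unfolding eventually_at_top_linorder by blast
  show ?thesis
  proof (intro exI[of _ D0] allI impI, elim conjE)
    fix D and V :: "'a set" and E
    assume D: "D0 \<le> D" and V: "finite V" "\<forall>e\<in>E. e \<subseteq> V \<and> card e = 3" "locally_sparse E"
      "\<forall>v\<in>V. real (degree 3 E v) \<le> D"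
    define L A J where "L = ln D" and "A = sqrt (D * L)" and "J = nat \<lfloor>L / 4\<rfloor>"
    have L: "1 \<le> D" "8 \<le> L" and big: "16 * L ^ 3 \<le> A * D powr (- 1 / 8)"
      using D0[OF D] by (auto simp: L_def A_def)
    have A: "0 < A" "A\<^sup>2 = D * L" using L by (auto simp: A_def)
    have J: "real J \<le> L / 4" "L / 8 \<le> real J" using L unfolding J_def by linarith+
    have "D powr (- 1 / 8) = exp (- L / 8)" using L by (simp add: powr_def L_def)
    also have "\<dots> \<le> exp (real J * (- (1 / 2)))" using J by simp
    also have "\<dots> = exp (- (1 / 2)) ^ J" by (rule exp_of_nat_mult)
    also have "\<dots> \<le> (3 / 4) ^ J"
    proof (intro power_mono)
      have "4 / 3 \<le> exp (1 / 2 :: real)" using exp_ge_add_one_self[of "1 / 2 :: real"] by linarith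
      then show "exp (- (1 / 2)) \<le> (3 / 4 :: real)" by (simp add: exp_minus field_simps)
    qed simp
    finally have "A * D powr (- 1 / 8) \<le> A * (3 / 4) ^ J" using A by simp
    then have big: "16 * L ^ 3 \<le> A * (3 / 4) ^ J" using big by simp
    have "{e \<in> E. v \<in> e \<and> card e = 2} = {}" for v using V(2) by auto
    then have "degree 2 E v = 0" for v unfolding degree_def by (simp only: card.empty)
    then have "mixed_graph V E (3 * real (J - J) * (A / L) * 1) (A\<^sup>2 / L * (1 + real (J - J) / J) * 1\<^sup>2)"
      using V A L by (auto simp: mixed_graph_def)
    from nibble_rounds[OF _ J(1) big _ _ _ this] L obtain I where I: "I \<subseteq> V" "independent_set E I"
      "real J * (1 - 1 / (4 * L)) ^ J / (16 * A) * card V \<le> card I" by auto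
    have "1 / 2 \<le> (1 - 1 / (4 * L)) ^ J"
    proof -
      have "1 / (4 * L) \<le> 1" using L by (simp add: divide_simps)
      then have "1 + real J * (- (1 / (4 * L))) \<le> (1 + (- (1 / (4 * L)))) ^ J"
        by (intro Bernoulli_inequality) simp
      moreover have "real J * (1 / (4 * L)) \<le> 1 / 2" using J L by (simp add: field_simps)
      ultimately show ?thesis by simp
    qed
    \<comment> \<open>256 is \<open>8 * 2 * 16\<close>: from \<open>L / 8 \<le> J\<close>, from the
      accumulated loss, and from the gain per round.\<close>
    then have "L / 8 * (1 / 2) / (16 * A) \<le> real J * (1 - 1 / (4 * L)) ^ J / (16 * A)"
      using J A L by (intro divide_right_mono mult_mono) auto
    moreover have "sqrt (ln D / D) = L / A"
      using L by (simp add: A_def L_def[symmetric] real_sqrt_divide real_sqrt_mult divide_simps)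
    ultimately have "sqrt (ln D / D) / 256 \<le> real J * (1 - 1 / (4 * L)) ^ J / (16 * A)" by simp
    then have "sqrt (ln D / D) / 256 * card V \<le> card I"
      using I(3) by (meson mult_right_mono of_nat_0_le_iff order_trans)
    then show "\<exists>I\<subseteq>V. independent_set E I \<and> sqrt (ln D / D) / 256 * card V \<le> card I" using I by blast
  qed
qed

section \<open>Short cycles in triple systems\<close>

definition triple_system :: "'a set \<Rightarrow> 'a set set \<Rightarrow> bool" where
  "triple_system V E \<longleftrightarrow> finite V \<and> (\<forall>e\<in>E. e \<subseteq> V \<and> card e = 3)"

lemma triple_systemD:
  assumes "triple_system V E"
  shows "finite V" "finite E" "\<And>e. e \<in> E \<Longrightarrow> e \<subseteq> V" "\<And>e. e \<in> E \<Longrightarrow> card e = 3" "\<And>e. e \<in> E \<Longrightarrow> finite e"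
proof -
  show V: "finite V" and sub: "\<And>e. e \<in> E \<Longrightarrow> e \<subseteq> V" and "\<And>e. e \<in> E \<Longrightarrow> card e = 3"
    using assms by (auto simp: triple_system_def)
  then show "finite E" by (meson PowI finite_Pow_iff finite_subset subsetI)
  show "\<And>e. e \<in> E \<Longrightarrow> finite e" using V sub finite_subset by blast
qed

lemma triple_system_restrict:
  assumes "triple_system V E" "W \<subseteq> V"
  shows "triple_system W {e \<in> E. e \<subseteq> W}"
  using assms finite_subset unfolding triple_system_def by auto

lemma sum_degree_3:
  assumes "triple_system V E"
  shows "(\<Sum>v\<in>V. degree 3 E v) = 3 * card E"
proof -
  note E = triple_systemD[OF assms]
  have "(\<Sum>v\<in>V. degree 3 E v) = (\<Sum>v\<in>V. \<Sum>e\<in>E. of_bool (v \<in> e))"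
    using E by (intro sum.cong refl) (auto simp: degree_def of_bool_def sum.If_cases intro!: arg_cong[where f = card])
  also have "\<dots> = (\<Sum>e\<in>E. \<Sum>v\<in>V. of_bool (v \<in> e))" by (rule sum.swap)
  also have "\<dots> = (\<Sum>e\<in>E. card e)"
    using E by (intro sum.cong refl) (auto simp: of_bool_def sum.If_cases Int_absorb1)
  also have "\<dots> = 3 * card E" using E by simp
  finally show ?thesis .
qed

text \<open>Markov's inequality: the average degree is at most \<open>3 * D\<close>, so at most half
  of the vertices have degree above \<open>6 * D\<close>, and deleting these does not raise any
  degree.\<close>

lemma triple_system_low_degree:
  fixes D :: real
  assumes G: "triple_system V E" and D: "0 < D" and E: "card E \<le> D * card V"
  obtains W where "W \<subseteq> V" "card V \<le> 2 * card W" "\<And>v. v \<in> W \<Longrightarrow> degree 3 {e \<in> E. e \<subseteq> W} v \<le> 6 * D"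
proof -
  note T = triple_systemD[OF G]
  define B where "B = {v \<in> V. 6 * D < degree 3 E v}"
  have "6 * D * card B = (\<Sum>v\<in>B. 6 * D)" by simp
  also have "\<dots> \<le> (\<Sum>v\<in>B. real (degree 3 E v))" by (intro sum_mono) (auto simp: B_def)
  also have "\<dots> \<le> (\<Sum>v\<in>V. real (degree 3 E v))" using T by (intro sum_mono2) (auto simp: B_def)
  also have "\<dots> = 3 * real (card E)" using sum_degree_3[OF G] by (simp flip: of_nat_sum)
  also have "\<dots> \<le> 3 * (D * card V)" using E by simp
  finally have "D * (2 * real (card B)) \<le> D * card V" by simp
  then have "2 * card B \<le> card V" using D by simp
  moreover have "card (V - B) = card V - card B" using T by (intro card_Diff_subset) (auto simp: B_def)
  ultimately have "card V \<le> 2 * card (V - B)" by simp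
  moreover have "degree 3 {e \<in> E. e \<subseteq> V - B} v \<le> 6 * D" if "v \<in> V - B" for v
  proof -
    have "degree 3 {e \<in> E. e \<subseteq> V - B} v \<le> degree 3 E v"
      unfolding degree_def using T by (intro card_mono) auto
    then show ?thesis using that by (auto simp: B_def)
  qed
  ultimately show ?thesis using that[of "V - B"] by auto
qed

text \<open>Minimal violations of local sparsity; minimality forces \<open>card (\<Union>F) = 2 * card F\<close>, which makes them
  rare in a random sample.\<close>

definition short_cycles :: "'a set set \<Rightarrow> 'a set set set" where
  "short_cycles E = {F. F \<subseteq> E \<and> finite F \<and> F \<noteq> {} \<and> card F \<le> 4 \<and> card (\<Union>F) \<le> 2 * card F \<and>
     (\<forall>F'. F' \<subset> F \<and> F' \<noteq> {} \<longrightarrow> 2 * card F' < card (\<Union>F'))}"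

text \<open>A violation that is minimal under inclusion is a short cycle, so induction on proper
  subsets suffices.\<close>

lemma locally_sparse_if_no_short_cycles:
  assumes G: "triple_system V E" and none: "short_cycles E = {}"
  shows "locally_sparse E"
  unfolding locally_sparse_def
proof (intro allI impI, elim conjE)
  fix F assume F: "F \<subseteq> E" "finite F" "F \<noteq> {}" "card F \<le> 4"
  note T = triple_systemD[OF G]
  have "2 * card F < card (\<Union>F)" using F(2,1,3,4)
  proof (induction F rule: finite_psubset_induct)
    case (psubset F)
    have "2 * card F' < card (\<Union>F')" if "F' \<subset> F" "F' \<noteq> {}" for F'
      using psubset.IH[of F'] that psubset.prems psubset_card_mono[OF psubset.hyps that(1)] by auto
    moreover have "F \<notin> short_cycles E" using none by simp
    ultimately have "\<not> card (\<Union>F) \<le> 2 * card F"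
      using psubset.prems psubset.hyps unfolding short_cycles_def by blast
    then show ?case by simp
  qed
  moreover have "(\<Sum>f\<in>F. card f - 1) = 2 * card F" using F T by (simp add: subset_iff)
  ultimately show "(\<Sum>f\<in>F. card f - 1) < card (\<Union>F)" by simp
qed

text \<open>Any edge of a minimal violation can be put last: the others span more than
  \<open>2 * card F - 2\<close> vertices, so it adds at most one new vertex and meets their union in
  at least two. The earlier edges are ordered so that each touches the preceding ones, which is the
  form needed for counting.\<close>

lemma short_cycle_cases:
  assumes G: "triple_system V E" and F: "F \<in> short_cycles E"
  obtains (2) f g where "F = {f, g}" "f \<in> E" "g \<in> E" "card (\<Union>F) = 4" "2 \<le> card (g \<inter> f)"
  | (3) f g h where "F = {f, g, h}" "f \<in> E" "g \<in> E" "h \<in> E" "card (\<Union>F) = 6"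
      "g \<inter> f \<noteq> {}" "2 \<le> card (h \<inter> (f \<union> g))"
  | (4) f g h i where "F = {f, g, h, i}" "f \<in> E" "g \<in> E" "h \<in> E" "i \<in> E" "card (\<Union>F) = 8"
      "g \<inter> f \<noteq> {}" "h \<inter> (f \<union> g) \<noteq> {}" "2 \<le> card (i \<inter> (f \<union> g \<union> h))"
proof -
  note T = triple_systemD[OF G]
  have F': "F \<subseteq> E" "finite F" "F \<noteq> {}" "card F \<le> 4" "card (\<Union>F) \<le> 2 * card F"
    and min: "\<And>F'. F' \<subseteq> F \<Longrightarrow> F' \<noteq> F \<Longrightarrow> F' \<noteq> {} \<Longrightarrow> 2 * card F' < card (\<Union>F')"
    using F unfolding short_cycles_def by blast+
  have c3: "card f = 3" "finite f" if "f \<in> F" for f using that F' T by auto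
  have fU: "finite (\<Union>F)" using F'(2) c3 by blast
  have FE: "f \<in> E" if "f \<in> F" for f using that F'(1) by blast
  have last: "2 \<le> card (f \<inter> \<Union>(F - {f}))" if f: "f \<in> F" "F \<noteq> {f}" for f
  proof -
    have "2 * card (F - {f}) < card (\<Union>(F - {f}))" using f by (intro min) auto
    moreover have "card (F - {f}) = card F - 1" using f F' by simp
    moreover have "0 < card (F - {f})"
    proof -
      have "F - {f} \<noteq> {}" using f by blast
      then show ?thesis using F'(2) by (simp only: card_gt_0_iff finite_Diff simp_thms)
    qed
    moreover have "card (f \<union> \<Union>(F - {f})) + card (f \<inter> \<Union>(F - {f})) = card f + card (\<Union>(F - {f}))"
      using c3 F' f by (intro card_Un_Int[symmetric]) auto
    moreover have "f \<union> \<Union>(F - {f}) = \<Union>F" using f by auto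
    ultimately show ?thesis using c3[OF f(1)] F'(5) by simp
  qed
  have pair: "5 \<le> card (f \<union> g)" if "f \<in> F" "g \<in> F" "f \<noteq> g" "F \<noteq> {f, g}" for f g
    using min[of "{f, g}"] that by auto
  have inter: "card (f \<union> g) + card (f \<inter> g) = 6" if "f \<in> F" "g \<in> F" for f g
    using card_Un_Int[of f g] c3[OF that(1)] c3[OF that(2)] by simp
  obtain f where f: "f \<in> F" using F' by auto
  have "F \<noteq> {f}" using F'(5) c3[OF f] by auto
  then have "f \<inter> \<Union>(F - {f}) \<noteq> {}" using last[OF f] by auto
  then obtain g where g: "g \<in> F" "g \<noteq> f" "g \<inter> f \<noteq> {}" by blast
  have cF: "card (F - {f, g}) = card F - 2" using f g F' by (simp add: card_Diff_subset)
  consider "card (F - {f, g}) = 0" | "card (F - {f, g}) = 1" | "card (F - {f, g}) = 2" using cF F' by linarith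
  then show ?thesis
  proof cases
    case 1
    then have "F - {f, g} = {}" using F'(2) by (simp only: card_0_eq finite_Diff)
    then have F2: "F = {f, g}" using f g by blast
    have "f \<union> g \<noteq> f" 
    proof
      assume "f \<union> g = f"
      then have "g = f" using c3[OF f] c3[OF g(1)] by (intro card_subset_eq) auto
      then show False using g by simp
    qed
    then have "card f < card (f \<union> g)" using c3[OF f] c3[OF g(1)] by (intro psubset_card_mono) auto
    then have "card (\<Union>F) = 4" using c3[OF f] F'(5) F2 g by simp
    moreover have "2 \<le> card (g \<inter> f)" using last[OF g(1)] F2 g by (simp add: insert_Diff_if)
    ultimately show ?thesis using 2[OF F2 FE[OF f] FE[OF g(1)]] by blast
  next
    case one: 2
    then obtain h where h: "F - {f, g} = {h}" by (auto simp: card_1_singleton_iff)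
    have F3: "F = {f, g, h}" "h \<in> F" "h \<noteq> f" "h \<noteq> g" using h f g by blast+
    have cF3: "card F = 3" unfolding F3(1) using F3 g by simp
    have two: "card {x, y} \<noteq> 3" for x y :: "'a set" by (simp add: card_insert_if)
    have c: "5 \<le> card (f \<union> g)" "5 \<le> card (g \<union> h)" "5 \<le> card (f \<union> h)"
      using pair[OF f g(1)] pair[OF g(1) F3(2)] pair[OF f F3(2)] f g F3(2-) cF3 two by metis+
    \<comment> \<open>With 5 vertices, \<open>f \<union> g\<close> and \<open>f \<union> h\<close>
      would both be everything, so the two vertices outside \<open>f\<close> would lie in
      \<open>g \<inter> h\<close>, contradicting \<open>5 \<le> card (g \<union> h)\<close>.\<close>
    have "card (\<Union>F) \<noteq> 5"
    proof
      assume 5: "card (\<Union>F) = 5"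
      have "f \<union> g = \<Union>F" by (rule card_seteq[OF fU]) (use f g c 5 in auto)
      moreover have "f \<union> h = \<Union>F" by (rule card_seteq[OF fU]) (use f F3(2) c 5 in auto)
      ultimately have "\<Union>F - f \<subseteq> g \<inter> h" by blast
      then have "card (\<Union>F - f) \<le> card (g \<inter> h)" using c3[OF g(1)] by (intro card_mono) auto
      moreover have "card (\<Union>F - f) = 2" using 5 c3[OF f] f by (subst card_Diff_subset) auto
      ultimately show False using inter[OF g(1) F3(2)] c by simp
    qed
    moreover have "5 \<le> card (\<Union>F)"
    proof -
      have "card (f \<union> g) \<le> card (\<Union>F)" using f g(1) by (intro card_mono fU) blast
      then show ?thesis using c by simp
    qed
    ultimately have "card (\<Union>F) = 6" using F'(5) cF3 by linarith
    moreover have "2 \<le> card (h \<inter> (f \<union> g))"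
    proof -
      have "F - {h} = {f, g}" "F \<noteq> {h}" using F3 f by blast+
      then show ?thesis using last[OF F3(2)] by simp
    qed
    ultimately show ?thesis using 3[OF F3(1) FE[OF f] FE[OF g(1)] FE[OF F3(2)] _ g(3)] by blast
  next
    case two: 3
    \<comment> \<open>Otherwise the two remaining edges avoid \<open>f \<union> g\<close>, and two
      disjoint unions of at least 5 vertices each exceed the total of 8.\<close>
    have "\<exists>h\<in>F - {f, g}. h \<inter> (f \<union> g) \<noteq> {}"
    proof (rule ccontr)
      assume no: "\<not> ?thesis"
      obtain h i where hi: "F - {f, g} = {h, i}" "h \<noteq> i" using two by (auto simp: card_2_iff)
      have hF: "h \<in> F" "i \<in> F" using hi by blast+
      have "h \<inter> (f \<union> g) = {}" "i \<inter> (f \<union> g) = {}" using no hi(1) by blast+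
      then have disj: "(f \<union> g) \<inter> (h \<union> i) = {}" by blast
      have cF4: "card F = 4" using cF two by linarith
      have ne: "F \<noteq> {f, g}" "F \<noteq> {h, i}" using cF4 by (auto simp: card_insert_if split: if_splits)
      have "card (f \<union> g) + card (h \<union> i) = card ((f \<union> g) \<union> (h \<union> i))"
        using c3(2)[OF f] c3(2)[OF g(1)] c3(2)[OF hF(1)] c3(2)[OF hF(2)] by (intro card_Un_disjoint[symmetric] disj) simp_all
      also have "\<dots> \<le> card (\<Union>F)" using f g(1) hF by (intro card_mono fU) blast
      finally show False using pair[OF f g(1) _ ne(1)] pair[OF hF hi(2) ne(2)] g(2) cF4 F'(5) by simp
    qed
    then obtain h where h': "h \<in> F - {f, g}" "h \<inter> (f \<union> g) \<noteq> {}" by (rule bexE)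
    then have h: "h \<in> F" "h \<noteq> f" "h \<noteq> g" "h \<inter> (f \<union> g) \<noteq> {}" by simp_all
    have sub: "{f, g, h} \<subseteq> F" using f g(1) h(1) by simp
    have "card {f, g, h} = 3" using g(2) h(2,3) by simp
    then have "card (F - {f, g, h}) = 1" using sub cF two F'(2) by (simp add: card_Diff_subset)
    then obtain i where i: "F - {f, g, h} = {i}" by (rule card_1_singletonE)
    then have i': "i \<in> F - {f, g, h}" by simp
    have "F = {f, g, h} \<union> (F - {f, g, h})" using Diff_partition[OF sub] by (rule sym)
    then have "F = {f, g, h, i}" unfolding i by (simp add: insert_commute)
    with i' have F4: "F = {f, g, h, i}" "i \<in> F" "i \<noteq> f" "i \<noteq> g" "i \<noteq> h" by simp_all
    have cF4: "card F = 4" using cF two by linarith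
    have five: "5 \<le> card (x \<union> y)" if "x \<in> F" "y \<in> F" "x \<noteq> y" for x y
      using pair[OF that] cF4 that by (cases "F = {x, y}") (simp_all add: card_insert_if)
    have three: "7 \<le> card (x \<union> y \<union> z)" if "x \<in> F" "y \<in> F" "z \<in> F" "x \<noteq> y" "x \<noteq> z" "y \<noteq> z" for x y z
    proof -
      have "card {x, y, z} = 3" using that(4-6) by simp
      then have "{x, y, z} \<noteq> F" using cF4 by (intro notI) simp
      moreover have "{x, y, z} \<subseteq> F" using that(1-3) by blast
      ultimately have "2 * card {x, y, z} < card (\<Union>{x, y, z})" by (intro min) simp_all
      also have "\<Union>{x, y, z} = x \<union> y \<union> z" by blast
      finally show ?thesis using \<open>card {x, y, z} = 3\<close> by linarith
    qed
    \<comment> \<open>With 7 vertices, any three edges would cover everything, so the vertices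
      outside \<open>x \<union> y\<close> would lie in \<open>z \<inter> w\<close>, which has at
      most one element. Hence \<open>x\<close> and \<open>y\<close> would be disjoint, and four
      disjoint triples need 12 vertices.\<close>
    have "card (\<Union>F) \<noteq> 7"
    proof
      assume 7: "card (\<Union>F) = 7"
      have disj: "x \<inter> y = {}" if xy: "x \<in> F" "y \<in> F" "x \<noteq> y" for x y
      proof -
        have "card (F - {x, y}) = 2" using xy cF4 F'(2) by (simp add: card_Diff_subset)
        then obtain z w where "F - {x, y} = {z, w}" "z \<noteq> w" by (auto simp: card_2_iff)
        then have zw: "z \<in> F" "w \<in> F" "z \<noteq> w" "z \<noteq> x" "z \<noteq> y" "w \<noteq> x" "w \<noteq> y" by blast+
        have "x \<union> y \<union> z = \<Union>F"
          by (rule card_seteq[OF fU]) (use xy zw three[OF xy(1,2) zw(1) xy(3)] 7 in \<open>blast, simp\<close>)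
        moreover have "x \<union> y \<union> w = \<Union>F"
          by (rule card_seteq[OF fU]) (use xy zw three[OF xy(1,2) zw(2) xy(3)] 7 in \<open>blast, simp\<close>)
        ultimately have "\<Union>F - (x \<union> y) \<subseteq> z \<inter> w" by blast
        then have "card (\<Union>F - (x \<union> y)) \<le> card (z \<inter> w)" using c3 zw by (intro card_mono) auto
        moreover have "card (\<Union>F - (x \<union> y)) = 7 - card (x \<union> y)"
          using 7 c3 xy by (subst card_Diff_subset) auto
        ultimately have "card (x \<inter> y) = 0" 
          using inter[OF zw(1,2)] five[OF zw(1-3)] inter[OF xy(1,2)] five[OF xy] by linarith
        then show ?thesis using c3 xy by simp
      qed
      have "card (\<Union>F) = card (f \<union> g \<union> h \<union> i)" using F4 by (simp add: Un_assoc)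
      also have "\<dots> = 12"
      proof -
        have "f \<inter> g = {}" "f \<inter> h = {}" "g \<inter> h = {}" "f \<inter> i = {}" "g \<inter> i = {}" "h \<inter> i = {}"
          using disj[OF f g(1)] disj[OF f h(1)] disj[OF g(1) h(1)] disj[OF f F4(2)] disj[OF g(1) F4(2)]
            disj[OF h(1) F4(2)] g(2) h(2,3) F4(3-5) by metis+
        then have "f \<inter> g = {}" "(f \<union> g) \<inter> h = {}" "(f \<union> g \<union> h) \<inter> i = {}" by blast+
        moreover note c3[OF f] c3[OF g(1)] c3[OF h(1)] c3[OF F4(2)]
        ultimately show ?thesis by (simp add: card_Un_disjoint)
      qed
      finally show False using 7 by simp
    qed
    moreover have "7 \<le> card (\<Union>F)"
    proof -
      have "card (f \<union> g \<union> h) \<le> card (\<Union>F)" using fU f g h by (intro card_mono) auto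
      then show ?thesis using three[of f g h] f g h by simp
    qed
    ultimately have "card (\<Union>F) = 8" using F'(5) cF4 by simp
    moreover have "2 \<le> card (i \<inter> (f \<union> g \<union> h))"
    proof -
      have "F - {i} = {f, g, h}" "F \<noteq> {i}" using F4 f by auto
      then have "i \<inter> \<Union>(F - {i}) = i \<inter> (f \<union> g \<union> h)" by auto
      then show ?thesis using last[OF F4(2)] \<open>F \<noteq> {i}\<close> by simp
    qed
    ultimately show ?thesis using 4[OF F4(1) FE[OF f] FE[OF g(1)] FE[OF h(1)] FE[OF F4(2)] _ g(3) h(4)] by blast
  qed
qed

section \<open>Sampling\<close>

lemma card_Sigma_le:
  fixes c :: real
  assumes "finite A" "\<And>a. a \<in> A \<Longrightarrow> finite (B a)" "\<And>a. a \<in> A \<Longrightarrow> card (B a) \<le> c"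
  shows "card (Sigma A B) \<le> card A * c"
proof -
  have "real (card (Sigma A B)) = (\<Sum>a\<in>A. real (card (B a)))" using assms by simp
  also have "\<dots> \<le> (\<Sum>a\<in>A. c)" using assms by (intro sum_mono)
  finally show ?thesis by simp
qed

lemma card_touching:
  fixes D :: real
  assumes G: "triple_system V E" and deg: "\<And>v. v \<in> V \<Longrightarrow> degree 3 E v \<le> D" and D: "0 \<le> D"
    and U: "U \<subseteq> V" "card U \<le> n"
  shows "card {g \<in> E. g \<inter> U \<noteq> {}} \<le> n * D"
proof -
  note T = triple_systemD[OF G]
  have fU: "finite U" using U T finite_subset by blast
  have "{g \<in> E. g \<inter> U \<noteq> {}} = (\<Union>v\<in>U. {g \<in> E. v \<in> g \<and> card g = 3})" using T by auto
  then have "real (card {g \<in> E. g \<inter> U \<noteq> {}}) \<le> (\<Sum>v\<in>U. real (degree 3 E v))"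
    using card_UN_le[OF fU, of "\<lambda>v. {g \<in> E. v \<in> g \<and> card g = 3}"]
    by (simp add: degree_def flip: of_nat_sum)
  also have "\<dots> \<le> (\<Sum>v\<in>U. D)" using U deg by (intro sum_mono) auto
  also have "\<dots> \<le> n * D" using U D by (simp add: mult_right_mono)
  finally show ?thesis .
qed

lemma card_touching_twice:
  fixes \<kappa> :: real
  assumes G: "triple_system V E" and codeg: "\<And>x y. x \<noteq> y \<Longrightarrow> card {e \<in> E. x \<in> e \<and> y \<in> e} \<le> \<kappa>"
    and k: "0 \<le> \<kappa>" and U: "U \<subseteq> V" "card U \<le> n"
  shows "card {g \<in> E. 2 \<le> card (g \<inter> U)} \<le> n\<^sup>2 * \<kappa>"
proof -
  note T = triple_systemD[OF G]
  have fU: "finite U" using U T finite_subset by blast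
  have sub: "{g \<in> E. 2 \<le> card (g \<inter> U)} \<subseteq> (\<Union>(x, y)\<in>U \<times> U - Id. {e \<in> E. x \<in> e \<and> y \<in> e})"
  proof
    fix g assume g: "g \<in> {g \<in> E. 2 \<le> card (g \<inter> U)}"
    obtain S where S: "S \<subseteq> g \<inter> U" "card S = 2"
      by (rule obtain_subset_with_card_n[of 2 "g \<inter> U"]) (use g in simp_all)
    obtain x y where xy: "x \<noteq> y" "S = {x, y}" using S(2) unfolding card_2_iff by blast
    then have "(x, y) \<in> U \<times> U - Id" "x \<in> g" "y \<in> g" using S(1) by simp_all
    then show "g \<in> (\<Union>(x, y)\<in>U \<times> U - Id. {e \<in> E. x \<in> e \<and> y \<in> e})"
      using g by (intro UN_I[of "(x, y)"]) simp_all
  qed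
  have "card {g \<in> E. 2 \<le> card (g \<inter> U)} \<le> card (\<Union>(x, y)\<in>U \<times> U - Id. {e \<in> E. x \<in> e \<and> y \<in> e})"
    using T(2) fU by (intro card_mono[OF _ sub]) auto
  also have "\<dots> \<le> (\<Sum>z\<in>U \<times> U - Id. card (case z of (x, y) \<Rightarrow> {e \<in> E. x \<in> e \<and> y \<in> e}))"
    using fU by (intro card_UN_le) auto
  finally have "real (card {g \<in> E. 2 \<le> card (g \<inter> U)}) \<le> (\<Sum>z\<in>U \<times> U - Id. real (card (case z of (x, y) \<Rightarrow> {e \<in> E. x \<in> e \<and> y \<in> e})))"
    by (simp flip: of_nat_sum)
  also have "\<dots> \<le> (\<Sum>z\<in>U \<times> U - Id. \<kappa>)" using codeg by (intro sum_mono) auto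
  also have "\<dots> \<le> (\<Sum>z\<in>U \<times> U. \<kappa>)" using fU k by (intro sum_mono2) auto
  also have "\<dots> = (real (card U))\<^sup>2 * \<kappa>" by (simp add: card_cartesian_product power2_eq_square)
  also have "\<dots> \<le> n\<^sup>2 * \<kappa>" using U k by (intro mult_right_mono power_mono) auto
  finally show ?thesis by simp
qed

text \<open>Edges are chosen in the order given by the case analysis. The earlier edges span at most
  3, 6 or 9 vertices: a touching edge has at most \<open>3 * D\<close> or \<open>6 * D\<close>
  choices, and the last one, meeting the rest in two vertices, at most 9, 36 or 81 times
  \<open>\<kappa>\<close>. Only the last choice profits from the codegree bound.\<close>

lemma card_short_cycles:
  fixes D \<kappa> :: real
  assumes G: "triple_system V E" and deg: "\<And>v. v \<in> V \<Longrightarrow> degree 3 E v \<le> D" and D: "0 \<le> D"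
    and codeg: "\<And>x y. x \<noteq> y \<Longrightarrow> card {e \<in> E. x \<in> e \<and> y \<in> e} \<le> \<kappa>" and k: "0 \<le> \<kappa>"
  defines "cycles \<equiv> \<lambda>j. {F \<in> short_cycles E. card (\<Union>F) = j}"
  shows "card (cycles 4) \<le> card E * (9 * \<kappa>)"
    "card (cycles 6) \<le> card E * (3 * D * (36 * \<kappa>))"
    "card (cycles 8) \<le> card E * (3 * D * (6 * D * (81 * \<kappa>)))"
proof -
  note T = triple_systemD[OF G]
  define one where "one = (\<lambda>U. {g \<in> E. g \<inter> U \<noteq> {}})"
  define two where "two = (\<lambda>U. {g \<in> E. 2 \<le> card (g \<inter> U)})"
  have fin: "finite (one U)" "finite (two U)" for U using T by (auto simp: one_def two_def)
  have mem: "f \<in> E" if "f \<in> one U \<or> f \<in> two U" for f U using that by (auto simp: one_def two_def)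
  have U2: "f \<union> g \<subseteq> V" "card (f \<union> g) \<le> 6" if "f \<in> E" "g \<in> E" for f g
    using that T(3,4) card_Un_le[of f g] by auto
  have U3: "f \<union> g \<union> h \<subseteq> V" "card (f \<union> g \<union> h) \<le> 9" if "f \<in> E" "g \<in> E" "h \<in> E" for f g h
    using U2[OF that(1,2)] T(3,4)[OF that(3)] card_Un_le[of "f \<union> g" h] by auto
  have one: "card (one U) \<le> n * D" if "U \<subseteq> V" "card U \<le> n" for U n
    unfolding one_def by (rule card_touching[OF G deg D that])
  have two: "card (two U) \<le> n\<^sup>2 * \<kappa>" if "U \<subseteq> V" "card U \<le> n" for U n
    unfolding two_def by (rule card_touching_twice[OF G codeg k that])
  define P2 where "P2 = (SIGMA f:E. two f)"
  define P3 where "P3 = (SIGMA f:E. SIGMA g:one f. two (f \<union> g))"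
  define P4 where "P4 = (SIGMA f:E. SIGMA g:one f. SIGMA h:one (f \<union> g). two (f \<union> g \<union> h))"
  have "card P2 \<le> card E * (9 * \<kappa>)"
    unfolding P2_def using T two[of _ 3] by (intro card_Sigma_le fin) auto
  moreover have "cycles 4 \<subseteq> (\<lambda>(f, g). {f, g}) ` P2"
  proof
    fix F assume "F \<in> cycles 4"
    then have F: "F \<in> short_cycles E" "card (\<Union>F) = 4" by (auto simp: cycles_def)
    from G F(1) show "F \<in> (\<lambda>(f, g). {f, g}) ` P2"
    proof (cases rule: short_cycle_cases)
      case (2 f g)
      then have "(f, g) \<in> P2" by (simp add: P2_def two_def)
      then show ?thesis using 2(1) by (intro image_eqI[of _ _ "(f, g)"]) simp_all
    qed (use F in simp_all)
  qed
  moreover have "finite P2" unfolding P2_def using T fin by simp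
  ultimately show "card (cycles 4) \<le> card E * (9 * \<kappa>)"
    by (meson surj_card_le of_nat_le_iff order_trans)
  have "card (SIGMA g:one f. two (f \<union> g)) \<le> 3 * D * (36 * \<kappa>)" if f: "f \<in> E" for f
  proof -
    have "card (SIGMA g:one f. two (f \<union> g)) \<le> card (one f) * (36 * \<kappa>)"
      using two[OF U2[OF f mem]] fin by (intro card_Sigma_le) auto
    also have "\<dots> \<le> 3 * D * (36 * \<kappa>)" using one[of f 3] T f k by (intro mult_right_mono) auto
    finally show ?thesis .
  qed
  then have "card P3 \<le> card E * (3 * D * (36 * \<kappa>))"
    unfolding P3_def using T fin by (intro card_Sigma_le) auto
  moreover have "cycles 6 \<subseteq> (\<lambda>(f, g, h). {f, g, h}) ` P3"
  proof
    fix F assume "F \<in> cycles 6"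
    then have F: "F \<in> short_cycles E" "card (\<Union>F) = 6" by (auto simp: cycles_def)
    from G F(1) show "F \<in> (\<lambda>(f, g, h). {f, g, h}) ` P3"
    proof (cases rule: short_cycle_cases)
      case (3 f g h)
      then have "(f, g, h) \<in> P3" by (simp add: P3_def one_def two_def)
      then show ?thesis using 3(1) by (intro image_eqI[of _ _ "(f, g, h)"]) simp_all
    qed (use F in simp_all)
  qed
  moreover have "finite P3" unfolding P3_def using T fin by simp
  ultimately show "card (cycles 6) \<le> card E * (3 * D * (36 * \<kappa>))"
    by (meson surj_card_le of_nat_le_iff order_trans)
  have "card (SIGMA g:one f. SIGMA h:one (f \<union> g). two (f \<union> g \<union> h)) \<le> 3 * D * (6 * D * (81 * \<kappa>))" if f: "f \<in> E" for f
  proof -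
    have "card (SIGMA h:one (f \<union> g). two (f \<union> g \<union> h)) \<le> 6 * D * (81 * \<kappa>)" if g: "g \<in> E" for g
    proof -
      have "card (SIGMA h:one (f \<union> g). two (f \<union> g \<union> h)) \<le> card (one (f \<union> g)) * (81 * \<kappa>)"
        using two[OF U3[OF f g mem]] fin by (intro card_Sigma_le) auto
      also have "\<dots> \<le> 6 * D * (81 * \<kappa>)" using one[OF U2[OF f g]] k by (intro mult_right_mono) auto
      finally show ?thesis .
    qed
    then have "card (SIGMA g:one f. SIGMA h:one (f \<union> g). two (f \<union> g \<union> h)) \<le> card (one f) * (6 * D * (81 * \<kappa>))"
      using mem fin by (intro card_Sigma_le) auto
    also have "\<dots> \<le> 3 * D * (6 * D * (81 * \<kappa>))" using one[of f 3] T f k D by (intro mult_right_mono) auto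
    finally show ?thesis .
  qed
  then have "card P4 \<le> card E * (3 * D * (6 * D * (81 * \<kappa>)))"
    unfolding P4_def using T fin by (intro card_Sigma_le) auto
  moreover have "cycles 8 \<subseteq> (\<lambda>(f, g, h, i). {f, g, h, i}) ` P4"
  proof
    fix F assume "F \<in> cycles 8"
    then have F: "F \<in> short_cycles E" "card (\<Union>F) = 8" by (auto simp: cycles_def)
    from G F(1) show "F \<in> (\<lambda>(f, g, h, i). {f, g, h, i}) ` P4"
    proof (cases rule: short_cycle_cases)
      case (4 f g h i)
      then have "(f, g, h, i) \<in> P4" by (simp add: P4_def one_def two_def)
      then show ?thesis using 4(1) by (intro image_eqI[of _ _ "(f, g, h, i)"]) simp_all
    qed (use F in simp_all)
  qed
  moreover have "finite P4" unfolding P4_def using T fin by simp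
  ultimately show "card (cycles 8) \<le> card E * (3 * D * (6 * D * (81 * \<kappa>)))"
    by (meson surj_card_le of_nat_le_iff order_trans)
qed

text \<open>The deletion method: in a random sample, one vertex of each remaining short cycle is
  removed. Passing to a low-degree half afterwards turns the edge bound
  \<open>3 * (p\<^sup>2 * D)\<close> per vertex into the degree bound with 18, and
  \<open>p / 2\<close> into \<open>p / 4\<close>.\<close>

lemma sparse_subsystem:
  fixes D \<kappa> p :: real
  assumes G: "triple_system V E" and deg: "\<And>v. v \<in> V \<Longrightarrow> degree 3 E v \<le> D" and D: "0 < D"
    and codeg: "\<And>x y. x \<noteq> y \<Longrightarrow> card {e \<in> E. x \<in> e \<and> y \<in> e} \<le> \<kappa>" and k: "0 \<le> \<kappa>"
    and p: "0 < p" "p \<le> 1"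
    and few: "D * (9 * \<kappa>) * p ^ 4 + D * (3 * D * (36 * \<kappa>)) * p ^ 6 + D * (3 * D * (6 * D * (81 * \<kappa>))) * p ^ 8 \<le> p / 6"
  obtains W where "W \<subseteq> V" "p / 4 * card V \<le> card W" "locally_sparse {e \<in> E. e \<subseteq> W}"
    "\<And>v. v \<in> W \<Longrightarrow> degree 3 {e \<in> E. e \<subseteq> W} v \<le> 18 * (p\<^sup>2 * D)"
proof -
  note T = triple_systemD[OF G]
  define n where "n = real (card V)"
  have "3 * real (card E) = (\<Sum>v\<in>V. real (degree 3 E v))"
    using sum_degree_3[OF G] by (simp flip: of_nat_sum)
  also have "\<dots> \<le> (\<Sum>v\<in>V. D)" using deg by (intro sum_mono) auto
  finally have cE: "card E \<le> n * D" "3 * card E \<le> n * D" by (simp_all add: n_def)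
  define S where "S = short_cycles E"
  define cyc where "cyc = (\<lambda>j. {F \<in> S. card (\<Union>F) = j})"
  have SE: "F \<subseteq> E" "F \<noteq> {}" "\<Union>F \<subseteq> V" if "F \<in> S" for F
    using that T by (auto simp: S_def short_cycles_def)
  have fS: "finite S" by (rule finite_subset[of _ "Pow E"]) (use SE T in auto)
  have Scyc: "S = cyc 4 \<union> cyc 6 \<union> cyc 8"
  proof -
    have "card (\<Union>F) \<in> {4, 6, 8}" if "F \<in> S" for F
      by (rule short_cycle_cases[OF G that[unfolded S_def]]) simp_all
    then show ?thesis by (auto simp: cyc_def)
  qed
  \<comment> \<open>The last term controls the number of edges inside \<open>C\<close> by the same
    expectation. Its coefficient makes it cost at most \<open>n * p / 3\<close>; cycles cost at most
    \<open>n * p / 6\<close>, so half of the expected \<open>n * p\<close> vertices remain.\<close>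
  define X where "X = (\<lambda>C. (\<Sum>v\<in>V. of_bool ({v} \<subseteq> C)) - (\<Sum>F\<in>S. of_bool (\<Union>F \<subseteq> C))
     - 1 / (3 * (p\<^sup>2 * D)) * (\<Sum>e\<in>E. of_bool (e \<subseteq> C)) :: real)"
  have "bernoulli_sum p V X = n * p - (\<Sum>F\<in>S. p ^ card (\<Union>F)) - 1 / (3 * (p\<^sup>2 * D)) * (card E * p ^ 3)"
  proof -
    have "bernoulli_sum p V (\<lambda>C. \<Sum>v\<in>V. of_bool ({v} \<subseteq> C)) = n * p"
      unfolding bernoulli_sum_sum using bernoulli_sum_superset[OF T(1), of "{_}" p] by (simp add: n_def)
    moreover have "bernoulli_sum p V (\<lambda>C. \<Sum>F\<in>S. of_bool (\<Union>F \<subseteq> C)) = (\<Sum>F\<in>S. p ^ card (\<Union>F))"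
      unfolding bernoulli_sum_sum by (intro sum.cong refl bernoulli_sum_superset T SE)
    moreover have "bernoulli_sum p V (\<lambda>C. \<Sum>e\<in>E. of_bool (e \<subseteq> C)) = card E * p ^ 3"
      unfolding bernoulli_sum_sum using T by (simp add: bernoulli_sum_superset)
    ultimately show ?thesis unfolding X_def bernoulli_sum_diff bernoulli_sum_cmult by simp
  qed
  moreover have "(\<Sum>F\<in>S. p ^ card (\<Union>F)) \<le> n * (p / 6)"
  proof -
    have "(\<Sum>F\<in>S. p ^ card (\<Union>F)) = (\<Sum>F\<in>cyc 4. p ^ 4) + (\<Sum>F\<in>cyc 6. p ^ 6) + (\<Sum>F\<in>cyc 8. p ^ 8)"
      unfolding Scyc using fS
      by (subst sum.union_disjoint; (subst sum.union_disjoint)?) (auto simp: cyc_def)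
    also have "\<dots> = card (cyc 4) * p ^ 4 + card (cyc 6) * p ^ 6 + card (cyc 8) * p ^ 8" by simp
    also have "\<dots> \<le> (n * D) * (9 * \<kappa>) * p ^ 4 + (n * D) * (3 * D * (36 * \<kappa>)) * p ^ 6
        + (n * D) * (3 * D * (6 * D * (81 * \<kappa>))) * p ^ 8"
    proof (intro add_mono mult_right_mono)
      have le: "real (card E) * y \<le> n * D * y" if "0 \<le> y" for y using cE(1) that by (rule mult_right_mono)
      note bounds = card_short_cycles[OF G deg less_imp_le[OF D] codeg k]
      show "card (cyc 4) \<le> n * D * (9 * \<kappa>)"
        unfolding cyc_def S_def using k by (intro order_trans[OF bounds(1) le]) auto
      show "card (cyc 6) \<le> n * D * (3 * D * (36 * \<kappa>))"
        unfolding cyc_def S_def using k D by (intro order_trans[OF bounds(2) le]) auto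
      show "card (cyc 8) \<le> n * D * (3 * D * (6 * D * (81 * \<kappa>)))"
        unfolding cyc_def S_def using k D by (intro order_trans[OF bounds(3) le]) auto
    qed (use p in simp_all)
    also have "\<dots> = n * (D * (9 * \<kappa>) * p ^ 4 + D * (3 * D * (36 * \<kappa>)) * p ^ 6 + D * (3 * D * (6 * D * (81 * \<kappa>))) * p ^ 8)"
      by (simp add: algebra_simps)
    also have "\<dots> \<le> n * (p / 6)" using few by (intro mult_left_mono) (auto simp: n_def)
    finally show ?thesis .
  qed
  moreover have "1 / (3 * (p\<^sup>2 * D)) * (card E * p ^ 3) \<le> n * (p / 3)"
  proof -
    have "1 / (3 * (p\<^sup>2 * D)) * (card E * p ^ 3) \<le> 1 / (3 * (p\<^sup>2 * D)) * (n * D * p ^ 3)"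
      using cE p D by (intro mult_left_mono mult_right_mono) auto
    also have "\<dots> = n * (p / 3)" using p D by (simp add: power2_eq_square power3_eq_cube)
    finally show ?thesis .
  qed
  ultimately have "n * (p / 2) \<le> bernoulli_sum p V X" by argo
  then obtain C where C: "C \<subseteq> V" "n * (p / 2) \<le> X C"
    by (rule bernoulli_sum_exists[rotated 3]) (use p T in auto)
  define R where "R = (\<lambda>F. SOME v. v \<in> \<Union>F) ` {F \<in> S. \<Union>F \<subseteq> C}"
  have SOME: "(SOME v. v \<in> \<Union>F) \<in> \<Union>F" if F: "F \<in> S" for F
  proof (rule someI_ex)
    obtain f where "f \<in> F" using SE(2)[OF F] by auto
    then have "f \<in> E" using SE(1)[OF F] by auto
    then have "f \<noteq> {}" using T(4) by fastforce
    then show "\<exists>v. v \<in> \<Union>F" using \<open>f \<in> F\<close> by auto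
  qed
  define W0 where "W0 = C - R"
  define E0 where "E0 = {e \<in> E. e \<subseteq> W0}"
  have finC: "finite C" using C T finite_subset by blast
  have RC: "R \<subseteq> C" using SOME by (auto simp: R_def)
  have cR: "card R \<le> card {F \<in> S. \<Union>F \<subseteq> C}" unfolding R_def using fS by (intro card_image_le) auto
  have XC: "X C = real (card C) - real (card {F \<in> S. \<Union>F \<subseteq> C}) - 1 / (3 * (p\<^sup>2 * D)) * card {e \<in> E. e \<subseteq> C}"
  proof -
    have "{v \<in> V. {v} \<subseteq> C} = C" using C(1) by blast
    then show ?thesis unfolding X_def card_eq_sum_of_bool[OF T(1), symmetric]
        card_eq_sum_of_bool[OF fS, symmetric] card_eq_sum_of_bool[OF T(2), symmetric] by (simp only:)
  qed
  have cW0: "real (card W0) = card C - card R"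
    unfolding W0_def using RC finC by (simp add: card_Diff_subset finite_subset of_nat_diff card_mono)
  have G0: "triple_system W0 E0"
    unfolding E0_def by (rule triple_system_restrict[OF G]) (use C(1) in \<open>auto simp: W0_def\<close>)
  have lower: "n * (p / 2) + 1 / (3 * (p\<^sup>2 * D)) * card E0 \<le> card W0"
  proof -
    have "card E0 \<le> card {e \<in> E. e \<subseteq> C}" unfolding E0_def W0_def using T by (intro card_mono) auto
    then have "1 / (3 * (p\<^sup>2 * D)) * card E0 \<le> 1 / (3 * (p\<^sup>2 * D)) * card {e \<in> E. e \<subseteq> C}"
      using p D by (intro mult_left_mono) auto
    then show ?thesis using C(2) XC cW0 cR by linarith
  qed
  have pD: "0 < 3 * (p\<^sup>2 * D)" using p D by simp
  have "0 \<le> n * (p / 2)" using p by (simp add: n_def)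
  then have "1 / (3 * (p\<^sup>2 * D)) * card E0 \<le> card W0" using lower by linarith
  then have "card E0 \<le> 3 * (p\<^sup>2 * D) * card W0" using pD by (simp add: field_simps)
  from triple_system_low_degree[OF G0 pD this] obtain W where W: "W \<subseteq> W0" "card W0 \<le> 2 * card W"
    "\<And>v. v \<in> W \<Longrightarrow> degree 3 {e \<in> E0. e \<subseteq> W} v \<le> 6 * (3 * (p\<^sup>2 * D))" by blast
  have EW: "{e \<in> E0. e \<subseteq> W} = {e \<in> E. e \<subseteq> W}" using W(1) by (auto simp: E0_def)
  have "short_cycles {e \<in> E. e \<subseteq> W} = {}"
  proof (rule ccontr)
    assume "short_cycles {e \<in> E. e \<subseteq> W} \<noteq> {}"
    then obtain F where F: "F \<in> short_cycles {e \<in> E. e \<subseteq> W}" by blast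
    then have "F \<in> S" "\<Union>F \<subseteq> W" unfolding S_def short_cycles_def by blast+
    moreover then have "\<Union>F \<subseteq> C" using W(1) by (auto simp: W0_def)
    ultimately have "(SOME v. v \<in> \<Union>F) \<in> R" "(SOME v. v \<in> \<Union>F) \<in> W0"
      using SOME[of F] W(1) by (auto simp: R_def)
    then show False by (simp add: W0_def)
  qed
  moreover have WV: "W \<subseteq> V" using W(1) C(1) by (auto simp: W0_def)
  ultimately have "locally_sparse {e \<in> E. e \<subseteq> W}"
    using locally_sparse_if_no_short_cycles[OF triple_system_restrict[OF G]] by blast
  moreover have "p / 4 * card V \<le> card W"
  proof -
    have "0 \<le> 1 / (3 * (p\<^sup>2 * D)) * real (card E0)" using pD by simp
    then have "n * (p / 2) \<le> card W0" using lower by linarith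
    then show ?thesis using W(2) by (simp add: n_def mult.commute)
  qed
  ultimately show ?thesis using that[of W] WV W(3)[unfolded EW] by auto
qed

text \<open>A sample with probability \<open>p\<close> has degrees of order
  \<open>P = p\<^sup>2 * x\<close>, where \<open>x = 6 * D\<close> bounds the degrees of a half of
  \<open>V\<close>. The loss \<open>p\<close> is exactly \<open>sqrt (P / x)\<close>, so the powers
  of \<open>P\<close> cancel against the bound for sparse systems, and only
  \<open>ln P = ln x / 16\<close> replaces \<open>ln x\<close>.\<close>

lemma triple_system_independent:
  obtains c D0 :: real where "0 < c"
    "\<And>(D :: real) (V :: 'a set) E. \<lbrakk>D0 \<le> D; triple_system V E; card E \<le> D * card V;
       \<And>x y. x \<noteq> y \<Longrightarrow> card {e \<in> E. x \<in> e \<and> y \<in> e} \<le> D powr (1 / 4)\<rbrakk> \<Longrightarrow>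
       \<exists>I\<subseteq>V. independent_set E I \<and> c * sqrt (ln D / D) * card V \<le> card I"
proof -
  obtain D1 where D1: "\<And>D (V :: 'a set) E. D \<ge> D1 \<Longrightarrow> finite V \<and> (\<forall>e\<in>E. e \<subseteq> V \<and> card e = 3) \<and> locally_sparse E \<and>
     (\<forall>v\<in>V. real (degree 3 E v) \<le> D) \<Longrightarrow>
     (\<exists>I\<subseteq>V. independent_set E I \<and> sqrt (ln D / D) / 256 * card V \<le> card I)"
    using sparse_triple_system_independent by metis
  \<comment> \<open>Relative to \<open>p\<close>, the three terms are of order \<open>x\<close> to
    the powers \<open>- 5 / 32\<close>, \<open>- 3 / 32\<close> and \<open>- 1 / 32\<close>. The
    exponent of \<open>p\<close> has to lie between \<open>- 1 / 2\<close>, so that the sampled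
    degrees grow, and \<open>- 13 / 28\<close>, so that cycles of length four are rare.\<close>
  have "eventually (\<lambda>x::real. 1 \<le> x \<and> D1 \<le> 18 * x powr (1 / 16) \<and>
      9 * (x * x powr (1 / 4) * (x powr (- 15 / 32)) ^ 4) + 108 * (x\<^sup>2 * x powr (1 / 4) * (x powr (- 15 / 32)) ^ 6)
        + 1458 * (x ^ 3 * x powr (1 / 4) * (x powr (- 15 / 32)) ^ 8) \<le> x powr (- 15 / 32) / 6) at_top"
    by (intro eventually_conj) real_asymp+
  then obtain D2 where D2: "\<And>x. x \<ge> D2 \<Longrightarrow> 1 \<le> x \<and> D1 \<le> 18 * x powr (1 / 16) \<and>
      9 * (x * x powr (1 / 4) * (x powr (- 15 / 32)) ^ 4) + 108 * (x\<^sup>2 * x powr (1 / 4) * (x powr (- 15 / 32)) ^ 6)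
        + 1458 * (x ^ 3 * x powr (1 / 4) * (x powr (- 15 / 32)) ^ 8) \<le> x powr (- 15 / 32) / 6"
    unfolding eventually_at_top_linorder by blast
  \<comment> \<open>256 is the constant for sparse systems, 8 combines the low-degree half with
    \<open>p / 4\<close>, and 42 is chosen because \<open>42 ^ 2\<close> exceeds
    \<open>16 * 18 * 6\<close>.\<close>
  define c where "c = 1 / (256 * 8 * 42 :: real)"
  have main: "\<exists>I\<subseteq>V. independent_set E I \<and> c * sqrt (ln D / D) * card V \<le> card I"
    if D: "1 \<le> D" "D2 \<le> D" and G: "triple_system V E" and cE: "card E \<le> D * card V"
      and codeg: "\<And>x y. x \<noteq> y \<Longrightarrow> card {e \<in> E. x \<in> e \<and> y \<in> e} \<le> D powr (1 / 4)"
    for D :: real and V :: "'a set" and E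
  proof -
    note T = triple_systemD[OF G]
    have "0 < D" using D by simp
    from triple_system_low_degree[OF G this cE] obtain V1 where V1: "V1 \<subseteq> V" "card V \<le> 2 * card V1"
      "\<And>v. v \<in> V1 \<Longrightarrow> degree 3 {e \<in> E. e \<subseteq> V1} v \<le> 6 * D" by blast
    define E1 where "E1 = {e \<in> E. e \<subseteq> V1}"
    define x where "x = 6 * D"
    define p where "p = x powr (- 15 / 32)"
    have x: "1 \<le> x" "D2 \<le> x" using D by (auto simp: x_def)
    note X = D2[OF x(2), folded p_def]
    have p: "0 < p" "p \<le> 1" using x powr_mono[of "- 15 / 32" 0 x] by (auto simp: p_def)
    have p2: "p\<^sup>2 * x = x powr (1 / 16)"
    proof -
      have "p\<^sup>2 * x = x powr (- 15 / 32) * x powr (- 15 / 32) * x powr 1"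
        using x by (simp add: p_def power2_eq_square)
      also have "\<dots> = x powr (1 / 16)" unfolding powr_add[symmetric] by simp
      finally show ?thesis .
    qed
    have G1: "triple_system V1 E1" unfolding E1_def by (rule triple_system_restrict[OF G V1(1)])
    have codeg1: "card {e \<in> E1. y \<in> e \<and> z \<in> e} \<le> x powr (1 / 4)" if "y \<noteq> z" for y z
    proof -
      have "card {e \<in> E1. y \<in> e \<and> z \<in> e} \<le> card {e \<in> E. y \<in> e \<and> z \<in> e}"
        unfolding E1_def using T by (intro card_mono) auto
      also have "real \<dots> \<le> D powr (1 / 4)" by (rule codeg[OF that])
      also have "\<dots> \<le> x powr (1 / 4)" using D by (intro powr_mono2) (auto simp: x_def)
      finally show ?thesis by simp
    qed
    have few: "x * (9 * x powr (1 / 4)) * p ^ 4 + x * (3 * x * (36 * x powr (1 / 4))) * p ^ 6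
        + x * (3 * x * (6 * x * (81 * x powr (1 / 4)))) * p ^ 8 \<le> p / 6"
    proof -
      have "x * (9 * x powr (1 / 4)) * p ^ 4 + x * (3 * x * (36 * x powr (1 / 4))) * p ^ 6
        + x * (3 * x * (6 * x * (81 * x powr (1 / 4)))) * p ^ 8
        = 9 * (x * x powr (1 / 4) * p ^ 4) + 108 * (x\<^sup>2 * x powr (1 / 4) * p ^ 6) + 1458 * (x ^ 3 * x powr (1 / 4) * p ^ 8)"
        by (simp add: power2_eq_square power3_eq_cube)
      then show ?thesis using X by simp
    qed
    obtain W where W: "W \<subseteq> V1" "p / 4 * card V1 \<le> card W" "locally_sparse {e \<in> E1. e \<subseteq> W}"
      "\<And>v. v \<in> W \<Longrightarrow> degree 3 {e \<in> E1. e \<subseteq> W} v \<le> 18 * (p\<^sup>2 * x)"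
    proof (rule sparse_subsystem[OF G1 _ _ codeg1 _ p few])
      show "real (degree 3 E1 v) \<le> x" if "v \<in> V1" for v using V1(3)[OF that] by (simp add: x_def E1_def)
    qed (use x in auto)
    define P where "P = x powr (1 / 16)"
    have P: "1 \<le> P" using x by (simp add: P_def ge_one_powr_ge_zero)
    have GW: "triple_system W {e \<in> E1. e \<subseteq> W}" by (rule triple_system_restrict[OF G1 W(1)])
    have "D1 \<le> 18 * P" using X by (simp add: P_def)
    moreover have "finite W \<and> (\<forall>e\<in>{e \<in> E1. e \<subseteq> W}. e \<subseteq> W \<and> card e = 3) \<and> locally_sparse {e \<in> E1. e \<subseteq> W} \<and>
       (\<forall>v\<in>W. real (degree 3 {e \<in> E1. e \<subseteq> W} v) \<le> 18 * P)"
      using GW W(3) W(4)[unfolded p2, folded P_def] unfolding triple_system_def by simp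
    ultimately have "\<exists>I\<subseteq>W. independent_set {e \<in> E1. e \<subseteq> W} I \<and> sqrt (ln (18 * P) / (18 * P)) / 256 * card W \<le> card I"
      by (rule D1)
    then obtain I where I: "I \<subseteq> W" "independent_set {e \<in> E1. e \<subseteq> W} I"
      "sqrt (ln (18 * P) / (18 * P)) / 256 * card W \<le> card I" by (elim exE conjE)
    have "independent_set E I"
      unfolding independent_set_def
    proof (intro ballI notI)
      fix e assume "e \<in> E" "e \<subseteq> I"
      moreover from this have "e \<subseteq> W" "e \<subseteq> V1" using I(1) W(1) by (meson order_trans)+
      ultimately have "e \<in> {e \<in> E1. e \<subseteq> W}" by (simp add: E1_def)
      then show False using I(2) \<open>e \<subseteq> I\<close> unfolding independent_set_def by blast
    qed
    moreover have "I \<subseteq> V" using I(1) W(1) V1(1) by (meson order_trans)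
    moreover have "c * sqrt (ln D / D) * card V \<le> card I"
    proof -
      have "sqrt (ln D / D) / 42 \<le> sqrt (ln (18 * P) / (18 * P)) * p"
      proof -
        have "ln x / 16 = ln P" using x by (simp add: P_def ln_powr)
        also have "\<dots> \<le> ln (18 * P)" using P by simp
        finally have "ln x / 16 \<le> ln (18 * P)" .
        moreover have "ln D \<le> ln x" using D by (subst ln_le_cancel_iff) (auto simp: x_def)
        ultimately have lnP: "ln D / 16 \<le> ln (18 * P)" by linarith
        have "ln D / D / 1764 \<le> ln D / 16 / (18 * x)"
          using D by (simp add: x_def divide_simps)
        also have "\<dots> \<le> ln (18 * P) / (18 * x)" using lnP x by (intro divide_right_mono) auto
        also have "\<dots> = ln (18 * P) / (18 * P) * p\<^sup>2"
          using p2 P x by (simp add: P_def[symmetric] field_simps)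
        finally have "sqrt (ln D / D / 42\<^sup>2) \<le> sqrt (ln (18 * P) / (18 * P) * p\<^sup>2)" by simp
        then show ?thesis using p by (simp add: real_sqrt_mult real_sqrt_divide)
      qed
      then have le: "sqrt (ln D / D) / 42 * (card V / 2048) \<le> sqrt (ln (18 * P) / (18 * P)) * p * (card V / 2048)"
        by (intro mult_right_mono) auto
      have "c * sqrt (ln D / D) * card V = sqrt (ln D / D) / 42 * (card V / 2048)" by (simp add: c_def)
      also note le
      also have "sqrt (ln (18 * P) / (18 * P)) * p * (card V / 2048) \<le> sqrt (ln (18 * P) / (18 * P)) / 256 * card W"
      proof -
        have "p / 8 * card V \<le> p / 4 * card V1" using V1(2) p by (simp add: mult_left_mono)
        also have "\<dots> \<le> card W" by (rule W)
        finally have "sqrt (ln (18 * P) / (18 * P)) / 256 * (p / 8 * card V) \<le> sqrt (ln (18 * P) / (18 * P)) / 256 * card W"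
          using P by (intro mult_left_mono) auto
        then show ?thesis by (simp add: mult_ac)
      qed
      also note I(3)
      finally show ?thesis .
    qed
    ultimately show ?thesis by blast
  qed
  show ?thesis
  proof (rule that[of c "max 1 D2"])
    show "0 < c" by (simp add: c_def)
  qed (rule main, simp_all)
qed

section \<open>Sets with prescribed sum modulo $k$\<close>

text \<open>A Graham-Sloane code: constant-weight words grouped by a sum modulo \<open>k\<close>,
  which forces distinct members apart.\<close>

definition residue_sets :: "nat \<Rightarrow> nat \<Rightarrow> nat \<Rightarrow> nat set set" where
  "residue_sets k s c = {e. e \<subseteq> {..<k} \<and> card e = s \<and> \<Sum>e mod k = c}"

definition crowded_triples :: "nat \<Rightarrow> nat \<Rightarrow> nat \<Rightarrow> nat set set set" where
  "crowded_triples k s c = {t. t \<subseteq> residue_sets k s c \<and> card t = 3 \<and> card (\<Union>t) \<le> s + 2}"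

lemma residue_setsD:
  assumes "e \<in> residue_sets k s c"
  shows "e \<subseteq> {..<k}" "finite e" "card e = s" "\<Sum>e mod k = c"
  using assms finite_subset by (auto simp: residue_sets_def)

lemma add_mod_cancel:
  fixes x y a k :: nat
  assumes "(a + x) mod k = (a + y) mod k" "x < k" "y < k"
  shows "x = y"
  using assms cong_add_lcancel_nat[of a x y k] cong_less_modulus_unique_nat[of x y k]
  by (simp add: cong_def)

text \<open>Exchanging a single element of \<open>[0, k)\<close> for another changes the sum modulo
  \<open>k\<close>, so two members differ in at least two elements on each side.\<close>

lemma residue_sets_union_card:
  assumes e: "e \<in> residue_sets k s c" "f \<in> residue_sets k s c" "e \<noteq> f"
  shows "s + 2 \<le> card (e \<union> f)"
proof (rule ccontr)
  assume less: "\<not> ?thesis"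
  note E = residue_setsD[OF e(1)] and F = residue_setsD[OF e(2)]
  have eq: "card (e - f) = card (f - e)"
    using card_Int_Diff[OF E(2), of f] card_Int_Diff[OF F(2), of e] E(3) F(3) by (simp add: Int_commute)
  have "card (e \<union> f) = s + card (f - e)"
    using card_Un_disjoint[of e "f - e"] E F by simp
  then have "card (f - e) \<le> 1" using less by simp
  moreover have "card (f - e) \<noteq> 0"
  proof
    assume 0: "card (f - e) = 0"
    then have "f - e = {}" using F(2) by (simp only: card_0_eq finite_Diff)
    moreover have "e - f = {}" using 0[folded eq] E(2) by (simp only: card_0_eq finite_Diff)
    ultimately show False using e(3) by blast
  qed
  ultimately have "card (f - e) = 1" "card (e - f) = 1" using eq by simp_all
  then obtain x y where x: "e - f = {x}" and y: "f - e = {y}" by (meson card_1_singletonE)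
  have "\<Sum>e = \<Sum>(e \<inter> f) + x" "\<Sum>f = \<Sum>(e \<inter> f) + y"
    using sum.Int_Diff[OF E(2), of "\<lambda>x. x" f] sum.Int_Diff[OF F(2), of "\<lambda>x. x" e] x y
    by (simp_all add: Int_commute)
  then have "(\<Sum>(e \<inter> f) + x) mod k = (\<Sum>(e \<inter> f) + y) mod k" using E(4) F(4) by simp
  moreover have xy: "x \<in> e" "y \<in> f" "x \<notin> f" using x y by blast+
  then have "x < k" "y < k" using E(1) F(1) by auto
  ultimately have "x = y" by (rule add_mod_cancel)
  then show False using xy by simp
qed

lemma residue_sets_complement:
  assumes e: "e \<in> residue_sets k s c" and S: "e \<subseteq> S" "finite S" "card S = s + 2"
  obtains x y where "x \<noteq> y" "x \<in> S" "y \<in> S" "e = S - {x, y}" "(c + (x + y)) mod k = \<Sum>S mod k"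
proof -
  note E = residue_setsD[OF e]
  have "card (S - e) = 2" using S E by (simp add: card_Diff_subset)
  then obtain x y where xy: "S - e = {x, y}" "x \<noteq> y" by (auto simp: card_2_iff)
  have "e = S - (S - e)" using S(1) by blast
  moreover have "x \<in> S" "y \<in> S" using xy(1) by blast+
  moreover have "\<Sum>S = \<Sum>e + (x + y)"
    using sum.subset_diff[OF S(1,2), of "\<lambda>x. x"] xy by simp
  then have "(c + (x + y)) mod k = \<Sum>S mod k" using mod_add_left_eq[of "\<Sum>e" k "x + y"] E(4) by simp
  ultimately show ?thesis using that[of x y] xy by simp
qed

lemma crowded_triplesD:
  assumes t: "t \<in> crowded_triples k s c"
  shows "finite (\<Union>t)" "\<Union>t \<subseteq> {..<k}" "card (\<Union>t) = s + 2" "\<And>e. e \<in> t \<Longrightarrow> e \<in> residue_sets k s c"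
    "\<And>e f. \<lbrakk>e \<in> t; f \<in> t; e \<noteq> f\<rbrakk> \<Longrightarrow> e \<union> f = \<Union>t"
proof -
  show mem: "\<And>e. e \<in> t \<Longrightarrow> e \<in> residue_sets k s c" using t by (auto simp: crowded_triples_def)
  have c3: "card t = 3" using t by (simp add: crowded_triples_def)
  have le: "card (\<Union>t) \<le> s + 2" using t by (simp add: crowded_triples_def)
  have "finite t" using c3 by (intro card_ge_0_finite) simp
  then show fin: "finite (\<Union>t)" using mem residue_setsD(2) by blast
  show "\<Union>t \<subseteq> {..<k}" using mem residue_setsD(1) by blast
  show eq: "e \<union> f = \<Union>t" if ef: "e \<in> t" "f \<in> t" "e \<noteq> f" for e f
  proof (rule card_seteq[OF fin])
    show "e \<union> f \<subseteq> \<Union>t" using ef by blast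
    show "card (\<Union>t) \<le> card (e \<union> f)"
      using residue_sets_union_card[OF mem[OF ef(1)] mem[OF ef(2)] ef(3)] le by simp
  qed
  obtain e f g where "t = {e, f, g}" "e \<noteq> f" using c3 by (auto simp: card_3_iff)
  then have ef: "e \<in> t" "f \<in> t" "e \<noteq> f" by simp_all
  show "card (\<Union>t) = s + 2"
    using residue_sets_union_card[OF mem[OF ef(1)] mem[OF ef(2)] ef(3)] le eq[OF ef] by simp
qed

lemma crowded_triples_system: "triple_system (residue_sets k s c) (crowded_triples k s c)"
proof -
  have "residue_sets k s c \<subseteq> Pow {..<k}" by (auto simp: residue_sets_def)
  then have "finite (residue_sets k s c)" by (rule finite_subset) simp
  then show ?thesis by (simp add: triple_system_def crowded_triples_def)
qed

text \<open>Two members determine the surrounding set \<open>S\<close> as their union. A third one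
  is \<open>S - {x, y}\<close> with the residue of \<open>x + y\<close> prescribed, so
  \<open>x\<close> alone determines it.\<close>

lemma crowded_triples_codegree:
  assumes "e \<noteq> f"
  shows "card {t \<in> crowded_triples k s c. e \<in> t \<and> f \<in> t} \<le> s + 2"
proof (cases "{t \<in> crowded_triples k s c. e \<in> t \<and> f \<in> t} = {}")
  case True
  show ?thesis unfolding True by simp
next
  case False
  define S where "S = e \<union> f"
  have S: "\<Union>t = S" if "t \<in> crowded_triples k s c" "e \<in> t" "f \<in> t" for t
    using crowded_triplesD(5)[OF that assms] by (simp add: S_def)
  define \<eta> where "\<eta> = (\<lambda>x. THE y. y < k \<and> (c + (x + y)) mod k = \<Sum>S mod k)"
  have "{t \<in> crowded_triples k s c. e \<in> t \<and> f \<in> t} \<subseteq> (\<lambda>x. {e, f, S - {x, \<eta> x}}) ` S"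
  proof
    fix t assume "t \<in> {t \<in> crowded_triples k s c. e \<in> t \<and> f \<in> t}"
    then have t: "t \<in> crowded_triples k s c" "e \<in> t" "f \<in> t" by simp_all
    note T = crowded_triplesD[OF t(1), unfolded S[OF t]]
    have "card t = 3" using t by (simp add: crowded_triples_def)
    then have "card (t - {e, f}) = 1" using t assms by (simp add: card_Diff_subset)
    then obtain h where h: "t - {e, f} = {h}" by (rule card_1_singletonE)
    then have "h \<in> t" by blast
    have "h \<subseteq> S" using S[OF t] \<open>h \<in> t\<close> by blast
    then obtain x y where xy: "x \<noteq> y" "x \<in> S" "y \<in> S" "h = S - {x, y}" "(c + (x + y)) mod k = \<Sum>S mod k"
      by (rule residue_sets_complement[OF T(4)[OF \<open>h \<in> t\<close>] _ T(1,3)])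
    have "\<eta> x = y" unfolding \<eta>_def
    proof (rule the_equality)
      show "y < k \<and> (c + (x + y)) mod k = \<Sum>S mod k" using xy T(2) by auto
      show "z = y" if "z < k \<and> (c + (x + z)) mod k = \<Sum>S mod k" for z
        using add_mod_cancel[of "c + x" z k y] that xy T(2) by (auto simp: add.assoc)
    qed
    moreover have "t = {e, f} \<union> (t - {e, f})" using t by blast
    ultimately have "t = {e, f, S - {x, \<eta> x}}" using h xy by (simp add: insert_commute)
    then show "t \<in> (\<lambda>x. {e, f, S - {x, \<eta> x}}) ` S" using xy(2) by (rule image_eqI)
  qed
  moreover obtain t where t: "t \<in> crowded_triples k s c" "e \<in> t" "f \<in> t" using False by blast
  ultimately have "card {t \<in> crowded_triples k s c. e \<in> t \<and> f \<in> t} \<le> card S"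
    using crowded_triplesD(1)[OF t(1)] S[OF t] by (intro surj_card_le) auto
  then show ?thesis using crowded_triplesD(3)[OF t(1)] S[OF t] by simp
qed

text \<open>The three complements in the union are disjoint pairs with equal sums modulo
  \<open>k\<close>. Hence \<open>x\<close>, \<open>y\<close>, \<open>x'\<close>, \<open>x''\<close>
  and the \<open>s - 4\<close> remaining elements determine the triple. The partner function
  \<open>\<eta>\<close> depends on \<open>x + y\<close> only and not on \<open>c\<close>, so one
  encoding serves all residues at once.\<close>

lemma crowded_triples_total:
  assumes "4 \<le> s"
  shows "(\<Sum>c<k. card (crowded_triples k s c)) \<le> k ^ 4 * (k choose (s - 4))"
proof -
  define \<eta> where "\<eta> = (\<lambda>x y x'. THE y'. y' < k \<and> (x' + y') mod k = (x + y) mod k)"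
  define S where "S = (\<lambda>x y x' x'' f. f \<union> {x, y, x', \<eta> x y x', x'', \<eta> x y x''})"
  define \<Phi> where "\<Phi> = (\<lambda>(x, y, x', x'', f). {S x y x' x'' f - {x, y}, S x y x' x'' f - {x', \<eta> x y x'},
      S x y x' x'' f - {x'', \<eta> x y x''}})"
  define K where "K = {..<k}"
  define P where "P = K \<times> K \<times> K \<times> K \<times> {f. f \<subseteq> K \<and> card f = s - 4}"
  have fin: "finite (crowded_triples k s c)" for c
    using triple_systemD(2)[OF crowded_triples_system] .
  have "t \<in> \<Phi> ` P" if t: "t \<in> crowded_triples k s c" for t c
  proof -
    note T = crowded_triplesD[OF t]
    define U where "U = \<Union>t"
    have "card t = 3" using t by (simp add: crowded_triples_def)
    then obtain e f g where t_eq: "t = {e, f, g}" and ne: "e \<noteq> f" "e \<noteq> g" "f \<noteq> g" by (auto simp: card_3_iff)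
    have mem: "e \<in> t" "f \<in> t" "g \<in> t" using t_eq by simp_all
    have sub: "h \<subseteq> U" if "h \<in> t" for h using that by (auto simp: U_def)
    note TU = T(1-3)[folded U_def]
    obtain x y where x: "x \<noteq> y" "x \<in> U" "y \<in> U" "e = U - {x, y}" "(c + (x + y)) mod k = \<Sum>U mod k"
      by (rule residue_sets_complement[OF T(4)[OF mem(1)] sub[OF mem(1)] TU(1,3)])
    obtain x' y' where x': "x' \<noteq> y'" "x' \<in> U" "y' \<in> U" "f = U - {x', y'}" "(c + (x' + y')) mod k = \<Sum>U mod k"
      by (rule residue_sets_complement[OF T(4)[OF mem(2)] sub[OF mem(2)] TU(1,3)])
    obtain x'' y'' where x'': "x'' \<noteq> y''" "x'' \<in> U" "y'' \<in> U" "g = U - {x'', y''}" "(c + (x'' + y'')) mod k = \<Sum>U mod k"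
      by (rule residue_sets_complement[OF T(4)[OF mem(3)] sub[OF mem(3)] TU(1,3)])
    have UK: "z < k" if "z \<in> U" for z using TU(2) that by auto
    have \<eta>: "\<eta> x y a = b" if ab: "a \<in> U" "b \<in> U" "(c + (a + b)) mod k = \<Sum>U mod k" for a b
      unfolding \<eta>_def
    proof (rule the_equality)
      have "[c + (a + b) = c + (x + y)] (mod k)" unfolding cong_def using ab(3) x(5) by simp
      then have "[a + b = x + y] (mod k)" by (simp only: cong_add_lcancel_nat)
      then show *: "b < k \<and> (a + b) mod k = (x + y) mod k" unfolding cong_def using UK[OF ab(2)] by simp
      show "z = b" if "z < k \<and> (a + z) mod k = (x + y) mod k" for z
        using add_mod_cancel[of a z k b] that * by simp
    qed
    have disjI: "A \<inter> B = {}" if "(U - A) \<union> (U - B) = U" "A \<subseteq> U" for A B using that by blast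
    have XU: "{x, y} \<subseteq> U" "{x', y'} \<subseteq> U" "{x'', y''} \<subseteq> U" using x(2,3) x'(2,3) x''(2,3) by simp_all
    define B where "B = {x, y} \<union> {x', y'} \<union> {x'', y''}"
    have "{x, y} \<inter> {x', y'} = {}"
      by (rule disjI[OF _ XU(1)]) (use T(5)[OF mem(1,2) ne(1)] x(4) x'(4) in \<open>simp add: U_def\<close>)
    moreover have "{x, y} \<inter> {x'', y''} = {}"
      by (rule disjI[OF _ XU(1)]) (use T(5)[OF mem(1,3) ne(2)] x(4) x''(4) in \<open>simp add: U_def\<close>)
    moreover have "{x', y'} \<inter> {x'', y''} = {}"
      by (rule disjI[OF _ XU(2)]) (use T(5)[OF mem(2,3) ne(3)] x'(4) x''(4) in \<open>simp add: U_def\<close>)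
    moreover have "card {x, y} = 2" "card {x', y'} = 2" "card {x'', y''} = 2" using x(1) x'(1) x''(1) by simp_all
    ultimately have "card B = 6"
      unfolding B_def by (subst card_Un_disjoint, simp, simp, simp only: Int_Un_distrib2 Un_empty_left)+ simp
    moreover define F where "F = U - B"
    moreover have BU: "B \<subseteq> U" unfolding B_def using XU by (intro Un_least)
    ultimately have "card F = s - 4"
      unfolding F_def using TU(1,3) BU by (simp add: card_Diff_subset finite_subset)
    moreover have "F \<subseteq> K" using TU(2) by (auto simp: F_def K_def)
    ultimately have P: "(x, y, x', x'', F) \<in> P"
      using x(2,3) x'(2) x''(2) UK by (simp add: P_def K_def)
    have "F \<union> B = U" unfolding F_def using BU by (simp only: Un_Diff_cancel2 Un_absorb2)
    moreover have "B = {x, y, x', y', x'', y''}" unfolding B_def by (rule set_eqI) auto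
    ultimately have "F \<union> {x, y, x', y', x'', y''} = U" by simp
    then have "S x y x' x'' F = U" unfolding S_def using \<eta>[OF x'(2,3,5)] \<eta>[OF x''(2,3,5)] by simp
    then have "\<Phi> (x, y, x', x'', F) = t"
      unfolding \<Phi>_def t_eq x(4) x'(4) x''(4) using \<eta>[OF x'(2,3,5)] \<eta>[OF x''(2,3,5)] by simp
    then show ?thesis using P by (metis image_eqI)
  qed
  then have sub: "(\<Union>c<k. crowded_triples k s c) \<subseteq> \<Phi> ` P" by blast
  have finP: "finite P" by (simp add: P_def K_def)
  have "(\<Sum>c<k. card (crowded_triples k s c)) = card (\<Union>c<k. crowded_triples k s c)"
  proof (rule card_UN_disjoint[symmetric])
    show "\<forall>c\<in>{..<k}. \<forall>d\<in>{..<k}. c \<noteq> d \<longrightarrow> crowded_triples k s c \<inter> crowded_triples k s d = {}"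
    proof (intro ballI impI equals0I)
      fix c d t assume "c \<noteq> d" and t: "t \<in> crowded_triples k s c \<inter> crowded_triples k s d"
      have "card t = 3" using t by (simp add: crowded_triples_def)
      then obtain e where "e \<in> t" by fastforce
      then have "e \<in> residue_sets k s c" "e \<in> residue_sets k s d" using t crowded_triplesD(4) by blast+
      then show False using \<open>c \<noteq> d\<close> by (simp add: residue_sets_def)
    qed
  qed (use fin in auto)
  also have "\<dots> \<le> card P" using surj_card_le[OF finP sub] .
  also have "card P = k ^ 4 * (k choose (s - 4))"
    by (simp add: P_def K_def card_cartesian_product n_subsets power4_eq_xxxx)
  finally show ?thesis .
qed

section \<open>Choice of the residue\<close>

lemma binomial_ratio_step:
  assumes "Suc j \<le> r" "2 * r \<le> k"
  shows "k * (k choose j) \<le> 2 * r * (k choose Suc j)"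
proof -
  have "k * (k choose j) \<le> 2 * (k - j) * (k choose j)" using assms by (intro mult_right_mono) auto
  also have "\<dots> = 2 * (Suc j * (k choose Suc j))"
    using binomial_absorption[of j k] binomial_absorb_comp[of k j] by simp
  also have "\<dots> \<le> 2 * (r * (k choose Suc j))" using assms by (intro mult_left_mono mult_right_mono) auto
  finally show ?thesis by simp
qed

lemma binomial_ratio_4:
  assumes "j + 4 \<le> r" "2 * r \<le> k"
  shows "k ^ 4 * (k choose j) \<le> 16 * r ^ 4 * (k choose (j + 4))"
proof -
  have "k ^ i * (k choose j) \<le> (2 * r) ^ i * (k choose (j + i))" if "j + i \<le> r" for i
    using that
  proof (induction i)
    case (Suc i)
    have "k ^ Suc i * (k choose j) = k * (k ^ i * (k choose j))" by simp
    also have "\<dots> \<le> k * ((2 * r) ^ i * (k choose (j + i)))" using Suc by (intro mult_left_mono) auto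
    also have "\<dots> = (2 * r) ^ i * (k * (k choose (j + i)))" by simp
    also have "\<dots> \<le> (2 * r) ^ i * (2 * r * (k choose Suc (j + i)))"
      using Suc.prems assms by (intro mult_left_mono binomial_ratio_step) auto
    finally show ?case by (simp add: mult_ac)
  qed simp
  from this[of 4] assms show ?thesis by (simp add: power_mult_distrib)
qed

text \<open>Averaging \<open>N c - T c / Q\<close> over the residues secures both bounds
  simultaneously: the triples use up at most half of the total, so some residue attains half of the
  average class size, and there \<open>T c / Q\<close> cannot exceed \<open>N c\<close>.\<close>

lemma good_residue_class:
  assumes r: "5 \<le> r"
  defines "k \<equiv> r\<^sup>2" and "s \<equiv> r - 1"
  obtains c :: nat where "real (k choose s) / (2 * real k) \<le> real (card (residue_sets k s c))"
    "real (card (crowded_triples k s c)) \<le> 32 * real r ^ 4 * real (card (residue_sets k s c))"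
proof -
  have k: "0 < k" "2 * r \<le> k" using r by (auto simp: k_def power2_eq_square)
  define N where "N = (\<lambda>c. real (card (residue_sets k s c)))"
  define T where "T = (\<lambda>c. real (card (crowded_triples k s c)))"
  have fin: "finite (residue_sets k s c)" for c using triple_systemD(1)[OF crowded_triples_system] .
  have "(\<Sum>c<k. card (residue_sets k s c)) = card (\<Union>c<k. residue_sets k s c)"
    by (rule card_UN_disjoint[symmetric]) (auto simp: fin residue_sets_def)
  also have "(\<Union>c<k. residue_sets k s c) = {e. e \<subseteq> {..<k} \<and> card e = s}"
    using k by (auto simp: residue_sets_def)
  also have "card \<dots> = k choose s" by (simp add: n_subsets)
  finally have N: "(\<Sum>c<k. N c) = k choose s" unfolding N_def by (simp flip: of_nat_sum)
  have "(\<Sum>c<k. card (crowded_triples k s c)) \<le> 16 * r ^ 4 * (k choose s)"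
  proof (rule order_trans[OF crowded_triples_total])
    show "4 \<le> s" using r by (simp add: s_def)
    then show "k ^ 4 * (k choose (s - 4)) \<le> 16 * r ^ 4 * (k choose s)"
      using binomial_ratio_4[of "s - 4" r k] k by (simp add: s_def)
  qed
  then have "real (\<Sum>c<k. card (crowded_triples k s c)) \<le> real (16 * r ^ 4 * (k choose s))" by (rule of_nat_mono)
  then have T: "(\<Sum>c<k. T c) \<le> 16 * real r ^ 4 * (k choose s)" by (simp add: T_def)
  define Q where "Q = 32 * real r ^ 4"
  have Q: "0 < Q" using r by (simp add: Q_def)
  have "\<exists>c<k. real (k choose s) / (2 * real k) \<le> N c - T c / Q"
  proof (rule ccontr)
    assume "\<not> ?thesis"
    then have "(\<Sum>c<k. N c - T c / Q) < (\<Sum>c<k. real (k choose s) / (2 * real k))"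
      using k by (intro sum_strict_mono) auto
    also have "\<dots> = real (k choose s) / 2" using k by simp
    finally have "(k choose s) - (\<Sum>c<k. T c) / Q < real (k choose s) / 2"
      by (simp add: sum_subtractf N flip: sum_divide_distrib)
    moreover have "(\<Sum>c<k. T c) / Q \<le> real (k choose s) / 2"
      using T Q by (simp add: divide_le_eq Q_def mult_ac)
    ultimately show False by simp
  qed
  then obtain c where c: "real (k choose s) / (2 * real k) \<le> N c - T c / Q" by blast
  show ?thesis
  proof (rule that[of c])
    have "0 \<le> T c / Q" using Q by (simp add: T_def)
    then show "real (k choose s) / (2 * real k) \<le> real (card (residue_sets k s c))" using c by (simp add: N_def)
    have "0 \<le> real (k choose s) / (2 * real k)" by simp
    then have "T c / Q \<le> N c" using c by linarith
    then show "real (card (crowded_triples k s c)) \<le> 32 * real r ^ 4 * real (card (residue_sets k s c))"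
      using Q by (simp add: divide_le_eq N_def T_def Q_def mult_ac)
  qed
qed

lemma independent_crowded_triples:
  assumes H: "H \<subseteq> residue_sets k s c" "independent_set (crowded_triples k s c) H"
    and S: "finite S" "card S = s + 2"
  shows "card {h \<in> H. h \<subseteq> S} \<le> 2"
proof (rule ccontr)
  assume "\<not> ?thesis"
  then obtain t where t: "t \<subseteq> {h \<in> H. h \<subseteq> S}" "card t = 3"
    using obtain_subset_with_card_n[of 3 "{h \<in> H. h \<subseteq> S}"] by force
  then have "card (\<Union>t) \<le> card S" using S by (intro card_mono) auto
  then have "t \<in> crowded_triples k s c" using t H(1) S by (auto simp: crowded_triples_def)
  then show False using H(2) t(1) unfolding independent_set_def by blast
qed

section \<open>The sets one element above an independent family\<close>

definition shadow_up :: "nat \<Rightarrow> nat set set \<Rightarrow> nat set set" where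
  "shadow_up k H = {f. f \<subseteq> {..<k} \<and> (\<exists>h\<in>H. h \<subseteq> f \<and> card f = card h + 1)}"

text \<open>No set is counted twice: two distinct members of \<open>H\<close> have a union of at
  least \<open>s + 2\<close> elements and do not fit into a common set of size
  \<open>s + 1\<close>.\<close>

lemma shadow_up_card:
  assumes H: "H \<subseteq> residue_sets k s c"
  shows "card (shadow_up k H) = card H * (k - s)"
proof -
  have R: "h \<in> residue_sets k s c" if "h \<in> H" for h using H that by blast
  have finH: "finite H" using H triple_systemD(1)[OF crowded_triples_system] finite_subset by blast
  define P where "P = (SIGMA h:H. {..<k} - h)"
  have "inj_on (\<lambda>(h, x). insert x h) P"
  proof (rule inj_onI, clarify)
    fix h x h' x' assume hx: "(h, x) \<in> P" "(h', x') \<in> P" and eq: "insert x h = insert x' h'"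
    have mem: "h \<in> H" "x \<notin> h" "h' \<in> H" "x' \<notin> h'" using hx by (simp_all add: P_def)
    note h = residue_setsD[OF R[OF mem(1)]]
    have sub: "h \<union> h' \<subseteq> insert x h" unfolding eq using eq by blast
    have "card (h \<union> h') \<le> card (insert x h)" by (rule card_mono[OF _ sub]) (simp add: h(2))
    then have "\<not> s + 2 \<le> card (h \<union> h')" using h(2,3) mem(2) by simp
    then have "h = h'" using residue_sets_union_card[OF R[OF mem(1)] R[OF mem(3)]] by metis
    moreover have "x \<in> insert x' h'" unfolding eq[symmetric] by simp
    ultimately show "h = h' \<and> x = x'" using mem(2) by simp
  qed
  moreover have "(\<lambda>(h, x). insert x h) ` P = shadow_up k H"
  proof
    show "(\<lambda>(h, x). insert x h) ` P \<subseteq> shadow_up k H"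
    proof clarify
      fix h x assume "(h, x) \<in> P"
      then have hx: "h \<in> H" "x < k" "x \<notin> h" by (simp_all add: P_def)
      note h = residue_setsD[OF R[OF hx(1)]]
      have "insert x h \<subseteq> {..<k}" using h(1) hx(2) by simp
      moreover have "card (insert x h) = card h + 1" using h hx(3) by simp
      ultimately show "insert x h \<in> shadow_up k H" unfolding shadow_up_def using hx(1) by blast
    qed
    show "shadow_up k H \<subseteq> (\<lambda>(h, x). insert x h) ` P"
    proof
      fix f assume "f \<in> shadow_up k H"
      then obtain h where h: "f \<subseteq> {..<k}" "h \<in> H" "h \<subseteq> f" "card f = card h + 1" by (auto simp: shadow_up_def)
      have "card (f - h) = 1" using h residue_setsD(2)[OF R[OF h(2)]] by (simp add: card_Diff_subset)
      then obtain x where x: "f - h = {x}" by (rule card_1_singletonE)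
      then have "x < k" "x \<notin> h" using h(1) by blast+
      moreover have "f = insert x h" using x h(3) by blast
      ultimately show "f \<in> (\<lambda>(h, x). insert x h) ` P"
        using h(2) by (intro image_eqI[of _ _ "(h, x)"]) (simp_all add: P_def)
    qed
  qed
  moreover have "card P = (\<Sum>h\<in>H. card ({..<k} - h))" unfolding P_def using finH by simp
  moreover have "\<dots> = (\<Sum>h\<in>H. k - s)"
    using residue_setsD[OF R] by (intro sum.cong) (simp_all add: card_Diff_subset)
  ultimately show ?thesis using card_image[of "\<lambda>(h, x). insert x h" P] by simp
qed

text \<open>The members of the shadow inside \<open>S\<close> are the sets \<open>S - {x}\<close>
  with \<open>x\<close> outside some \<open>h \<in> HS\<close>. Any two such \<open>h\<close> cover
  \<open>S\<close>, so their complements are disjoint pairs and the count is exactly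
  \<open>2 * card HS\<close>.\<close>

lemma shadow_up_even:
  assumes H: "H \<subseteq> residue_sets k s c" "independent_set (crowded_triples k s c) H"
    and S: "S \<subseteq> {..<k}" "card S = s + 2"
  shows "card {f \<in> shadow_up k H. f \<subseteq> S} \<in> {0, 2, 4}"
proof -
  have R: "h \<in> residue_sets k s c" if "h \<in> H" for h using H that by blast
  have finS: "finite S" using S(1) finite_subset by blast
  define HS where "HS = {h \<in> H. h \<subseteq> S}"
  have finHS: "finite HS" by (rule finite_subset[of _ "Pow S"]) (use finS in \<open>auto simp: HS_def\<close>)
  have HS: "h \<in> residue_sets k s c" "finite h" "h \<subseteq> S" "h \<in> H" "card h = s" if "h \<in> HS" for h
  proof -
    show "h \<subseteq> S" "h \<in> H" using that by (simp_all add: HS_def)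
    then show h: "h \<in> residue_sets k s c" using R by simp
    show "finite h" "card h = s" using residue_setsD(2,3)[OF h] by simp_all
  qed
  have "{f \<in> shadow_up k H. f \<subseteq> S} = (\<lambda>x. S - {x}) ` (\<Union>h\<in>HS. S - h)"
  proof
    show "{f \<in> shadow_up k H. f \<subseteq> S} \<subseteq> (\<lambda>x. S - {x}) ` (\<Union>h\<in>HS. S - h)"
    proof
      fix f assume "f \<in> {f \<in> shadow_up k H. f \<subseteq> S}"
      then obtain h where h: "f \<subseteq> S" "h \<in> H" "h \<subseteq> f" "card f = card h + 1" by (auto simp: shadow_up_def)
      then have hS: "h \<in> HS" by (auto simp: HS_def)
      have "card (S - f) = 1" using h HS(5)[OF hS] S finS finite_subset[OF h(1)] by (simp add: card_Diff_subset)
      then obtain x where x: "S - f = {x}" by (rule card_1_singletonE)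
      then have "f = S - {x}" "x \<in> S - h" using h(1,3) by blast+
      then show "f \<in> (\<lambda>x. S - {x}) ` (\<Union>h\<in>HS. S - h)" using hS by blast
    qed
    show "(\<lambda>x. S - {x}) ` (\<Union>h\<in>HS. S - h) \<subseteq> {f \<in> shadow_up k H. f \<subseteq> S}"
    proof
      fix f assume "f \<in> (\<lambda>x. S - {x}) ` (\<Union>h\<in>HS. S - h)"
      then obtain x h where x: "f = S - {x}" "h \<in> HS" "x \<in> S" "x \<notin> h" by blast
      then have "h \<subseteq> f" "f \<subseteq> {..<k}" "f \<subseteq> S" using HS(3)[OF x(2)] S(1) by blast+
      moreover have "card f = card h + 1" using x S HS(5)[OF x(2)] finS by simp
      ultimately show "f \<in> {f \<in> shadow_up k H. f \<subseteq> S}" using HS(4)[OF x(2)] by (auto simp: shadow_up_def)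
    qed
  qed
  moreover have "inj_on (\<lambda>x. S - {x}) (\<Union>h\<in>HS. S - h)" by (rule inj_onI) blast
  ultimately have "card {f \<in> shadow_up k H. f \<subseteq> S} = card (\<Union>h\<in>HS. S - h)" by (simp add: card_image)
  also have "\<dots> = (\<Sum>h\<in>HS. card (S - h))"
  proof (rule card_UN_disjoint[OF finHS])
    show "\<forall>h\<in>HS. \<forall>g\<in>HS. h \<noteq> g \<longrightarrow> (S - h) \<inter> (S - g) = {}"
    proof (intro ballI impI)
      fix h g assume hg: "h \<in> HS" "g \<in> HS" "h \<noteq> g"
      have "h \<union> g = S"
        using residue_sets_union_card[OF HS(1)[OF hg(1)] HS(1)[OF hg(2)] hg(3)] HS(3)[OF hg(1)] HS(3)[OF hg(2)] S(2)
        by (intro card_seteq[OF finS]) simp_all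
      then show "(S - h) \<inter> (S - g) = {}" by blast
    qed
  qed (use finS in auto)
  also have "\<dots> = (\<Sum>h\<in>HS. 2)" using HS(2,3,5) S(2) by (intro sum.cong) (simp_all add: card_Diff_subset)
  also have "\<dots> = 2 * card HS" by simp
  finally have eq: "card {f \<in> shadow_up k H. f \<subseteq> S} = 2 * card HS" .
  have "card HS \<le> 2" unfolding HS_def by (rule independent_crowded_triples[OF H finS S(2)])
  then have "card HS = 0 \<or> card HS = 1 \<or> card HS = 2" by linarith
  then show ?thesis unfolding eq by auto
qed

section \<open>Blow-up\<close>

text \<open>If residues are distinct on \<open>S\<close>, the count is that of its projection.
  Otherwise let \<open>u\<close> and \<open>v\<close> share a residue: an edge inside
  \<open>S\<close> has distinct residues, so it is \<open>S - {u}\<close> or \<open>S - {v}\<close>.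
  Both have the projection of \<open>S\<close>, so both are edges or neither is.\<close>

lemma blow_up_even:
  fixes T :: "nat set set"
  assumes k: "0 < k" and T: "\<And>f. f \<in> T \<Longrightarrow> f \<subseteq> {..<k} \<and> card f = r"
    and even: "\<And>S. \<lbrakk>S \<subseteq> {..<k}; card S = r + 1\<rbrakk> \<Longrightarrow> card {f \<in> T. f \<subseteq> S} \<in> {0, 2, 4}"
  defines "\<pi> \<equiv> \<lambda>x. x mod k"
  shows "even_le4_graph r {..<k * t} {e. e \<subseteq> {..<k * t} \<and> card e = r \<and> \<pi> ` e \<in> T}" (is "even_le4_graph r ?V ?E")
  unfolding even_le4_graph_def
proof (intro conjI allI impI)
  show "r_graph r ?V ?E" by (simp add: r_graph_def)
  fix S assume "S \<subseteq> ?V \<and> card S = r + 1"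
  then have S: "S \<subseteq> ?V" "card S = r + 1" by simp_all
  have fS: "finite S" using S(1) finite_subset by blast
  have \<pi>: "\<pi> ` S \<subseteq> {..<k}" using k by (auto simp: \<pi>_def)
  have ES: "{e \<in> ?E. e \<subseteq> S} = {e. e \<subseteq> S \<and> card e = r \<and> \<pi> ` e \<in> T}" using S(1) by auto
  show "card {e \<in> ?E. e \<subseteq> S} \<in> {0, 2, 4}"
  proof (cases "inj_on \<pi> S")
    case True
    have "{f \<in> T. f \<subseteq> \<pi> ` S} = image \<pi> ` {e. e \<subseteq> S \<and> card e = r \<and> \<pi> ` e \<in> T}"
    proof
      show "{f \<in> T. f \<subseteq> \<pi> ` S} \<subseteq> image \<pi> ` {e. e \<subseteq> S \<and> card e = r \<and> \<pi> ` e \<in> T}"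
      proof
        fix f assume f: "f \<in> {f \<in> T. f \<subseteq> \<pi> ` S}"
        then obtain e where e: "e \<subseteq> S" "f = \<pi> ` e" by (auto simp: subset_image_iff)
        then have "card e = r" using f T[of f] card_image[OF inj_on_subset[OF True e(1)]] by simp
        then show "f \<in> image \<pi> ` {e. e \<subseteq> S \<and> card e = r \<and> \<pi> ` e \<in> T}" using f e by blast
      qed
    qed blast
    moreover have "inj_on (image \<pi>) {e. e \<subseteq> S \<and> card e = r \<and> \<pi> ` e \<in> T}"
      by (rule inj_on_subset[OF inj_on_image_Pow[OF True]]) blast
    ultimately have "card {e \<in> ?E. e \<subseteq> S} = card {f \<in> T. f \<subseteq> \<pi> ` S}"
      unfolding ES by (simp add: card_image)
    also have "\<dots> \<in> {0, 2, 4}" using S by (intro even \<pi>) (simp add: card_image[OF True])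
    finally show ?thesis .
  next
    case False
    then obtain u v where uv: "u \<in> S" "v \<in> S" "u \<noteq> v" "\<pi> u = \<pi> v" by (auto simp: inj_on_def)
    have img: "\<pi> ` (S - {x}) = \<pi> ` S" if "x \<in> S" "y \<in> S" "x \<noteq> y" "\<pi> x = \<pi> y" for x y
    proof -
      have "\<pi> x \<in> \<pi> ` (S - {x})" using that by (intro image_eqI[of _ _ y]) auto
      then have "insert (\<pi> x) (\<pi> ` (S - {x})) = \<pi> ` (S - {x})" by (rule insert_absorb)
      moreover have "insert x (S - {x}) = S" using that(1) by (rule insert_Diff)
      ultimately show ?thesis by (metis image_insert)
    qed
    have img: "\<pi> ` (S - {u}) = \<pi> ` S" "\<pi> ` (S - {v}) = \<pi> ` S"
      using img[OF uv] img[OF uv(2,1) uv(3)[symmetric] uv(4)[symmetric]] by simp_all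
    have e: "e \<in> {S - {u}, S - {v}}" if e: "e \<subseteq> S" "card e = r" "\<pi> ` e \<in> T" for e
    proof -
      have "card (S - e) = 1" using e S fS by (simp add: card_Diff_subset finite_subset)
      then obtain x where x: "S - e = {x}" by (rule card_1_singletonE)
      have "inj_on \<pi> e" using T[OF e(3)] e finite_subset[OF e(1) fS] by (intro eq_card_imp_inj_on) simp_all
      then have "\<not> (u \<in> e \<and> v \<in> e)" using uv(3,4) by (auto simp: inj_on_def)
      then have "u = x \<or> v = x" using x uv(1,2) by blast
      moreover have "e = S - {x}" using x e(1) by blast
      ultimately show ?thesis by blast
    qed
    have "{e. e \<subseteq> S \<and> card e = r \<and> \<pi> ` e \<in> T} = (if \<pi> ` S \<in> T then {S - {u}, S - {v}} else {})" (is "?F = _")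
    proof (cases "\<pi> ` S \<in> T")
      case True
      have "S - {u} \<in> ?F" "S - {v} \<in> ?F" using True img uv(1,2) S(2) fS by auto
      moreover have "?F \<subseteq> {S - {u}, S - {v}}" using e by blast
      ultimately have "?F = {S - {u}, S - {v}}" by blast
      then show ?thesis using True by simp
    next
      case False
      have "?F = {}"
      proof (rule equals0I)
        fix x assume x: "x \<in> ?F"
        then have "x = S - {u} \<or> x = S - {v}" using e by blast
        then have "\<pi> ` x = \<pi> ` S" using img by blast
        then show False using x False by simp
      qed
      then show ?thesis using False by simp
    qed
    moreover have "S - {u} \<noteq> S - {v}" using uv by blast
    ultimately show ?thesis unfolding ES by simp
  qed
qed

text \<open>Every vertex \<open>x\<close> of \<open>f\<close> has \<open>t\<close> independent lifts
  \<open>x + k * g x\<close>; reduction modulo \<open>k\<close> recovers \<open>f\<close>, and then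
  \<open>g\<close>.\<close>

lemma blow_up_card:
  fixes T :: "nat set set"
  assumes k: "0 < k" and T: "\<And>f. f \<in> T \<Longrightarrow> f \<subseteq> {..<k} \<and> card f = r"
  shows "card T * t ^ r \<le> card {e. e \<subseteq> {..<k * t} \<and> card e = r \<and> (\<lambda>x. x mod k) ` e \<in> T}" (is "_ \<le> card ?E")
proof -
  have finT: "finite T" by (rule finite_subset[of _ "Pow {..<k}"]) (use T in auto)
  have finf: "finite f" if "f \<in> T" for f using T[OF that] finite_subset by blast
  define P :: "(nat set \<times> (nat \<Rightarrow> nat)) set" where "P = (SIGMA f:T. PiE f (\<lambda>_. {..<t}))"
  define \<phi> where "\<phi> = (\<lambda>(f, g). (\<lambda>x. x + k * g x) ` f)"
  have mod: "(x + k * g x) mod k = x" if "f \<in> T" "x \<in> f" for f x and g :: "nat \<Rightarrow> nat"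
    using T[OF that(1)] that(2) by auto
  have img: "(\<lambda>x. x mod k) ` \<phi> (f, g) = f" if "f \<in> T" for f g
    using mod[OF that] by (simp add: \<phi>_def image_image)
  have "inj_on \<phi> P"
  proof (rule inj_onI, clarify)
    fix f g f' g' assume P: "(f, g) \<in> P" "(f', g') \<in> P" and eq: "\<phi> (f, g) = \<phi> (f', g')"
    have f: "f \<in> T" "f' \<in> T" using P by (simp_all add: P_def)
    have ff: "f = f'" using img[OF f(1), of g] img[OF f(2), of g'] eq by simp
    have "g x = g' x" if x: "x \<in> f" for x
    proof -
      have "x + k * g x \<in> \<phi> (f', g')" using x eq by (auto simp: \<phi>_def)
      then obtain y where y: "y \<in> f'" "x + k * g x = y + k * g' y" by (auto simp: \<phi>_def)
      then have "x = y" using mod[OF f(1) x, of g] mod[OF f(2) y(1), of g'] by simp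
      then show ?thesis using y(2) k by simp
    qed
    moreover have "g \<in> PiE f (\<lambda>_. {..<t})" "g' \<in> PiE f (\<lambda>_. {..<t})" using P ff by (simp_all add: P_def)
    ultimately have "g = g'" by (intro PiE_ext) auto
    then show "f = f' \<and> g = g'" using ff by simp
  qed
  moreover have "\<phi> ` P \<subseteq> ?E"
  proof clarify
    fix f g assume "(f, g) \<in> P"
    then have f: "f \<in> T" and g: "\<And>x. x \<in> f \<Longrightarrow> g x < t" by (auto simp: P_def)
    have "\<phi> (f, g) \<subseteq> {..<k * t}"
    proof
      fix z assume "z \<in> \<phi> (f, g)"
      then obtain x where x: "x \<in> f" "z = x + k * g x" by (auto simp: \<phi>_def)
      have "x < k" using T[OF f] x(1) by auto
      then have "z < k * (g x + 1)" using x(2) by simp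
      also have "\<dots> \<le> k * t" using g[OF x(1)] by (intro mult_le_mono2) simp
      finally show "z \<in> {..<k * t}" by simp
    qed
    moreover have "card (\<phi> (f, g)) = r"
    proof -
      have "inj_on (\<lambda>x. x + k * g x) f" by (rule inj_on_inverseI[where g = "\<lambda>x. x mod k"]) (rule mod[OF f])
      then show ?thesis using T[OF f] by (simp add: \<phi>_def card_image)
    qed
    ultimately show "\<phi> (f, g) \<subseteq> {..<k * t} \<and> card (\<phi> (f, g)) = r \<and> (\<lambda>x. x mod k) ` \<phi> (f, g) \<in> T"
      using img[OF f] f by simp
  qed
  moreover have "finite ?E" by (rule finite_subset[of _ "Pow {..<k * t}"]) auto
  ultimately have "card P \<le> card ?E" by (rule card_inj_on_le)
  moreover have "card P = (\<Sum>f\<in>T. card (PiE f (\<lambda>_. {..<t})))"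
    unfolding P_def using finT finf by (intro card_SigmaI) (auto intro: finite_PiE)
  moreover have "\<dots> = (\<Sum>f\<in>T. t ^ r)" using T finf by (intro sum.cong) (simp_all add: card_PiE)
  ultimately show ?thesis by simp
qed

text \<open>The limit may be taken along the multiples of \<open>k\<close>, where
  \<open>(k * t choose r) * fact r \<le> (k * t) ^ r\<close> makes the power of \<open>t\<close>
  cancel.\<close>

lemma m_le4_ge_blow_up:
  fixes T :: "nat set set"
  assumes k: "0 < k" and T: "\<And>f. f \<in> T \<Longrightarrow> f \<subseteq> {..<k} \<and> card f = r"
    and even: "\<And>S. \<lbrakk>S \<subseteq> {..<k}; card S = r + 1\<rbrakk> \<Longrightarrow> card {f \<in> T. f \<subseteq> S} \<in> {0, 2, 4}"
  shows "real (card T) * fact r / real k ^ r \<le> m_le4 r"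
proof (rule LIMSEQ_le_const)
  have "strict_mono (\<lambda>t. k * t)" using k by (simp add: strict_mono_def)
  from LIMSEQ_subseq_LIMSEQ[OF m_le4_LIMSEQ this]
  show "(\<lambda>t. real (M_le4 (k * t) r) / real (k * t choose r)) \<longlonglongrightarrow> m_le4 r" by (simp add: o_def)
  have "real (card T) * fact r / real k ^ r \<le> real (M_le4 (k * t) r) / real (k * t choose r)" if t: "r + 1 \<le> t" for t
  proof -
    have "r \<le> k * t" using t k by (metis add_leD1 le_trans mult_le_mono1 nat_mult_1 Suc_leI One_nat_def)
    then have pos: "0 < real (k * t choose r)" by simp
    have "card T * t ^ r \<le> M_le4 (k * t) r"
    proof (rule order_trans[OF blow_up_card[OF k]])
      show "card {e. e \<subseteq> {..<k * t} \<and> card e = r \<and> (\<lambda>x. x mod k) ` e \<in> T} \<le> M_le4 (k * t) r"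
        using M_le4_upper[OF blow_up_even[OF k], of T r t] T even by simp
    qed (rule T)
    then have le: "real (card T) * real t ^ r \<le> M_le4 (k * t) r" by (metis of_nat_le_iff of_nat_mult of_nat_power)
    have "(k * t choose r) * fact r \<le> (k * t) ^ r" using binomial_fact_pow by blast
    then have "real ((k * t choose r) * fact r) \<le> real ((k * t) ^ r)" by (rule of_nat_mono)
    then have "real (k * t choose r) * fact r \<le> real k ^ r * real t ^ r" by (simp add: power_mult_distrib)
    then have "real (card T) * (real (k * t choose r) * fact r) \<le> real (card T) * (real k ^ r * real t ^ r)"
      by (intro mult_left_mono) simp_all
    also have "\<dots> \<le> real k ^ r * M_le4 (k * t) r"
      using mult_left_mono[OF le, of "real k ^ r"] by (simp add: mult_ac)
    finally show ?thesis using pos k by (simp add: divide_simps mult_ac)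
  qed
  then show "\<exists>N. \<forall>t\<ge>N. real (card T) * fact r / real k ^ r \<le> real (M_le4 (k * t) r) / real (k * t choose r)" by blast
qed

text \<open>The Weierstrass product inequality.\<close>

lemma one_minus_sum_le_prod:
  fixes a :: "nat \<Rightarrow> real"
  assumes "\<And>i. i \<in> {0..<n} \<Longrightarrow> a i \<in> {0..1}"
  shows "1 - (\<Sum>i = 0..<n. a i) \<le> (\<Prod>i = 0..<n. 1 - a i)"
  using assms
proof (induction n)
  case (Suc n)
  define P where "P = (\<Prod>i = 0..<n. 1 - a i)"
  have "P \<le> 1" unfolding P_def using Suc.prems by (intro prod_le_1) auto
  moreover have "0 \<le> a n" using Suc.prems[of n] by simp
  ultimately have "P * a n \<le> 1 * a n" by (rule mult_right_mono)
  moreover have "1 - (\<Sum>i = 0..<n. a i) \<le> P" unfolding P_def using Suc by simp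
  ultimately show ?case by (simp add: P_def[symmetric] algebra_simps)
qed simp

text \<open>The ratio is the product of the factors \<open>1 - i / r ^ 2\<close> over
  \<open>i < r\<close>, and the subtracted terms sum to at most \<open>1 / 2\<close>; this is what
  fixes the size \<open>r ^ 2\<close> of the ground set.\<close>

lemma binomial_square_ge:
  assumes "1 \<le> r"
  shows "1 / 2 \<le> real (r\<^sup>2 choose r) * fact r / real (r\<^sup>2) ^ r"
proof -
  have r2: "0 < real (r\<^sup>2)" using assms by simp
  have "real (r\<^sup>2 choose r) = (\<Prod>i = 0..<r. real (r\<^sup>2) - real i) / fact r"
    by (simp only: binomial_gbinomial gbinomial_prod_rev)
  then have "real (r\<^sup>2 choose r) * fact r / real (r\<^sup>2) ^ r = (\<Prod>i = 0..<r. real (r\<^sup>2) - real i) / (\<Prod>i = 0..<r. real (r\<^sup>2))"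
    by simp
  also have "\<dots> = (\<Prod>i = 0..<r. 1 - real i / real (r\<^sup>2))"
    unfolding prod_dividef[symmetric] using r2 by (intro prod.cong) (simp_all add: diff_divide_distrib)
  also have "\<dots> \<ge> 1 - (\<Sum>i = 0..<r. real i / real (r\<^sup>2))"
  proof (rule one_minus_sum_le_prod)
    fix i assume "i \<in> {0..<r}"
    then have "real i \<le> real (r\<^sup>2)" using self_le_power[of r 2] by (simp flip: of_nat_power)
    then show "real i / real (r\<^sup>2) \<in> {0..1}" using r2 by (simp add: divide_simps)
  qed
  moreover have "(\<Sum>i = 0..<r. real i / real (r\<^sup>2)) \<le> 1 / 2"
  proof -
    have "2 * (\<Sum>i = 0..<r. i) \<le> r\<^sup>2" 
      by (induction r) (simp_all add: power2_eq_square)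
    then have "real (2 * (\<Sum>i = 0..<r. i)) \<le> real (r\<^sup>2)" by (rule of_nat_mono)
    then have "2 * (\<Sum>i = 0..<r. real i) \<le> real (r\<^sup>2)" by simp
    then show ?thesis using r2 by (simp add: sum_divide_distrib[symmetric] divide_simps)
  qed
  ultimately show ?thesis by linarith
qed

theorem corollary5:
  "\<exists>c::real. c > 0 \<and>
     (\<exists>r0::nat. \<forall>r\<ge>r0. m_le4 r \<ge> c * real r powi (-3) * sqrt (ln (real r)))"
proof (rule triple_system_independent[where 'a = "nat set"])
  fix c0 D0 :: real
  assume c0: "0 < c0" and indep:
    "\<And>(D :: real) (V :: nat set set) E. \<lbrakk>D0 \<le> D; triple_system V E; card E \<le> D * card V;
       \<And>x y. x \<noteq> y \<Longrightarrow> card {e \<in> E. x \<in> e \<and> y \<in> e} \<le> D powr (1 / 4)\<rbrakk> \<Longrightarrow>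
       \<exists>I\<subseteq>V. independent_set E I \<and> c0 * sqrt (ln D / D) * card V \<le> card I"
  \<comment> \<open>24 is \<open>6 * 2 * 2\<close>: 6 is a convenient bound for
    \<open>sqrt 32\<close>, one factor 2 comes from the residue class, the other from
    \<open>binomial_square_ge\<close>.\<close>
  have "c0 / 24 * real r powi (-3) * sqrt (ln (real r)) \<le> m_le4 r" if r: "5 \<le> r" "D0 \<le> real r" for r
  proof -
    define k s where "k = r\<^sup>2" and "s = r - 1"
    have rs: "r = s + 1" using r by (simp add: s_def)
    have k: "0 < k" "s < k" using r self_le_power[of r 2] by (auto simp: k_def s_def)
    define D where "D = 32 * real r ^ 4"
    have rr: "real r \<le> real r ^ 4" "5 \<le> real r" using r self_le_power[of "real r" 4] by auto
    have D: "D0 \<le> D" "0 < D" using rr r(2) unfolding D_def by linarith+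
    obtain c where c: "real (k choose s) / (2 * real k) \<le> card (residue_sets k s c)"
      "card (crowded_triples k s c) \<le> D * card (residue_sets k s c)"
      using good_residue_class[OF r(1)] unfolding k_def s_def D_def by metis
    have codeg: "card {t \<in> crowded_triples k s c. e \<in> t \<and> f \<in> t} \<le> D powr (1 / 4)" if "e \<noteq> f" for e f
    proof -
      have "real (card {t \<in> crowded_triples k s c. e \<in> t \<and> f \<in> t}) \<le> real r + 1"
        using of_nat_mono[OF crowded_triples_codegree[OF that, of k s c], where 'a = real] rs by simp
      also have "\<dots> \<le> 2 * real r" using rr by simp
      \<comment> \<open>The fourth power of \<open>2 * r\<close> is \<open>16 * r ^ 4\<close>, below
        \<open>D\<close>; the codegrees thus just fit the exponent \<open>1 / 4\<close>.\<close>
      also have "\<dots> = ((2 * real r) ^ 4) powr (1 / 4)"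
      proof -
        define x where "x = 2 * real r"
        have "0 < x" using rr by (simp add: x_def)
        then have "(x ^ 4) powr (1 / 4) = (x powr 4) powr (1 / 4)" by simp
        also have "\<dots> = x" using \<open>0 < x\<close> by (subst powr_powr) simp
        finally show ?thesis by (simp add: x_def)
      qed
      also have "\<dots> \<le> D powr (1 / 4)" by (intro powr_mono2) (auto simp: D_def power_mult_distrib)
      finally show ?thesis .
    qed
    obtain H where H: "H \<subseteq> residue_sets k s c" "independent_set (crowded_triples k s c) H"
      "c0 * sqrt (ln D / D) * card (residue_sets k s c) \<le> card H"
      using indep[OF D(1) crowded_triples_system c(2) codeg] by blast
    have T: "f \<subseteq> {..<k} \<and> card f = r" if "f \<in> shadow_up k H" for f
      using that H(1) residue_setsD(3) rs unfolding shadow_up_def by fastforce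
    have even: "card {f \<in> shadow_up k H. f \<subseteq> S} \<in> {0, 2, 4}" if "S \<subseteq> {..<k}" "card S = r + 1" for S
      by (rule shadow_up_even[OF H(1,2) that(1)]) (use that rs in simp)
    have "real (card (shadow_up k H)) * fact r / real k ^ r \<le> m_le4 r"
      by (rule m_le4_ge_blow_up[OF k(1) T even])
    moreover have "c0 / 24 * real r powi (-3) * sqrt (ln (real r)) \<le> real (card (shadow_up k H)) * fact r / real k ^ r"
    proof -
      define q where "q = c0 * (sqrt (ln (real r)) / (6 * (real r)\<^sup>2))"
      have lnr: "0 \<le> ln (real r)" using rr by simp
      have q: "0 \<le> q" using c0 lnr by (simp add: q_def)
      have "q \<le> c0 * sqrt (ln D / D)"
      proof -
        have "real r \<le> D" using rr unfolding D_def by linarith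
        then have "ln (real r) \<le> ln D" using rr(2) by (intro ln_mono) simp_all
        moreover have "D \<le> (6 * (real r)\<^sup>2)\<^sup>2" by (simp add: D_def power_mult_distrib)
        ultimately have "ln (real r) / (6 * (real r)\<^sup>2)\<^sup>2 \<le> ln D / D"
          using lnr D(2) by (intro frac_le) linarith+
        then have "sqrt (ln (real r) / (6 * (real r)\<^sup>2)\<^sup>2) \<le> sqrt (ln D / D)" by (rule real_sqrt_le_mono)
        moreover have "sqrt (a / y\<^sup>2) = sqrt a / y" if "0 \<le> y" for a y :: real
          using that by (simp add: real_sqrt_divide)
        ultimately have "sqrt (ln (real r)) / (6 * (real r)\<^sup>2) \<le> sqrt (ln D / D)" by (metis mult_nonneg_nonneg zero_le_numeral zero_le_power2)
        then show ?thesis unfolding q_def using c0 by (intro mult_left_mono) simp_all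
      qed
      then have "q * (real (k choose s) / (2 * real k)) \<le> c0 * sqrt (ln D / D) * card (residue_sets k s c)"
        using c(1) q by (intro mult_mono) auto
      then have "q * (real (k choose s) / (2 * real k)) \<le> card H" using H(3) by linarith
      then have "q * (real (k choose s) / (2 * real k)) * real (k - s) \<le> card H * real (k - s)"
        by (intro mult_right_mono) auto
      also have "\<dots> = card (shadow_up k H)" using shadow_up_card[OF H(1)] by simp
      finally have T1: "q * (real (k choose s) / (2 * real k)) * real (k - s) \<le> card (shadow_up k H)" .
      \<comment> \<open>The gain of a factor \<open>r\<close>: each \<open>r\<close>-set has
        \<open>r\<close> subsets of size \<open>s\<close>, but at most one of them lies in
        \<open>H\<close>.\<close>
      have "(k - s) * (k choose s) = r * (k choose r)"
        using binomial_absorption[of s k] binomial_absorb_comp[of k s] rs by simp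
      then have "real (k - s) * real (k choose s) = real r * real (k choose r)" by (metis of_nat_mult)
      then have eq: "q * (real (k choose s) / (2 * real k)) * real (k - s) = q / (2 * real k) * (real r * real (k choose r))"
        by (simp add: mult_ac)
      have T2: "q / (2 * real k) * (real r * real (k choose r)) \<le> card (shadow_up k H)"
        using T1 unfolding eq .
      have "c0 / 24 * real r powi (-3) * sqrt (ln (real r)) = q / (2 * real k) * real r * (1 / 2)"
        using rr by (simp add: q_def k_def power_int_minus divide_simps power2_eq_square power3_eq_cube)
      also have "\<dots> \<le> q / (2 * real k) * real r * (real (k choose r) * fact r / real k ^ r)"
        using binomial_square_ge[of r] r q unfolding k_def by (intro mult_left_mono) auto
      also have "\<dots> = q / (2 * real k) * (real r * real (k choose r)) * (fact r / real k ^ r)" by simp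
      also have "\<dots> \<le> card (shadow_up k H) * (fact r / real k ^ r)" using T2 by (intro mult_right_mono) auto
      finally show ?thesis by simp
    qed
    ultimately show ?thesis by (rule order_trans[rotated])
  qed
  then have "\<forall>r\<ge>max 5 (nat \<lceil>D0\<rceil>). c0 / 24 * real r powi (-3) * sqrt (ln (real r)) \<le> m_le4 r"
    by (simp add: nat_le_iff ceiling_le_iff)
  moreover have "0 < c0 / 24" using c0 by simp
  ultimately show ?thesis by blast
qed

end
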